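(* Let $n\ge 1$. Let $\varphi\colon\mathbb{R}^n\to\mathbb{R}_+\cup\{+\infty\}$ be lower semicontinuous. Let $L\colon\mathbb{R}^n\times\mathbb{R}^n\to\mathbb{R}_+$ be locally bounded and lower semicontinuous, with $L(x,\cdot)$ convex for every $x\in\mathbb{R}^n$, and suppose there exists a function $\Theta\colon\mathbb{R}^n\to\mathbb{R}_+$ with $\lim_{|u|\to\infty}\Theta(u)/|u|=+\infty$ and $L(x,u)\ge\Theta(u)$ for all $(x,u)\in\mathbb{R}^n\times\mathbb{R}^n$. Assume moreover that $L$ is continuous on $\mathbb{R}^n\times\mathbb{R}^n$. Let $H$ be the Hamiltonian and $V$ the value function associated with $L$ and $\varphi$ (defined in the context). Let $W\colon\mathbb{R}_+^\star\times\mathbb{R}^n\to\mathbb{R}_+$ be a continuous function such that: (i) ($W$ is a viscosity solution of the Hamilton-Jacobi equation $W_t+H(x,-W_x)=0$) for every $(t,x)\in\mathbb{R}_+^\star\times\mathbb{R}^n$, $$p_t+H(x,-p_x)\ge 0\quad\text{for all }(p_t,p_x)\in\partial_-W(t,x),$$ $$p_t+H(x,-p_x)\le 0\quad\text{for all }(p_t,p_x)\in\partial_+W(t,x);$$ (ii) for every $(t,x)\in\mathbb{R}_+^\star\times\mathbb{R}^n$, $D_\uparrow W(t,x)(0,0)=0$; (iii) for every $(t,x)\in\mathbb{R}_+^\star\times\mathbb{R}^n$ there exists $u\in\mathbb{R}^n$ such that $D_\uparrow W(t,x)(-1,u)<+\infty$; (iv) for every $x\in\mathbb{R}^n$, $\liminf_{h\to0+,\,y\to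 x}W(h,y)=\varphi(x)$. Then $W=V$ on $\mathbb{R}_+^\star\times\mathbb{R}^n$.
   Context: Notation: $\mathbb{R}_+=[0,+\infty)$, $\mathbb{R}_+^\star=\mathbb{R}_+\setminus\{0\}$; $\langle\cdot,\cdot\rangle$ is the Euclidean scalar product and $|\cdot|$ the Euclidean norm. The Hamiltonian is $H(x,p):=\sup_{u\in\mathbb{R}^n}\left(\langle p,u\rangle-L(x,u)\right)$ for $x,p\in\mathbb{R}^n$. The value function $V\colon\mathbb{R}_+\times\mathbb{R}^n\to\mathbb{R}_+\cup\{+\infty\}$ is $$V(t,x):=\min\left\{\int_0^tL(y(s),y'(s))\,ds+\varphi(y(t)):\ y\in W^{1,1}(0,t;\mathbb{R}^n),\ y(0)=x\right\},$$ with $V(0,x)=\varphi(x)$. Here $W^{1,1}(0,t;\mathbb{R}^n)$ is the space of absolutely continuous functions $y\colon[0,t]\to\mathbb{R}^n$. For a function $W$ of $z\in\mathbb{R}^m$ (here $m=n+1$, $z=(t,x)$) and a point $z$ at which $W$ is finite, the subdifferential is $$\partial_-W(z):=\left\{p\in\mathbb{R}^m:\ \liminf_{z'\to z}\frac{W(z')-W(z)-\langle p,z'-z\rangle}{|z'-z|}\ge0\right\},$$ the superdifferential is $\partial_+W(z):=-\partial_-(-W)(z)$, and the contingent directional derivative in the direction $w\in\mathbb{R}^m$ is $$D_\uparrow W(z)(w):=\liminf_{h\to0+,\ v\to w}\frac{W(z+hv)-W(z)}{h}\in[-\infty,+\infty].$$ *)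

theory Defs
  imports "HOL-Analysis.Analysis"
begin

definition lower_semicontinuous :: "('a::topological_space \<Rightarrow> 'b::linorder) \<Rightarrow> bool" where
  "lower_semicontinuous f \<longleftrightarrow> (\<forall>x. \<forall>c < f x. \<forall>\<^sub>F y in nhds x. c < f y)"

definition locally_bounded :: "('a::topological_space \<Rightarrow> 'b::metric_space) \<Rightarrow> bool" where
  "locally_bounded f \<longleftrightarrow> (\<forall>x. \<exists>U. open U \<and> x \<in> U \<and> bounded (f ` U))"

text \<open>A pair \<open>(a, b)\<close> in the finite set \<open>I\<close> stands for the interval from \<open>a\<close> to \<open>b\<close>.\<close>

definition absolutely_continuous_on :: "real set \<Rightarrow> (real \<Rightarrow> 'a::real_normed_vector) \<Rightarrow> bool" where
  "absolutely_continuous_on S f \<longleftrightarrow>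
    (\<forall>\<epsilon>>0. \<exists>\<delta>>0. \<forall>I :: (real \<times> real) set.
      finite I \<and> (\<forall>(a, b) \<in> I. a \<le> b \<and> {a..b} \<subseteq> S) \<and>
      disjoint_family_on (\<lambda>(a, b). {a<..<b}) I \<and>
      (\<Sum>(a, b)\<in>I. b - a) < \<delta> \<longrightarrow>
      (\<Sum>(a, b)\<in>I. norm (f b - f a)) < \<epsilon>)"

definition hamiltonian :: "('a::real_inner \<Rightarrow> 'a \<Rightarrow> real) \<Rightarrow> 'a \<Rightarrow> 'a \<Rightarrow> ereal" where
  "hamiltonian L x p = (SUP u. ereal (p \<bullet> u - L x u))"

text \<open>
  The derivative of an absolutely continuous arc exists almost everywhere on \<open>[0, t]\<close>; the
  unspecified values of \<^const>\<open>vector_derivative\<close> on the remaining null set do not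
  affect the integral. The integrand is only Lebesgue measurable in general, hence
  \<^const>\<open>lebesgue\<close> instead of \<^const>\<open>lborel\<close>. The Lagrangian is assumed nonnegative,
  so that \<^const>\<open>ennreal\<close> does not truncate.
\<close>

definition bolza_cost ::
  "('a::euclidean_space \<Rightarrow> 'a \<Rightarrow> real) \<Rightarrow> ('a \<Rightarrow> ennreal) \<Rightarrow> real \<Rightarrow> (real \<Rightarrow> 'a) \<Rightarrow> ennreal" where
  "bolza_cost L \<phi> t y =
    (\<integral>\<^sup>+ s\<in>{0..t}. ennreal (L (y s) (vector_derivative y (at s within {0..t}))) \<partial>lebesgue) + \<phi> (y t)"

text \<open>
  The value function is a minimum, not just an infimum: \<open>LEAST\<close> denotes the attained least
  cost and carries no information if the minimum is not attained. For \<open>t = 0\<close> the only cost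
  is \<open>\<phi> x\<close>.
\<close>

definition value_function ::
  "('a::euclidean_space \<Rightarrow> 'a \<Rightarrow> real) \<Rightarrow> ('a \<Rightarrow> ennreal) \<Rightarrow> real \<Rightarrow> 'a \<Rightarrow> ennreal" where
  "value_function L \<phi> t x =
    (LEAST c. \<exists>y. absolutely_continuous_on {0..t} y \<and> y 0 = x \<and> c = bolza_cost L \<phi> t y)"

text \<open>
  The next three notions only depend on \<open>W\<close> near \<open>z\<close>. They may thus be used for a function
  that is meaningful only on an open set containing \<open>z\<close>.
\<close>

definition subdifferential :: "('a::real_inner \<Rightarrow> real) \<Rightarrow> 'a \<Rightarrow> 'a set" where
  "subdifferential W z =
    {p. Liminf (at z) (\<lambda>z'. ereal ((W z' - W z - p \<bullet> (z' - z)) / norm (z' - z))) \<ge> 0}"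

definition superdifferential :: "('a::real_inner \<Rightarrow> real) \<Rightarrow> 'a \<Rightarrow> 'a set" where
  "superdifferential W z = uminus ` subdifferential (\<lambda>z'. - W z') z"

definition contingent_derivative :: "('a::real_normed_vector \<Rightarrow> real) \<Rightarrow> 'a \<Rightarrow> 'a \<Rightarrow> ereal" where
  "contingent_derivative W z w =
    Liminf (at_right 0 \<times>\<^sub>F nhds w) (\<lambda>(h, v). ereal ((W (z + h *\<^sub>R v) - W z) / h))"

end

theory Submission
  imports Defs "HOL-Complex_Analysis.Great_Picard"
begin

text \<open>
  Both inequalities are obtained from polygons.

  Along a segment, the subsolution property yields \<open>W (t, x) \<le> W (t - s, x + s u) + cost\<close> by a
  penalized maximization, hence \<open>W (t, x) \<le> cost + \<phi> (y t)\<close> for polygons. An arbitrary arc \<open>y\<close>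
  of finite cost is replaced by a polygon through points of \<open>y\<close> whose speed is capped by a large
  number \<open>R\<close>. The cap makes the polygon arrive late, but only by at most (total variation) \<open>/ R\<close>,
  and the continuity of \<open>W\<close> at \<open>(t, x)\<close> absorbs the delay as well as the shift which moves the end
  point to a place where \<open>W\<close> is close to \<open>\<phi> (y t)\<close>. No Lavrentiev phenomenon occurs because \<open>L\<close>
  does not depend on time.

  In the other direction, Euler steps for the Moreau envelope of the supersolution \<open>W\<close> produce
  polygons along which \<open>W\<close> plus the accumulated cost does not increase, up to small errors.
  Superlinearity makes them uniformly absolutely continuous. A limit arc exists by the theorem of
  Arzela and Ascoli, and Tonelli's semicontinuity argument bounds its cost by \<open>W (t, x)\<close>, so that the
  minimum defining the value function is attained and equals \<open>W (t, x)\<close>.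
\<close>

section \<open>Absolutely continuous functions\<close>

text \<open>\<open>W\<close> and \<open>L\<close> are merely continuous, so the comparison argument
  with doubled variables has no modulus to work with. Each viscosity inequality is instead exploited
  in a single direction at a time, with frozen velocity, and all estimates become estimates of
  finite sums. The cost, however, is written with \<open>vector_derivative\<close>, so increments
  and derivatives have to be linked: almost everywhere differentiability rests on the convergence in
  the mean of the dyadic slopes, and a gauge argument then recovers the arc from its derivative.
  Dyadic grids are used throughout because they are nested: a coarse slope is the average of the
  finer ones, which makes every linear term telescope.

  Near time \<open>0\<close> only a lower limit of \<open>W\<close> is known, so every polygon ends
  at a positive time. For the upper bound a favourable end point close to \<open>(0, y t)\<close>
  may be chosen; for the lower bound any end points converging to \<open>(0, g t)\<close> are good
  enough.\<close>

lemma absolutely_continuous_onE: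
  assumes "absolutely_continuous_on S f" "0 < e"
  obtains d where "0 < d"
    "\<And>I. finite I \<Longrightarrow> (\<And>a b. (a, b) \<in> I \<Longrightarrow> a \<le> b \<and> {a..b} \<subseteq> S) \<Longrightarrow>
      disjoint_family_on (\<lambda>(a, b). {a<..<b}) I \<Longrightarrow> (\<Sum>(a, b)\<in>I. b - a) < d \<Longrightarrow>
      (\<Sum>(a, b)\<in>I. norm (f b - f a)) < e"
proof -
  obtain d where d: "0 < d" and D: "\<And>I. finite I \<and> (\<forall>(a, b) \<in> I. a \<le> b \<and> {a..b} \<subseteq> S) \<and>
      disjoint_family_on (\<lambda>(a, b). {a<..<b}) I \<and> (\<Sum>(a, b)\<in>I. b - a) < d \<Longrightarrow>
      (\<Sum>(a, b)\<in>I. norm (f b - f a)) < e"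
    using assms unfolding absolutely_continuous_on_def by meson
  show ?thesis
    by (rule that[OF d]) (rule D, auto)
qed

section \<open>Dyadic grids and the slopes of dyadic interpolations\<close>

lemma grid_mono: "0 < h \<Longrightarrow> i < j \<Longrightarrow> real (Suc i) * h \<le> real j * h"
  by (intro mult_right_mono) auto

lemma grid_cell:
  assumes "0 \<le> s" "0 < h"
  shows "s \<in> {real (nat \<lfloor>s / h\<rfloor>) * h..<real (Suc (nat \<lfloor>s / h\<rfloor>)) * h}"
proof -
  have "real (nat \<lfloor>s / h\<rfloor>) = of_int \<lfloor>s / h\<rfloor>" using assms by (simp add: of_nat_nat)
  then have "real (nat \<lfloor>s / h\<rfloor>) \<le> s / h" "s / h < real (Suc (nat \<lfloor>s / h\<rfloor>))" by linarith+
  then have "real (nat \<lfloor>s / h\<rfloor>) * h \<le> s" "s < real (Suc (nat \<lfloor>s / h\<rfloor>)) * h"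
    using assms by (simp_all only: pos_le_divide_eq pos_divide_less_eq)
  then show ?thesis by simp
qed

lemma dyadic_grid_mem:
  assumes "0 < T" "i \<le> 2^n"
  shows "real i * (T / 2^n) \<in> {0..T}"
proof -
  have "real i \<le> real (2^n)" using assms(2) by (simp only: of_nat_le_iff)
  then have "real i * (T / 2^n) \<le> real (2^n) * (T / 2^n)" using assms(1) by (intro mult_right_mono) auto
  then show ?thesis using assms(1) by simp
qed

lemma dyadic_mesh_less:
  assumes "0 < d"
  obtains n0 where "\<And>n. n \<ge> n0 \<Longrightarrow> T / 2^n < (d::real)"
proof -
  obtain n0 where n0: "T / d < 2^n0" using real_arch_pow[of 2] by auto
  have "T / 2^n < d" if "n \<ge> n0" for n
  proof -
    have "(2::real)^n0 \<le> 2^n" using that by simp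
    then have "T / d < 2^n" using n0 by linarith
    then show ?thesis using assms by (simp add: field_simps)
  qed
  then show ?thesis using that by blast
qed

text \<open>The modulus \<open>d\<close> is the same for all grids, so the variation over selected
  cells is controlled by their total length \<open>card J * h\<close> alone.\<close>

lemma absolutely_continuous_on_grid:
  assumes "absolutely_continuous_on {0..T} f" "0 < e"
  obtains d where "0 < d"
    "\<And>n h J. 0 < h \<Longrightarrow> real n * h = T \<Longrightarrow> J \<subseteq> {..<n} \<Longrightarrow> real (card J) * h < d \<Longrightarrow>
      (\<Sum>i\<in>J. norm (f (real (Suc i) * h) - f (real i * h))) < e"
proof -
  obtain d where d: "0 < d" and D:
    "\<And>I. finite I \<Longrightarrow> (\<And>a b. (a, b) \<in> I \<Longrightarrow> a \<le> b \<and> {a..b} \<subseteq> {0..T}) \<Longrightarrow>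
      disjoint_family_on (\<lambda>(a, b). {a<..<b}) I \<Longrightarrow> (\<Sum>(a, b)\<in>I. b - a) < d \<Longrightarrow>
      (\<Sum>(a, b)\<in>I. norm (f b - f a)) < e"
    using absolutely_continuous_onE[OF assms] by blast
  show ?thesis
  proof (rule that[OF d])
    fix n h J assume h: "0 < h" and n: "real n * h = T" and J: "J \<subseteq> {..<n}" and c: "real (card J) * h < d"
    define F where "F = (\<lambda>i. (real i * h, real (Suc i) * h))"
    have inj: "inj_on F J" using h by (auto simp: F_def inj_on_def)
    have fin: "finite J" using J finite_subset by auto
    note sep = grid_mono[OF h]
    have "(\<Sum>(a, b)\<in>F ` J. norm (f b - f a)) < e"
    proof (rule D)
      show "finite (F ` J)" using fin by simp
      show "a \<le> b \<and> {a..b} \<subseteq> {0..T}" if ab: "(a, b) \<in> F ` J" for a b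
      proof -
        obtain i where i: "i \<in> J" "a = real i * h" "b = real (Suc i) * h" using ab by (auto simp: F_def)
        have "b \<le> T" using i J sep[of i n] n by auto
        moreover have "0 \<le> a" using i h by auto
        moreover have "a \<le> b" using i h by (auto simp: algebra_simps)
        ultimately show ?thesis by auto
      qed
      show "disjoint_family_on (\<lambda>(a, b). {a<..<b}) (F ` J)"
        unfolding disjoint_family_on_def
      proof (intro ballI impI)
        fix p q assume "p \<in> F ` J" "q \<in> F ` J" and ne: "p \<noteq> q"
        then obtain i j where ij: "p = F i" "q = F j" by auto
        then consider "i < j" | "j < i" using ne by (metis linorder_neqE_nat)
        then show "(case p of (a, b) \<Rightarrow> {a<..<b}) \<inter> (case q of (a, b) \<Rightarrow> {a<..<b}) = {}"
        proof cases
          case 1 then show ?thesis using sep[OF 1] by (auto simp: ij F_def)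
        next
          case 2 then show ?thesis using sep[OF 2] by (auto simp: ij F_def)
        qed
      qed
      have "(\<Sum>(a, b)\<in>F ` J. b - a) = (\<Sum>i\<in>J. h)"
        by (subst sum.reindex[OF inj]) (auto simp: F_def algebra_simps)
      then show "(\<Sum>(a, b)\<in>F ` J. b - a) < d" using c by simp
    qed
    also have "(\<Sum>(a, b)\<in>F ` J. norm (f b - f a)) = (\<Sum>i\<in>J. norm (f (real (Suc i) * h) - f (real i * h)))"
      by (subst sum.reindex[OF inj]) (auto simp: F_def)
    finally show "(\<Sum>i\<in>J. norm (f (real (Suc i) * h) - f (real i * h))) < e" .
  qed
qed

text \<open>For \<open>n \<le> m\<close> these are the indices of the level \<open>m\<close> cells
  inside the \<open>j\<close>-th cell of level \<open>n\<close>, that is, the \<open>i\<close> with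
  \<open>i div 2^(m-n) = j\<close>.\<close>

abbreviation dyadic_block :: "nat \<Rightarrow> nat \<Rightarrow> nat \<Rightarrow> nat set" where
  "dyadic_block n m j \<equiv> {j * 2^(m-n)..<j * 2^(m-n) + 2^(m-n)}"

lemma sum_dyadic_blocks:
  fixes g :: "nat \<Rightarrow> 'a::comm_monoid_add"
  assumes "n \<le> m"
  shows "(\<Sum>i<2^m. g i) = (\<Sum>j<2^n. \<Sum>i\<in>dyadic_block n m j. g i)"
proof -
  have "(2::nat)^m = 2^n * 2^(m-n)" using assms by (simp flip: power_add)
  then show ?thesis by (simp add: sum.nat_group)
qed

text \<open>Along the dyadic filtration these slopes form a martingale; for the integral of a
  function they are its conditional expectations.\<close>

definition dyadic_slope :: "(real \<Rightarrow> 'a::real_normed_vector) \<Rightarrow> real \<Rightarrow> nat \<Rightarrow> nat \<Rightarrow> 'a" where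
  "dyadic_slope f T n i = (f (real (Suc i) * (T / 2^n)) - f (real i * (T / 2^n))) /\<^sub>R (T / 2^n)"

lemma dyadic_slope_scale:
  "T > 0 \<Longrightarrow> (T / 2^n) *\<^sub>R dyadic_slope f T n i = f (real (Suc i) * (T / 2^n)) - f (real i * (T / 2^n))"
  by (simp add: dyadic_slope_def)

text \<open>The martingale property, obtained by telescoping: averaging the fine slopes over a
  coarse cell returns the coarse slope.\<close>

lemma dyadic_slope_block:
  assumes "T > 0" "n \<le> m"
  shows "(\<Sum>i\<in>dyadic_block n m j. (T / 2^m) *\<^sub>R dyadic_slope f T m i) =
     (T / 2^n) *\<^sub>R dyadic_slope f T n j"
proof -
  have p: "(2::real)^m = 2^n * 2^(m-n)" using assms by (simp flip: power_add)
  have "(\<Sum>i\<in>dyadic_block n m j. (T / 2^m) *\<^sub>R dyadic_slope f T m i) =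
     (\<Sum>i\<in>dyadic_block n m j. f (real (Suc i) * (T / 2^m)) - f (real i * (T / 2^m)))"
    using assms by (simp only: dyadic_slope_scale)
  also have "\<dots> = f (real (j * 2^(m-n) + 2^(m-n)) * (T / 2^m)) - f (real (j * 2^(m-n)) * (T / 2^m))"
    by (subst sum_Suc_diff') auto
  also have "\<dots> = f (real (Suc j) * (T / 2^n)) - f (real j * (T / 2^n))"
  proof -
    have "real (j * 2^(m-n) + 2^(m-n)) = real (Suc j) * 2^(m-n)" "real (j * 2^(m-n)) = real j * 2^(m-n)"
      by (simp_all add: algebra_simps)
    then show ?thesis by (simp add: p)
  qed
  finally show ?thesis using assms by (simp only: dyadic_slope_scale)
qed

text \<open>Once the mesh of level \<open>n\<close> is below the modulus for \<open>1\<close>, each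
  of its \<open>2^n\<close> cells carries variation at most \<open>1\<close> at every finer level.
  The finitely many coarser levels are absorbed by adding their sums to the constant.\<close>

lemma absolutely_continuous_on_dyadic_variation:
  assumes ac: "absolutely_continuous_on {0..T} f" and T: "T > 0"
  obtains V where "V \<ge> 0" "\<And>m. (\<Sum>i<2^m. (T / 2^m) * norm (dyadic_slope f T m i)) \<le> V"
proof -
  obtain d where d: "0 < d" and D: "\<And>n h J. 0 < h \<Longrightarrow> real n * h = T \<Longrightarrow> J \<subseteq> {..<n} \<Longrightarrow> real (card J) * h < d \<Longrightarrow>
      (\<Sum>i\<in>J. norm (f (real (Suc i) * h) - f (real i * h))) < 1"
    using absolutely_continuous_on_grid[OF ac, of 1] by auto
  obtain n where n: "T / d < 2^n" using real_arch_pow[of 2] by auto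
  have nrm: "(T / 2^m) * norm (dyadic_slope f T m i) = norm (f (real (Suc i) * (T / 2^m)) - f (real i * (T / 2^m)))" for m i
    using T by (subst dyadic_slope_scale[symmetric]) auto
  define S where "S = (\<lambda>m. \<Sum>i<2^m. (T / 2^m) * norm (dyadic_slope f T m i))"
  have S0: "S m \<ge> 0" for m using T by (auto simp: S_def intro!: sum_nonneg)
  have big: "S m \<le> 2^n" if m: "n \<le> m" for m
  proof -
    have "S m = (\<Sum>j<2^n. \<Sum>i\<in>dyadic_block n m j. (T / 2^m) * norm (dyadic_slope f T m i))"
      unfolding S_def using sum_dyadic_blocks[OF m] .
    also have "\<dots> \<le> (\<Sum>j<(2::nat)^n. 1)"
    proof (rule sum_mono)
      fix j assume j: "j \<in> {..<(2::nat)^n}"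
      have mm: "(2::nat)^m = 2^n * 2^(m-n)" using m by (simp flip: power_add)
      have pm: "(2::real)^m = 2^n * 2^(m-n)" using m by (simp flip: power_add)
      have "Suc j * 2^(m-n) \<le> (2::nat)^n * 2^(m-n)" using j by (intro mult_right_mono) auto
      then have "dyadic_block n m j \<subseteq> {..<(2::nat)^m}" by (auto simp: mm)
      moreover have "real (card (dyadic_block n m j)) * (T / 2^m) < d"
        using n d T by (simp add: pm field_simps)
      ultimately show "(\<Sum>i\<in>dyadic_block n m j. (T / 2^m) * norm (dyadic_slope f T m i)) \<le> 1"
        unfolding nrm using D[of "T / 2^m" "2^m" "dyadic_block n m j"] T by (auto simp: less_imp_le)
    qed
    finally show ?thesis by simp
  qed
  have "S m \<le> 2^n + (\<Sum>k<n. S k)" for m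
  proof (cases "n \<le> m")
    case True then show ?thesis using big[OF True] sum_nonneg[of "{..<n}" S] S0 by auto
  next
    case False
    then have "S m \<le> (\<Sum>k<n. S k)" using S0 by (intro member_le_sum) auto
    then show ?thesis by (smt (verit) zero_le_power)
  qed
  then show ?thesis using that[of "2^n + (\<Sum>k<n. S k)"] sum_nonneg[of "{..<n}" S] S0 unfolding S_def by auto
qed

text \<open>The length element of a graph of slope \<open>v\<close>. It is strictly convex, which
  detects oscillation of the slopes, but grows only linearly, so bounded variation suffices to bound
  its sums; a square would require square integrable slopes.\<close>

definition arclen :: "'a::real_inner \<Rightarrow> real" where "arclen v = sqrt (1 + (norm v)\<^sup>2)"

text \<open>The size of \<open>b\<close> is unrestricted: the Bregman distance grows linearly at infinity.\<close>

lemma arclen_bregman: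
  fixes b c :: "'a::real_inner"
  assumes R: "norm c \<le> R" and e: "e > 0"
  defines "B \<equiv> arclen b - arclen c - (c \<bullet> (b - c)) / arclen c"
  shows "0 \<le> B" "norm (b - c) \<le> e + (1 + R + e) / e * (2 * (1 + R)\<^sup>2) * B"
proof -
  define w where "w = b - c"
  define r where "r = norm w"
  define P where "P = arclen c"
  \<comment> \<open>\<open>P + s\<close> is the value at \<open>b\<close> of the affine tangent of
    \<open>arclen\<close> at \<open>c\<close>, so \<open>B\<close> is the gap above this
    tangent.\<close>
  define s where "s = (c \<bullet> w) / P"
  have b: "b = c + w" by (simp add: w_def)
  have P2: "P\<^sup>2 = 1 + (norm c)\<^sup>2" by (simp add: P_def arclen_def)
  have P1: "P \<ge> 1" by (simp add: P_def arclen_def)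
  have "sqrt (1 + (norm c)\<^sup>2) \<le> 1 + norm c" by (rule real_le_lsqrt) (auto simp: power2_eq_square algebra_simps)
  then have PR: "P \<le> 1 + R" using R by (simp add: P_def arclen_def)
  have Bdef: "B = arclen b - (P + s)" by (simp add: B_def P_def s_def w_def)
  have r0: "r \<ge> 0" by (simp add: r_def)
  have ab2: "(arclen b)\<^sup>2 = P\<^sup>2 + 2 * (c \<bullet> w) + r\<^sup>2"
  proof -
    have "(arclen b)\<^sup>2 = 1 + (norm b)\<^sup>2" by (simp add: arclen_def)
    then show ?thesis
      by (simp add: P2 b r_def power2_norm_eq_inner inner_add inner_commute)
  qed
  have cw: "c \<bullet> w = P * s" using P1 by (simp add: s_def)
  have cs: "(c \<bullet> w)\<^sup>2 \<le> (P\<^sup>2 - 1) * r\<^sup>2"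
    using Cauchy_Schwarz_ineq[of c w] by (simp add: P2 r_def power2_norm_eq_inner)
  have key: "(arclen b)\<^sup>2 - (P + s)\<^sup>2 = r\<^sup>2 - s\<^sup>2"
    unfolding ab2 cw by (simp add: power2_sum)
  have s2: "P\<^sup>2 * s\<^sup>2 \<le> (P\<^sup>2 - 1) * r\<^sup>2" using cs by (simp add: cw power_mult_distrib)
  \<comment> \<open>Cauchy-Schwarz for \<open>c \<bullet> w = P * s\<close> with
    \<open>(norm c)^2 = P^2 - 1\<close> leaves a definite share of \<open>r^2\<close> in the
    difference of squares; this is the strict convexity, made quantitative.\<close>
  have rs: "r\<^sup>2 \<le> P\<^sup>2 * (r\<^sup>2 - s\<^sup>2)" using s2 by (simp add: algebra_simps)
  have ab0: "arclen b > 0" by (simp add: arclen_def add_pos_nonneg)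
  have "0 \<le> P\<^sup>2 * (r\<^sup>2 - s\<^sup>2)" using rs zero_le_power2[of r] by linarith
  then have rs0: "0 \<le> r\<^sup>2 - s\<^sup>2" using P1 by (simp add: zero_le_mult_iff)
  then have "(P + s)\<^sup>2 \<le> (arclen b)\<^sup>2" using key by linarith
  then have le: "\<bar>P + s\<bar> \<le> arclen b" using ab0 by (metis abs_le_square_iff abs_of_pos)
  then show B0: "0 \<le> B" unfolding Bdef by simp
  have sr: "s \<le> r" using rs0 r0 by (intro power2_le_imp_le[of s r]) auto
  have "(arclen b)\<^sup>2 \<le> (P + r)\<^sup>2" using sr P1 by (simp add: ab2 cw power2_sum mult_left_mono)
  then have abr: "arclen b \<le> P + r" using P1 r0 by (intro power2_le_imp_le[of "arclen b" "P + r"]) auto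
  have "B * (arclen b + (P + s)) = (arclen b)\<^sup>2 - (P + s)\<^sup>2" by (simp add: Bdef power2_eq_square algebra_simps)
  then have "B * (arclen b + (P + s)) = r\<^sup>2 - s\<^sup>2" using key by simp
  moreover have "B * (arclen b + (P + s)) \<le> B * (2 * (P + r))"
    using abr sr B0 by (intro mult_left_mono) auto
  ultimately have "r\<^sup>2 - s\<^sup>2 \<le> B * (2 * (P + r))" by linarith
  then have "P\<^sup>2 * (r\<^sup>2 - s\<^sup>2) \<le> P\<^sup>2 * (B * (2 * (P + r)))" by (intro mult_left_mono) auto
  then have main: "r\<^sup>2 \<le> 2 * P\<^sup>2 * B * (P + r)" using rs by (simp add: algebra_simps)
  have R0: "R \<ge> 0" using R norm_ge_zero[of c] by linarith
  \<comment> \<open>A distance below \<open>e\<close> is covered by the first term. Beyond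
    \<open>e\<close> the factor \<open>P + r\<close> is at most a multiple of \<open>r\<close>, and
    one power of \<open>r\<close> cancels, leaving a linear bound.\<close>
  have "r \<le> e + (1 + R + e) / e * (2 * (1 + R)\<^sup>2) * B"
  proof (cases "r \<le> e")
    case True
    moreover have "0 \<le> (1 + R + e) / e * (2 * (1 + R)\<^sup>2) * B" using e R0 B0 by simp
    ultimately show ?thesis by linarith
  next
    case False
    have "P + r \<le> (P + e) / e * r"
    proof -
      have "P * e \<le> P * r" using False P1 by (intro mult_left_mono) auto
      then show ?thesis using e by (simp add: field_simps)
    qed
    then have "2 * P\<^sup>2 * B * (P + r) \<le> 2 * P\<^sup>2 * B * ((P + e) / e * r)" using B0 by (intro mult_left_mono) auto
    with main have "r * r \<le> ((P + e) / e * (2 * P\<^sup>2) * B) * r" by (simp add: power2_eq_square algebra_simps)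
    then have "r \<le> (P + e) / e * (2 * P\<^sup>2) * B" by (rule mult_right_le_imp_le) (use False e in auto)
    also have "\<dots> \<le> (1 + R + e) / e * (2 * (1 + R)\<^sup>2) * B"
      using PR P1 e B0 by (intro mult_right_mono mult_mono divide_right_mono power_mono) auto
    finally show ?thesis using e by linarith
  qed
  then show "norm (b - c) \<le> e + (1 + R + e) / e * (2 * (1 + R)\<^sup>2) * B" by (simp add: r_def w_def)
qed

text \<open>The lengths of the graphs of the dyadic interpolations increase and are bounded, and the
  increment between two levels is a sum of Bregman distances. This controls the cells of bounded
  slope; the cells of large slope have small total length, where absolute continuity applies.\<close>

lemma dyadic_slopes_Cauchy:
  fixes f :: "real \<Rightarrow> 'a::real_inner"
  assumes ac: "absolutely_continuous_on {0..T} f" and T: "T > 0" and e: "0 < e"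
  obtains n where "\<And>m. n \<le> m \<Longrightarrow>
    (\<Sum>i<2^m. (T / 2^m) * norm (dyadic_slope f T m i - dyadic_slope f T n (i div 2^(m-n)))) \<le> e"
proof -
  define a where "a = dyadic_slope f T"
  define h where "h = (\<lambda>m::nat. T / 2^m)"
  have h0: "h m > 0" for m using T by (simp add: h_def)
  have hm: "2^m * h m = T" for m by (simp add: h_def)
  obtain V where V0: "V \<ge> 0" and V: "\<And>m. (\<Sum>i<2^m. h m * norm (a m i)) \<le> V"
    unfolding h_def a_def using absolutely_continuous_on_dyadic_variation[OF ac T] by blast
  define Q where "Q = (\<lambda>m. \<Sum>i<2^m. h m * arclen (a m i))"
  define B where "B = (\<lambda>m n i. arclen (a m i) - arclen (a n (i div 2^(m-n))) -
      (a n (i div 2^(m-n)) \<bullet> (a m i - a n (i div 2^(m-n)))) / arclen (a n (i div 2^(m-n))))"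
  have B0: "B m n i \<ge> 0" for m n i unfolding B_def by (rule arclen_bregman(1)[OF order_refl, of 1]) simp
  have blk: "i div 2^(m-n) = j" if "i \<in> dyadic_block n m j" for i j m n :: nat
    using that by (intro div_nat_eqI) (auto simp: algebra_simps)
  have hb: "(\<Sum>i\<in>dyadic_block n m j. h m *\<^sub>R a m i) = h n *\<^sub>R a n j" if "n \<le> m" for j m n
    unfolding h_def a_def using dyadic_slope_block[OF T that] .
  have card: "real (2^(m-n)) * h m = h n" if "n \<le> m" for m n
  proof -
    have "(2::real)^m = 2^n * 2^(m-n)" using that by (simp flip: power_add)
    then show ?thesis by (simp add: h_def)
  qed
  \<comment> \<open>On each block the fine slopes average to the coarse slope, so the first order
    terms of the Bregman distances sum to zero and only the increment of \<open>Q\<close>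
    survives.\<close>
  have QB: "Q m - Q n = (\<Sum>i<2^m. h m * B m n i)" if nm: "n \<le> m" for m n
  proof -
    have "(\<Sum>i\<in>dyadic_block n m j. h m * B m n i) =
        (\<Sum>i\<in>dyadic_block n m j. h m * arclen (a m i)) - h n * arclen (a n j)" for j
    proof -
      let ?I = "dyadic_block n m j"
      have "(\<Sum>i\<in>?I. h m * B m n i) = (\<Sum>i\<in>?I. h m * arclen (a m i) - h m * arclen (a n j)
          - (a n j \<bullet> (h m *\<^sub>R a m i - h m *\<^sub>R a n j)) / arclen (a n j))"
        using blk by (intro sum.cong refl) (simp add: B_def algebra_simps diff_divide_distrib inner_diff_right)
      also have "\<dots> = (\<Sum>i\<in>?I. h m * arclen (a m i)) - (real (2^(m-n)) * h m) * arclen (a n j)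
          - (a n j \<bullet> ((\<Sum>i\<in>?I. h m *\<^sub>R a m i) - (real (2^(m-n)) * h m) *\<^sub>R a n j)) / arclen (a n j)"
        by (simp only: sum_subtractf, simp only: sum_divide_distrib[symmetric], simp only: inner_sum_right[symmetric],
            simp only: sum_subtractf, simp only: sum_constant sum_constant_scaleR[where y = "h m *\<^sub>R a n j"]
            card_atLeastLessThan, simp)
      also have "\<dots> = (\<Sum>i\<in>?I. h m * arclen (a m i)) - h n * arclen (a n j)"
        unfolding card[OF nm] hb[OF nm] by simp
      finally show ?thesis .
    qed
    then show ?thesis
      unfolding Q_def sum_dyadic_blocks[OF nm] by (simp add: sum_subtractf)
  qed
  have mono: "Q n \<le> Q m" if "n \<le> m" for n m
    using QB[OF that] sum_nonneg[of "{..<2^m}" "\<lambda>i. h m * B m n i"] B0 h0 by (simp add: less_imp_le)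
  have bdd: "Q m \<le> T + V" for m
  proof -
    have "Q m \<le> (\<Sum>i<2^m. h m + h m * norm (a m i))"
      unfolding Q_def
    proof (rule sum_mono)
      fix i
      have "arclen (a m i) \<le> 1 + norm (a m i)" unfolding arclen_def
        by (rule real_le_lsqrt) (auto simp: power2_eq_square algebra_simps)
      then show "h m * arclen (a m i) \<le> h m + h m * norm (a m i)"
        using h0[of m] mult_left_mono[of _ _ "h m"] by (fastforce simp: algebra_simps)
    qed
    also have "\<dots> \<le> T + V" using V[of m] hm[of m] by (simp add: sum.distrib)
    finally show ?thesis .
  qed
  have "Q m \<ge> 0" for m
    unfolding Q_def using h0[of m] by (intro sum_nonneg mult_nonneg_nonneg) (auto simp: arclen_def)
  then have "norm (Q m) \<le> T + V" for m using bdd[of m] by simp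
  then have "Bseq Q" by (rule BseqI')
  then have "convergent Q" using mono by (intro Bseq_mono_convergent) auto
  then have C: "Cauchy Q" by (simp add: Cauchy_convergent_iff)
  \<comment> \<open>The cells of large slope will cost \<open>2 * e'\<close> and the others
    \<open>T * e' + e'\<close>, hence the factor \<open>3 + T\<close>.\<close>
  define e' where "e' = e / (2 * (3 + T))"
  have e'0: "e' > 0" using e T by (simp add: e'_def)
  obtain d where d: "0 < d" and D: "\<And>n h J. 0 < h \<Longrightarrow> real n * h = T \<Longrightarrow> J \<subseteq> {..<n} \<Longrightarrow> real (card J) * h < d \<Longrightarrow>
      (\<Sum>i\<in>J. norm (f (real (Suc i) * h) - f (real i * h))) < e'"
    using absolutely_continuous_on_grid[OF ac e'0] by auto
  \<comment> \<open>By Chebyshev's inequality the cells of slope above \<open>R\<close> have total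
    length less than \<open>d\<close>, because \<open>V < d * R = V + 1\<close>.\<close>
  define R where "R = (V + 1) / d"
  have R0: "R > 0" using V0 d by (simp add: R_def add_nonneg_pos)
  define c where "c = (1 + R + e') / e' * (2 * (1 + R)\<^sup>2)"
  have c0: "c > 0" unfolding c_def using R0 e'0 by (intro mult_pos_pos divide_pos_pos) auto
  obtain n where n: "\<And>m k. m \<ge> n \<Longrightarrow> k \<ge> n \<Longrightarrow> dist (Q m) (Q k) < e' / c"
    using C e'0 c0 unfolding Cauchy_def by (metis divide_pos_pos)
  have Df: "(\<Sum>i\<in>J. h k * norm (a k i)) < e'" if "J \<subseteq> {..<2^k}" "real (card J) * h k < d" for J k
  proof -
    have "h k * norm (a k i) = norm (f (real (Suc i) * h k) - f (real i * h k))" for i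
      using T dyadic_slope_scale[OF T, of k f i, symmetric] h0[of k] by (simp add: h_def a_def)
    then show ?thesis using D[of "h k" "2^k" J] that h0 hm by simp
  qed
  show ?thesis
  proof (rule that)
    fix m assume nm: "n \<le> m"
    define J where "J = {j. j < 2^n \<and> norm (a n j) > R}"
    \<comment> \<open>Steepness is judged at the coarse level \<open>n\<close>; \<open>I\<close>
      collects the fine cells below steep coarse ones and has the same total length as
      \<open>J\<close>. Absolute continuity therefore makes both the fine and the coarse variation
      over it small.\<close>
    define I where "I = {i. i < 2^m \<and> i div 2^(m-n) \<in> J}"
    have finJ: "finite J" by (simp add: J_def)
    have Isub: "I \<subseteq> {..<2^m}" by (auto simp: I_def)
    have mm: "(2::nat)^m = 2^n * 2^(m-n)" using nm by (simp flip: power_add)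
    have Iun: "I = (\<Union>j\<in>J. dyadic_block n m j)"
    proof (intro set_eqI iffI)
      fix i assume i: "i \<in> I"
      have "i div 2^(m-n) * 2^(m-n) \<le> i" "i < i div 2^(m-n) * 2^(m-n) + 2^(m-n)"
        by (auto simp: div_times_less_eq_dividend) (metis add.commute dividend_less_div_times zero_less_numeral zero_less_power)
      then show "i \<in> (\<Union>j\<in>J. dyadic_block n m j)" using i unfolding I_def by (intro UN_I[of "i div 2^(m-n)"]) auto
    next
      fix i assume "i \<in> (\<Union>j\<in>J. dyadic_block n m j)"
      then obtain j where j: "j \<in> J" "i \<in> dyadic_block n m j" by auto
      have "Suc j * 2^(m-n) \<le> (2::nat)^n * 2^(m-n)" using j by (intro mult_right_mono) (auto simp: J_def)
      then have "i < 2^m" using j by (auto simp: mm)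
      then show "i \<in> I" using j blk[OF j(2)] by (simp add: I_def)
    qed
    have sumI: "(\<Sum>i\<in>I. g i) = (\<Sum>j\<in>J. \<Sum>i\<in>dyadic_block n m j. g i)" for g :: "nat \<Rightarrow> real"
      unfolding Iun
    proof (rule sum.UNION_disjoint[OF finJ])
      show "\<forall>j\<in>J. \<forall>k\<in>J. j \<noteq> k \<longrightarrow> dyadic_block n m j \<inter> dyadic_block n m k = {}"
        using blk by blast
    qed auto
    have Jd: "real (card J) * h n < d"
    proof -
      have "real (card J) * h n * R = (\<Sum>j\<in>J. h n * R)" by simp
      also have "\<dots> \<le> (\<Sum>j\<in>J. h n * norm (a n j))" using h0[of n] by (intro sum_mono mult_left_mono) (auto simp: J_def)
      also have "\<dots> \<le> (\<Sum>j<2^n. h n * norm (a n j))" using h0[of n] by (intro sum_mono2) (auto simp: J_def)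
      also have "\<dots> \<le> V" by (rule V)
      also have "V < d * R" using d by (simp add: R_def)
      finally show ?thesis using R0 by simp
    qed
    have cI: "real (card I) * h m = real (card J) * h n"
      using sumI[of "\<lambda>_. h m"] card[OF nm] by auto
    have s1: "(\<Sum>i\<in>I. h m * norm (a m i)) < e'" using Df[OF Isub] cI Jd by simp
    have "(\<Sum>i\<in>I. h m * norm (a n (i div 2^(m-n)))) = (\<Sum>j\<in>J. h n * norm (a n j))"
      unfolding sumI
    proof (rule sum.cong[OF refl])
      fix j
      have "(\<Sum>i\<in>dyadic_block n m j. h m * norm (a n (i div 2^(m-n)))) =
          (\<Sum>i\<in>dyadic_block n m j. h m * norm (a n j))"
        using blk by (intro sum.cong refl) simp
      then show "(\<Sum>i\<in>dyadic_block n m j. h m * norm (a n (i div 2^(m-n)))) = h n * norm (a n j)"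
        using card[OF nm] by simp
    qed
    also have "\<dots> < e'" using Df[of J n] Jd by (simp add: J_def subset_iff)
    finally have s2: "(\<Sum>i\<in>I. h m * norm (a n (i div 2^(m-n)))) < e'" .
    have "(\<Sum>i\<in>I. h m * norm (a m i - a n (i div 2^(m-n)))) \<le> (\<Sum>i\<in>I. h m * norm (a m i) + h m * norm (a n (i div 2^(m-n))))"
      using h0[of m] norm_triangle_ineq4 by (intro sum_mono) (simp flip: distrib_left)
    also have "\<dots> \<le> 2 * e'" using s1 s2 by (simp add: sum.distrib)
    finally have part1: "(\<Sum>i\<in>I. h m * norm (a m i - a n (i div 2^(m-n)))) \<le> 2 * e'" .
    have "(\<Sum>i\<in>{..<2^m} - I. h m * norm (a m i - a n (i div 2^(m-n)))) \<le> (\<Sum>i\<in>{..<2^m} - I. h m * e' + c * (h m * B m n i))"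
    proof (rule sum_mono)
      fix i assume i: "i \<in> {..<2^m} - I"
      then have "i div 2^(m-n) < 2^n" using nm by (simp add: less_mult_imp_div_less mm)
      then have "norm (a n (i div 2^(m-n))) \<le> R" using i by (auto simp: I_def J_def)
      then have "norm (a m i - a n (i div 2^(m-n))) \<le> e' + c * B m n i"
        unfolding c_def B_def by (rule arclen_bregman(2)[OF _ e'0])
      then show "h m * norm (a m i - a n (i div 2^(m-n))) \<le> h m * e' + c * (h m * B m n i)"
        using h0[of m] mult_left_mono[of _ _ "h m"] by (fastforce simp: algebra_simps)
    qed
    also have "\<dots> \<le> (\<Sum>i<2^m. h m * e' + c * (h m * B m n i))"
      using h0[of m] e'0 c0 B0 by (intro sum_mono2) (auto intro!: add_nonneg_nonneg mult_nonneg_nonneg simp: less_imp_le)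
    also have "\<dots> = T * e' + c * (Q m - Q n)"
      using hm[of m] by (simp add: QB[OF nm] sum.distrib sum_distrib_left flip: mult.assoc)
    also have "\<dots> \<le> T * e' + e'"
    proof -
      have "Q m - Q n \<le> e' / c" using n[of m n] nm by (simp add: dist_real_def)
      then show ?thesis using c0 by (simp add: field_simps)
    qed
    finally have part2: "(\<Sum>i\<in>{..<2^m} - I. h m * norm (a m i - a n (i div 2^(m-n)))) \<le> T * e' + e'" .
    have "(\<Sum>i<2^m. h m * norm (a m i - a n (i div 2^(m-n)))) \<le> (T * e' + e') + 2 * e'"
      using part1 part2 sum.subset_diff[OF Isub, of "\<lambda>i. h m * norm (a m i - a n (i div 2^(m-n)))"] by simp
    also have "\<dots> = (3 + T) * e'" by (simp add: algebra_simps)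
    also have "\<dots> \<le> e" using e T by (simp add: e'_def field_simps)
    finally show "(\<Sum>i<2^m. (T / 2^m) * norm (dyadic_slope f T m i - dyadic_slope f T n (i div 2^(m-n)))) \<le> e"
      by (simp add: h_def a_def)
  qed
qed

text \<open>The mean estimate for slopes becomes a bound for the variation of \<open>f\<close> minus
  its \<open>n\<close>-th interpolation over arbitrary disjoint intervals, each inside one cell of
  level \<open>n\<close>: the intervals are approximated by grid intervals of level
  \<open>m\<close>, and continuity of \<open>f\<close> allows \<open>m\<close> to tend to
  infinity.\<close>

lemma dyadic_slope_variation_bound:
  fixes f :: "real \<Rightarrow> 'a::real_normed_vector"
  assumes cont: "continuous_on {0..T} f" and T: "T > 0"
    and C: "\<And>m. n \<le> m \<Longrightarrow>
      (\<Sum>i<2^m. (T / 2^m) * norm (dyadic_slope f T m i - dyadic_slope f T n (i div 2^(m-n)))) \<le> e"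
    and fin: "finite I"
    and less: "\<And>a b. (a, b) \<in> I \<Longrightarrow> a < b"
    and cell: "\<And>a b. (a, b) \<in> I \<Longrightarrow> j (a, b) < 2^n \<and> real (j (a, b)) * (T / 2^n) \<le> a \<and> b \<le> real (Suc (j (a, b))) * (T / 2^n)"
    and disj: "disjoint_family_on (\<lambda>(a, b). {a<..<b}) I"
  shows "(\<Sum>(a, b)\<in>I. norm (f b - f a - (b - a) *\<^sub>R dyadic_slope f T n (j (a, b)))) \<le> e"
proof -
  define h where "h = (\<lambda>m::nat. T / 2^m)"
  have h0: "h m > 0" for m using T by (simp add: h_def)
  have hlim: "h \<longlonglongrightarrow> 0" unfolding h_def by (rule LIMSEQ_divide_realpow_zero) simp
  define v where "v = (\<lambda>p. dyadic_slope f T n (j p))"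
  \<comment> \<open>End points are rounded inwards, up on the left and down on the right, so that
    the approximating grid intervals stay inside the given ones and thus remain disjoint.\<close>
  define lo where "lo = (\<lambda>m (p::real\<times>real). nat \<lceil>fst p / h m\<rceil>)"
  define hi where "hi = (\<lambda>m (p::real\<times>real). nat \<lfloor>snd p / h m\<rfloor>)"
  have cellT: "real (Suc i) * (T / 2^n) \<le> T" if "i < 2^n" for i
    using dyadic_grid_mem[OF T, of "Suc i" n] that by simp
  have I0: "0 \<le> fst p" "fst p < snd p" "snd p \<le> T" if "p \<in> I" for p
  proof -
    obtain a b where p: "p = (a, b)" by force
    show "fst p < snd p" using less that p by simp
    have "0 \<le> real (j (a, b)) * (T / 2^n)" using T by simp
    then show "0 \<le> fst p" using cell[of a b] that p by auto
    show "snd p \<le> T" using cell[of a b] that p cellT[of "j (a,b)"] by auto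
  qed
  have lo: "fst p \<le> real (lo m p) * h m" "real (lo m p) * h m < fst p + h m" if "p \<in> I" for p m
  proof -
    have 0: "0 \<le> fst p / h m" using I0[OF that] h0[of m] by simp
    then have "real (lo m p) = of_int \<lceil>fst p / h m\<rceil>" unfolding lo_def by (simp add: of_nat_nat)
    then have "fst p / h m \<le> real (lo m p)" "real (lo m p) < fst p / h m + 1" by linarith+
    then show "fst p \<le> real (lo m p) * h m" "real (lo m p) * h m < fst p + h m"
      using h0[of m] by (simp_all add: field_simps)
  qed
  have hi: "real (hi m p) * h m \<le> snd p" "snd p - h m < real (hi m p) * h m" if "p \<in> I" for p m
  proof -
    have 0: "0 \<le> snd p / h m" using I0[OF that] h0[of m] by simp
    then have "real (hi m p) = of_int \<lfloor>snd p / h m\<rfloor>" unfolding hi_def by (simp add: of_nat_nat)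
    then have "real (hi m p) \<le> snd p / h m" "snd p / h m - 1 < real (hi m p)" by linarith+
    then show "real (hi m p) * h m \<le> snd p" "snd p - h m < real (hi m p) * h m"
      using h0[of m] by (simp_all add: field_simps)
  qed
  have lolim: "(\<lambda>m. real (lo m p) * h m) \<longlonglongrightarrow> fst p" if "p \<in> I" for p
  proof (rule tendsto_sandwich[of "\<lambda>_. fst p" _ sequentially "\<lambda>m. fst p + h m"])
    show "(\<lambda>m. fst p + h m) \<longlonglongrightarrow> fst p" using tendsto_add[OF tendsto_const hlim, of "fst p"] by simp
  qed (use lo[OF that] in \<open>auto intro!: always_eventually less_imp_le\<close>)
  have hilim: "(\<lambda>m. real (hi m p) * h m) \<longlonglongrightarrow> snd p" if "p \<in> I" for p
  proof (rule tendsto_sandwich[of "\<lambda>m. snd p - h m" _ sequentially "\<lambda>_. snd p"])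
    show "(\<lambda>m. snd p - h m) \<longlonglongrightarrow> snd p" using tendsto_diff[OF tendsto_const hlim, of "snd p"] by simp
  qed (use hi[OF that] in \<open>auto intro!: always_eventually less_imp_le\<close>)
  have ord: "\<forall>\<^sub>F m in sequentially. real (lo m p) * h m < real (hi m p) * h m" if "p \<in> I" for p
    using order_tendstoD(1)[OF tendsto_diff[OF hilim[OF that] lolim[OF that]], of 0] I0[OF that] by simp
  have flo: "(\<lambda>m. f (real (lo m p) * h m)) \<longlonglongrightarrow> f (fst p)" if p: "p \<in> I" for p
  proof (rule continuous_on_tendsto_compose[OF cont lolim[OF p]])
    show "\<forall>\<^sub>F m in sequentially. real (lo m p) * h m \<in> {0..T}"
      using ord[OF p]
    proof eventually_elim
      case (elim m)
      then show ?case using hi(1)[OF p, of m] lo(1)[OF p, of m] I0[OF p] by auto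
    qed
  qed (use I0[OF p] in auto)
  have fhi: "(\<lambda>m. f (real (hi m p) * h m)) \<longlonglongrightarrow> f (snd p)" if p: "p \<in> I" for p
  proof (rule continuous_on_tendsto_compose[OF cont hilim[OF p]])
    show "\<forall>\<^sub>F m in sequentially. real (hi m p) * h m \<in> {0..T}"
    proof (rule always_eventually, rule allI)
      fix m
      have "0 \<le> real (hi m p) * h m" using h0[of m] by (intro mult_nonneg_nonneg) auto
      then show "real (hi m p) * h m \<in> {0..T}" using hi(1)[OF p, of m] I0[OF p] by auto
    qed
  qed (use I0[OF p] in auto)
  define G where "G = (\<lambda>m p. norm (f (real (hi m p) * h m) - f (real (lo m p) * h m)
       - (real (hi m p) * h m - real (lo m p) * h m) *\<^sub>R v p))"
  have Glim: "(\<lambda>m. \<Sum>p\<in>I. G m p) \<longlonglongrightarrow> (\<Sum>p\<in>I. norm (f (snd p) - f (fst p) - (snd p - fst p) *\<^sub>R v p))"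
    unfolding G_def by (intro tendsto_sum tendsto_norm tendsto_diff tendsto_scaleR tendsto_const flo fhi lolim hilim)
  have "\<forall>\<^sub>F m in sequentially. (\<Sum>p\<in>I. G m p) \<le> e"
  proof -
    have "\<forall>\<^sub>F m in sequentially. \<forall>p\<in>I. real (lo m p) * h m < real (hi m p) * h m"
      using ord fin by (simp add: eventually_ball_finite)
    moreover have "\<forall>\<^sub>F m in sequentially. n \<le> m" by (rule eventually_ge_at_top)
    ultimately show ?thesis
    proof eventually_elim
      case (elim m)
      define s where "s = (\<lambda>i. norm (dyadic_slope f T m i - dyadic_slope f T n (i div 2^(m-n))))"
      have pm: "(2::real)^m = 2^n * 2^(m-n)" using elim by (simp flip: power_add)
      have hnm: "h n = 2^(m-n) * h m" using pm T by (simp add: h_def)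
      have lh: "lo m p \<le> hi m p" if "p \<in> I" for p using elim(1) that h0[of m] by (auto simp: less_imp_le)
      have rng: "fst p \<le> real i * h m" "real (Suc i) * h m \<le> snd p" if "p \<in> I" "i \<in> {lo m p..<hi m p}" for p i
      proof -
        have "real (lo m p) * h m \<le> real i * h m" using that h0[of m] by (intro mult_right_mono) auto
        then show "fst p \<le> real i * h m" using lo(1)[OF that(1), of m] by linarith
        have "real (Suc i) * h m \<le> real (hi m p) * h m" using that h0[of m] by (intro mult_right_mono) auto
        then show "real (Suc i) * h m \<le> snd p" using hi(1)[OF that(1), of m] by linarith
      qed
      have divj: "i div 2^(m-n) = j p" if p: "p \<in> I" and i: "i \<in> {lo m p..<hi m p}" for p i
      proof -
        have c: "real (j p) * h n \<le> fst p" "snd p \<le> real (Suc (j p)) * h n"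
          using cell[of "fst p" "snd p"] p by (auto simp: h_def)
        have "real (j p) * h n \<le> real i * h m" using c rng[OF p i] by linarith
        then have "real (j p * 2^(m-n)) * h m \<le> real i * h m" by (simp add: hnm algebra_simps)
        then have "real (j p * 2^(m-n)) \<le> real i" using h0[of m] by (simp only: mult_le_cancel_right_pos)
        then have 1: "j p * 2^(m-n) \<le> i" by (simp only: of_nat_le_iff)
        have "real (Suc i) * h m \<le> real (Suc (j p)) * h n" using c rng[OF p i] by linarith
        then have "real (Suc i) * h m \<le> real (Suc (j p) * 2^(m-n)) * h m" by (simp add: hnm algebra_simps)
        then have "real (Suc i) \<le> real (Suc (j p) * 2^(m-n))" using h0[of m] by (simp only: mult_le_cancel_right_pos)
        then have "Suc i \<le> Suc (j p) * 2^(m-n)" by (simp only: of_nat_le_iff)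
        with 1 show ?thesis by (intro div_nat_eqI) (auto simp: algebra_simps)
      qed
      have "G m p \<le> (\<Sum>i\<in>{lo m p..<hi m p}. h m * s i)" if p: "p \<in> I" for p
      proof -
        have e1: "f (real (hi m p) * h m) - f (real (lo m p) * h m) = (\<Sum>i\<in>{lo m p..<hi m p}. f (real (Suc i) * h m) - f (real i * h m))"
          using lh[OF p] by (subst sum_Suc_diff') auto
        have e2: "\<dots> = (\<Sum>i\<in>{lo m p..<hi m p}. h m *\<^sub>R dyadic_slope f T m i)"
          unfolding h_def by (simp only: dyadic_slope_scale[OF T])
        have e3: "(real (hi m p) * h m - real (lo m p) * h m) *\<^sub>R v p = (\<Sum>i\<in>{lo m p..<hi m p}. h m *\<^sub>R v p)"
          using lh[OF p] by (simp add: sum_constant_scaleR of_nat_diff algebra_simps)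
        have "G m p = norm (\<Sum>i\<in>{lo m p..<hi m p}. h m *\<^sub>R (dyadic_slope f T m i - v p))"
          unfolding G_def e1 e2 e3 by (simp add: scaleR_diff_right sum_subtractf)
        also have "\<dots> \<le> (\<Sum>i\<in>{lo m p..<hi m p}. norm (h m *\<^sub>R (dyadic_slope f T m i - v p)))" by (rule norm_sum)
        also have "\<dots> = (\<Sum>i\<in>{lo m p..<hi m p}. h m * s i)"
          using h0[of m] divj[OF p] by (intro sum.cong refl) (simp add: s_def v_def)
        finally show ?thesis .
      qed
      then have "(\<Sum>p\<in>I. G m p) \<le> (\<Sum>p\<in>I. \<Sum>i\<in>{lo m p..<hi m p}. h m * s i)" by (rule sum_mono)
      also have "\<dots> = (\<Sum>i\<in>(\<Union>p\<in>I. {lo m p..<hi m p}). h m * s i)"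
      proof (rule sum.UNION_disjoint[OF fin, symmetric])
        show "\<forall>p\<in>I. \<forall>q\<in>I. p \<noteq> q \<longrightarrow> {lo m p..<hi m p} \<inter> {lo m q..<hi m q} = {}"
        proof (intro ballI impI)
          fix p q assume pq: "p \<in> I" "q \<in> I" "p \<noteq> q"
          show "{lo m p..<hi m p} \<inter> {lo m q..<hi m q} = {}"
          proof (rule ccontr)
            assume "\<not> ?thesis"
            then obtain i where i: "i \<in> {lo m p..<hi m p}" "i \<in> {lo m q..<hi m q}" by blast
            \<comment> \<open>The midpoint of a shared fine cell would lie in two of the disjoint
              open intervals.\<close>
            define x where "x = real i * h m + h m / 2"
            have "real i * h m < x" "x < real (Suc i) * h m" using h0[of m] by (auto simp: x_def algebra_simps)
            then have "x \<in> {fst p<..<snd p}" "x \<in> {fst q<..<snd q}"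
              using rng[OF pq(1) i(1)] rng[OF pq(2) i(2)] by auto
            then show False using disj pq unfolding disjoint_family_on_def by (fastforce simp: case_prod_beta)
          qed
        qed
      qed auto
      also have "\<dots> \<le> (\<Sum>i<2^m. h m * s i)"
      proof (rule sum_mono2)
        show "(\<Union>p\<in>I. {lo m p..<hi m p}) \<subseteq> {..<2^m}"
        proof
          fix i assume "i \<in> (\<Union>p\<in>I. {lo m p..<hi m p})"
          then obtain p where p: "p \<in> I" "i \<in> {lo m p..<hi m p}" by auto
          have "real (Suc i) * h m \<le> T" using rng(2)[OF p] I0(3)[OF p(1)] by linarith
          then have "real (Suc i) * h m \<le> real (2^m) * h m" by (simp add: h_def)
          then have "real (Suc i) \<le> real (2^m)" using h0[of m] by (simp only: mult_le_cancel_right_pos)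
          then have "Suc i \<le> 2^m" by (simp only: of_nat_le_iff)
          then show "i \<in> {..<2^m}" by simp
        qed
      qed (use h0[of m] in \<open>auto simp: s_def intro!: mult_nonneg_nonneg\<close>)
      also have "\<dots> \<le> e" using C[OF elim(2)] by (simp add: h_def s_def)
      finally show ?case .
    qed
  qed
  from tendsto_upperbound[OF Glim this] show ?thesis
    by (simp add: v_def case_prod_beta)
qed

section \<open>Variation over arbitrary intervals, differentiability almost everywhere, and the
  fundamental theorem\<close>

lemma sum_interval_lengths_le_measure:
  assumes fin: "finite I" and le: "\<And>a b. (a, b) \<in> I \<Longrightarrow> a \<le> b \<and> {a<..<b} \<subseteq> U"
    and disj: "disjoint_family_on (\<lambda>(a, b). {a<..<b}) I" and U: "U \<in> lmeasurable"
  shows "(\<Sum>(a, b)\<in>I. b - a) \<le> measure lebesgue U"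
proof -
  have "(\<Sum>(a, b)\<in>I. b - a) = (\<Sum>p\<in>I. measure lebesgue (case p of (a, b) \<Rightarrow> {a<..<b}))"
    using le by (intro sum.cong refl) (fastforce simp: measure_completion)
  also have "\<dots> = measure lebesgue (\<Union>p\<in>I. case p of (a, b) \<Rightarrow> {a<..<b})"
    by (rule measure_finite_Union[symmetric, OF fin _ disj]) (use le in fastforce)+
  also have "\<dots> \<le> measure lebesgue U"
    using le fin by (intro measure_mono_fmeasurable[OF _ _ U]) (auto intro!: sets.finite_UN)
  finally show ?thesis .
qed

lemma absolutely_continuous_on_imp_continuous_on:
  assumes ac: "absolutely_continuous_on {a..b} f"
  shows "continuous_on {a..b} f"
  unfolding continuous_on_iff
proof (intro ballI allI impI)
  fix x e :: real assume x: "x \<in> {a..b}" and e: "0 < e"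
  obtain d where d: "0 < d" and D: "\<And>I. finite I \<Longrightarrow> (\<And>u v. (u, v) \<in> I \<Longrightarrow> u \<le> v \<and> {u..v} \<subseteq> {a..b}) \<Longrightarrow>
      disjoint_family_on (\<lambda>(a, b). {a<..<b}) I \<Longrightarrow> (\<Sum>(a, b)\<in>I. b - a) < d \<Longrightarrow>
      (\<Sum>(a, b)\<in>I. norm (f b - f a)) < e"
    using absolutely_continuous_onE[OF ac e] by blast
  have *: "norm (f v - f u) < e" if "u \<in> {a..b}" "v \<in> {a..b}" "u \<le> v" "v - u < d" for u v
    using D[of "{(u, v)}"] that by (auto simp: disjoint_family_on_def)
  have "dist (f y) (f x) < e" if "y \<in> {a..b}" "dist y x < d" for y
    using *[of x y] *[of y x] that x by (cases "x \<le> y") (auto simp: dist_norm norm_minus_commute)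
  then show "\<exists>d>0. \<forall>y\<in>{a..b}. dist y x < d \<longrightarrow> dist (f y) (f x) < e" using d by blast
qed

text \<open>At level \<open>0\<close> the interpolation is the chord over the whole of
  \<open>{0..T}\<close>. The previous bound applies to \<open>f\<close> minus this chord with the
  single cell \<open>0\<close>, and the variation of the chord is added. The outcome is the
  hypothesis of the integrability criterion for the derivative.\<close>

lemma absolutely_continuous_on_variation:
  fixes f :: "real \<Rightarrow> 'a::real_inner"
  assumes ac: "absolutely_continuous_on {0..T} f" and T: "T > 0"
  obtains V where "\<And>I. finite I \<Longrightarrow> (\<And>a b. (a, b) \<in> I \<Longrightarrow> a < b \<and> {a..b} \<subseteq> {0..T}) \<Longrightarrow>
      disjoint_family_on (\<lambda>(a, b). {a<..<b}) I \<Longrightarrow> (\<Sum>(a, b)\<in>I. norm (f b - f a)) \<le> V"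
proof -
  obtain V where V: "V \<ge> 0" "\<And>m. (\<Sum>i<2^m. (T / 2^m) * norm (dyadic_slope f T m i)) \<le> V"
    using absolutely_continuous_on_dyadic_variation[OF ac T] by blast
  let ?s = "dyadic_slope f T 0 0"
  have C: "(\<Sum>i<2^m. (T / 2^m) * norm (dyadic_slope f T m i - dyadic_slope f T 0 (i div 2^(m-0)))) \<le> V + T * norm ?s" for m
  proof -
    have "(\<Sum>i<2^m. (T / 2^m) * norm (dyadic_slope f T m i - dyadic_slope f T 0 (i div 2^(m-0)))) \<le>
        (\<Sum>i<2^m. (T / 2^m) * norm (dyadic_slope f T m i) + (T / 2^m) * norm ?s)"
    proof (rule sum_mono)
      fix i assume "i \<in> {..<(2::nat)^m}"
      then have "i div 2^(m-0) = 0" by simp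
      then show "(T / 2^m) * norm (dyadic_slope f T m i - dyadic_slope f T 0 (i div 2^(m-0)))
          \<le> (T / 2^m) * norm (dyadic_slope f T m i) + (T / 2^m) * norm ?s"
        using T mult_left_mono[OF norm_triangle_ineq4[of "dyadic_slope f T m i" ?s], of "T / 2^m"]
        by (simp add: algebra_simps add_divide_distrib)
    qed
    also have "\<dots> \<le> V + T * norm ?s" using V(2)[of m] by (simp add: sum.distrib)
    finally show ?thesis .
  qed
  show ?thesis
  proof (rule that)
    fix I assume fin: "finite I" and I: "\<And>a b. (a, b) \<in> I \<Longrightarrow> a < b \<and> {a..b} \<subseteq> {0..T}"
      and disj: "disjoint_family_on (\<lambda>(a, b). {a<..<b}) I"
    have "(\<Sum>(a, b)\<in>I. norm (f b - f a - (b - a) *\<^sub>R ?s)) \<le> V + T * norm ?s"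
      using dyadic_slope_variation_bound[OF absolutely_continuous_on_imp_continuous_on[OF ac] T C fin, of "\<lambda>_. 0"] I disj
      by (fastforce simp: atLeastatMost_subset_iff)
    moreover have "(\<Sum>(a, b)\<in>I. (b - a) * norm ?s) \<le> T * norm ?s"
    proof -
      have "(\<Sum>(a, b)\<in>I. b - a) \<le> measure lebesgue {0..T}"
        using I by (intro sum_interval_lengths_le_measure[OF fin _ disj]) force+
      then show ?thesis using T by (simp add: case_prod_beta mult_right_mono flip: sum_distrib_right)
    qed
    moreover have "(\<Sum>(a, b)\<in>I. norm (f b - f a)) \<le>
       (\<Sum>(a, b)\<in>I. norm (f b - f a - (b - a) *\<^sub>R ?s) + (b - a) * norm ?s)"
    proof (rule sum_mono, clarify)
      fix a b assume "(a, b) \<in> I"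
      then have "a < b" using I by blast
      then show "norm (f b - f a) \<le> norm (f b - f a - (b - a) *\<^sub>R ?s) + (b - a) * norm ?s"
        using norm_triangle_ineq[of "f b - f a - (b - a) *\<^sub>R ?s" "(b - a) *\<^sub>R ?s"] by simp
    qed
    ultimately show "(\<Sum>(a, b)\<in>I. norm (f b - f a)) \<le> V + 2 * T * norm ?s"
      by (simp add: case_prod_beta sum.distrib)
  qed
qed

text \<open>Differentiability up to a tolerance \<open>c\<close>, tested on all short intervals that
  contain \<open>x\<close> and not only on those that start or end there. This is the form in which
  violating intervals make a Vitali cover.\<close>

definition straddled :: "(real \<Rightarrow> 'a::real_normed_vector) \<Rightarrow> real \<Rightarrow> real \<Rightarrow> real \<Rightarrow> 'a \<Rightarrow> bool" where
  "straddled f T c x v \<longleftrightarrow> (\<exists>d>0. \<forall>a b. 0 \<le> a \<and> a \<le> x \<and> x \<le> b \<and> b \<le> T \<and> b - a < d \<longrightarrow>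
     norm (f b - f a - (b - a) *\<^sub>R v) \<le> c * (b - a))"

text \<open>A weak type estimate: by the Vitali covering theorem, the set where \<open>f\<close> minus its \<open>n\<close>-th dyadic
  interpolation has difference quotients larger than \<open>c\<close> at arbitrarily small scales has measure
  at most the variation of that difference divided by \<open>c\<close>.\<close>

lemma negligible_not_straddled:
  fixes f :: "real \<Rightarrow> 'a::real_inner"
  assumes ac: "absolutely_continuous_on {0..T} f" and T: "T > 0" and c: "c > 0"
  shows "negligible {x \<in> {0..T}. \<not> (\<exists>v. straddled f T c x v)}"
  unfolding negligible_outer_le
proof (intro allI impI)
  fix e :: real assume e: "e > 0"
  let ?N = "{x \<in> {0..T}. \<not> (\<exists>v. straddled f T c x v)}"
  obtain n where n: "\<And>m. n \<le> m \<Longrightarrow>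
    (\<Sum>i<2^m. (T / 2^m) * norm (dyadic_slope f T m i - dyadic_slope f T n (i div 2^(m-n)))) \<le> c * e"
    using dyadic_slopes_Cauchy[OF ac T, of "c * e"] c e by auto
  define h where "h = T / 2^n"
  have h0: "h > 0" using T by (simp add: h_def)
  have hn: "2^n * h = T" by (simp add: h_def)
  \<comment> \<open>Around a grid point of level \<open>n\<close> no short interval stays within one
    cell; these points are finitely many and may be discarded.\<close>
  define G where "G = (\<lambda>j::nat. real j * h) ` {..2^n}"
  \<comment> \<open>The violating intervals at level \<open>n\<close>. A point that is not straddled
    rejects every candidate slope, in particular that of its own cell, so it lies in arbitrarily
    short members of \<open>K\<close>.\<close>
  define K where "K = {(a, b). a < b \<and> (\<exists>j<2^n. real j * h \<le> a \<and> b \<le> real (Suc j) * h \<and>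
      c * (b - a) < norm (f b - f a - (b - a) *\<^sub>R dyadic_slope f T n j))}"
  let ?a = "\<lambda>p::real\<times>real. (fst p + snd p) / 2" and ?r = "\<lambda>p::real\<times>real. (snd p - fst p) / 2"
  have ball: "cball (?a p) (?r p) = {fst p..snd p}" for p
    by (auto simp: cball_eq_atLeastAtMost field_simps)
  have Kless: "a < b" if "(a, b) \<in> K" for a b using that by (auto simp: K_def)
  obtain C where C: "countable C" "C \<subseteq> K"
     "pairwise (\<lambda>i j. disjnt (cball (?a i) (?r i)) (cball (?a j) (?r j))) C"
     "negligible ((?N - G) - (\<Union>i \<in> C. cball (?a i) (?r i)))"
  proof (rule Vitali_covering_theorem_cballs[of K ?r "?N - G" ?a])
    show "0 < ?r p" if "p \<in> K" for p using Kless[of "fst p" "snd p"] that by simp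
  next
    fix x d assume x: "x \<in> ?N - G" and d: "0 < (d::real)"
    define j where "j = nat \<lfloor>x / h\<rfloor>"
    have x0: "0 \<le> x" "x \<le> T" using x by auto
    have j1: "real j * h \<le> x" "x < real (Suc j) * h" using grid_cell[OF x0(1) h0] unfolding j_def by auto
    have j2: "j < 2^n"
    proof (rule ccontr)
      assume "\<not> j < 2^n"
      then have "2^n \<le> j" by simp
      then have "real (2^n) \<le> real j" by (simp only: of_nat_le_iff)
      then have "real (2^n) * h \<le> real j * h" using h0 by (intro mult_right_mono) auto
      then have "T \<le> real j * h" using hn by simp
      then have "x = real (2^n) * h" using j1 x0 hn by simp
      then have "x \<in> G" unfolding G_def by blast
      then show False using x by simp
    qed
    have "x \<noteq> real j * h" using x j2 by (auto simp: G_def)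
    then have j3: "real j * h < x" using j1 by simp
    define d' where "d' = min d (min (x - real j * h) (real (Suc j) * h - x))"
    have d': "d' > 0" using d j1 j3 by (simp add: d'_def)
    have "\<not> straddled f T c x (dyadic_slope f T n j)" using x by auto
    then obtain a b where ab: "0 \<le> a" "a \<le> x" "x \<le> b" "b \<le> T" "b - a < d'"
        "c * (b - a) < norm (f b - f a - (b - a) *\<^sub>R dyadic_slope f T n j)"
      using d' unfolding straddled_def by (metis not_le)
    have "a \<noteq> b" using ab by auto
    then have "a < b" using ab by simp
    moreover have "real j * h \<le> a" "b \<le> real (Suc j) * h" using ab by (auto simp: d'_def)
    ultimately have "(a, b) \<in> K" using ab j2 by (auto simp: K_def)
    moreover have "x \<in> cball (?a (a, b)) (?r (a, b))" unfolding ball using ab by simp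
    moreover have "?r (a, b) < d" using ab \<open>a < b\<close> by (simp add: d'_def)
    ultimately show "\<exists>p. p \<in> K \<and> x \<in> cball (?a p) (?r p) \<and> ?r p < d" by blast
  qed blast
  define jj where "jj = (\<lambda>(a, b). SOME j. j < 2^n \<and> real j * h \<le> a \<and> b \<le> real (Suc j) * h \<and>
      c * (b - a) < norm (f b - f a - (b - a) *\<^sub>R dyadic_slope f T n j))"
  have jj: "jj (a, b) < 2^n \<and> real (jj (a, b)) * h \<le> a \<and> b \<le> real (Suc (jj (a, b))) * h \<and>
      c * (b - a) < norm (f b - f a - (b - a) *\<^sub>R dyadic_slope f T n (jj (a, b)))" if "(a, b) \<in> K" for a b
  proof -
    have "\<exists>j. j < 2^n \<and> real j * h \<le> a \<and> b \<le> real (Suc j) * h \<and>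
      c * (b - a) < norm (f b - f a - (b - a) *\<^sub>R dyadic_slope f T n j)" using that by (auto simp: K_def)
    from someI_ex[OF this] show ?thesis by (simp add: jj_def)
  qed
  \<comment> \<open>The variation bound concerns finite families; the countable union follows
    because the bound \<open>e\<close> does not depend on \<open>J\<close>. The choice of
    \<open>n\<close> for \<open>c * e\<close> is what leaves \<open>e\<close> after division by
    \<open>c\<close>.\<close>
  have fin: "measure lebesgue (\<Union>p\<in>J. cball (?a p) (?r p)) \<le> e" if J: "J \<subseteq> C" "finite J" for J
  proof -
    have JK: "J \<subseteq> K" using J C by auto
    have disj: "disjoint_family_on (\<lambda>(a, b). {a<..<b}) J"
      unfolding disjoint_family_on_def
    proof (intro ballI impI)
      fix p q assume "p \<in> J" "q \<in> J" "p \<noteq> q"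
      then have "{fst p..snd p} \<inter> {fst q..snd q} = {}"
        using C(3) J unfolding pairwise_def disjnt_def ball by blast
      then show "(case p of (a, b) \<Rightarrow> {a<..<b}) \<inter> (case q of (a, b) \<Rightarrow> {a<..<b}) = {}"
        by (fastforce simp: case_prod_beta)
    qed
    have "measure lebesgue (\<Union>p\<in>J. cball (?a p) (?r p)) \<le> (\<Sum>p\<in>J. measure lebesgue (cball (?a p) (?r p)))"
      by (rule measure_UNION_le[OF J(2)]) auto
    also have "\<dots> = (\<Sum>(a, b)\<in>J. b - a)"
      unfolding ball using JK Kless by (intro sum.cong refl) (force simp: measure_completion less_imp_le)
    finally have "c * measure lebesgue (\<Union>p\<in>J. cball (?a p) (?r p)) \<le> c * (\<Sum>(a, b)\<in>J. b - a)"
      using c by simp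
    also have "\<dots> = (\<Sum>(a, b)\<in>J. c * (b - a))" by (simp add: sum_distrib_left case_prod_beta)
    also have "\<dots> \<le> (\<Sum>(a, b)\<in>J. norm (f b - f a - (b - a) *\<^sub>R dyadic_slope f T n (jj (a, b))))"
      using jj JK by (intro sum_mono) (force intro: less_imp_le)
    also have "\<dots> \<le> c * e"
    proof (rule dyadic_slope_variation_bound[OF absolutely_continuous_on_imp_continuous_on[OF ac] T n J(2) _ _ disj])
      show "a < b" if "(a, b) \<in> J" for a b using that JK Kless by auto
      show "jj (a, b) < 2^n \<and> real (jj (a, b)) * (T / 2^n) \<le> a \<and> b \<le> real (Suc (jj (a, b))) * (T / 2^n)"
        if "(a, b) \<in> J" for a b using that JK jj unfolding h_def by blast
    qed
    finally show ?thesis using c by simp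
  qed
  define U where "U = (\<Union>p\<in>C. cball (?a p) (?r p))"
  have U: "U \<in> lmeasurable" "measure lebesgue U \<le> e"
    unfolding U_def by (rule fmeasurable_UN_bound[OF C(1) _ fin], auto) (rule measure_UN_bound[OF C(1) _ fin], auto)
  have ng: "negligible (((?N - G) - U) \<union> G)"
    using C(4) by (intro negligible_Un) (auto simp: U_def G_def negligible_finite)
  show "\<exists>S. ?N \<subseteq> S \<and> S \<in> lmeasurable \<and> measure lebesgue S \<le> e"
  proof (intro exI conjI)
    show "?N \<subseteq> U \<union> (((?N - G) - U) \<union> G)" by auto
    show "U \<union> (((?N - G) - U) \<union> G) \<in> lmeasurable"
      by (intro fmeasurable.Un[OF U(1)] negligible_imp_measurable[OF ng])
    have "measure lebesgue (U \<union> (((?N - G) - U) \<union> G)) \<le> measure lebesgue U + measure lebesgue (((?N - G) - U) \<union> G)"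
      by (intro measure_Un_le fmeasurableD[OF U(1)] negligible_imp_sets[OF ng])
    then show "measure lebesgue (U \<union> (((?N - G) - U) \<union> G)) \<le> e"
      using U negligible_imp_measure0[OF ng] by simp
  qed
qed

text \<open>Two approximate slopes at the same point can be compared on one nondegenerate interval,
  so they differ by at most the sum of their tolerances. Slopes for tolerances tending to zero are
  thus Cauchy, and their limit is the derivative.\<close>

lemma straddled_all_imp_differentiable:
  fixes f :: "real \<Rightarrow> 'a::banach"
  assumes T: "T > 0" and x: "x \<in> {0..T}" and str: "\<And>c. c > 0 \<Longrightarrow> \<exists>v. straddled f T c x v"
  shows "\<exists>v. (f has_vector_derivative v) (at x within {0..T})"
proof -
  obtain v where v: "\<And>k. straddled f T (inverse (real (Suc k))) x (v k)"
    using str[of "inverse (real (Suc _))"] by (metis inverse_positive_iff_positive of_nat_0_less_iff zero_less_Suc)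
  have close: "norm (u - w) \<le> c + c'" if "straddled f T c x u" "straddled f T c' x w" for u w c c'
  proof -
    obtain d where d: "d > 0" "\<And>a b. \<lbrakk>0 \<le> a; a \<le> x; x \<le> b; b \<le> T; b - a < d\<rbrakk> \<Longrightarrow> norm (f b - f a - (b - a) *\<^sub>R u) \<le> c * (b - a)"
      using \<open>straddled f T c x u\<close> unfolding straddled_def by blast
    obtain d' where d': "d' > 0" "\<And>a b. \<lbrakk>0 \<le> a; a \<le> x; x \<le> b; b \<le> T; b - a < d'\<rbrakk> \<Longrightarrow> norm (f b - f a - (b - a) *\<^sub>R w) \<le> c' * (b - a)"
      using \<open>straddled f T c' x w\<close> unfolding straddled_def by blast
    define r where "r = min (min d d') T / 4"
    have r: "r > 0" "2 * r < d" "2 * r < d'" "4 * r \<le> T" using d d' T by (auto simp: r_def)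
    define a where "a = max 0 (x - r)"
    define b where "b = min T (x + r)"
    have ab: "0 \<le> a" "a \<le> x" "x \<le> b" "b \<le> T" "a < b" "b - a < d" "b - a < d'"
      using r x by (auto simp: a_def b_def)
    have "(b - a) *\<^sub>R (u - w) = (f b - f a - (b - a) *\<^sub>R w) - (f b - f a - (b - a) *\<^sub>R u)"
      by (simp add: algebra_simps)
    then have "norm ((b - a) *\<^sub>R (u - w)) \<le> c' * (b - a) + c * (b - a)"
      using norm_triangle_ineq4[of "f b - f a - (b - a) *\<^sub>R w" "f b - f a - (b - a) *\<^sub>R u"] d(2)[OF ab(1-4,6)] d'(2)[OF ab(1-4,7)]
      by simp
    moreover have "norm ((b - a) *\<^sub>R (u - w)) = (b - a) * norm (u - w)" using ab by simp
    ultimately have "(b - a) * norm (u - w) \<le> (b - a) * (c + c')" by (simp only: distrib_left mult.commute)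
    then show ?thesis using ab by simp
  qed
  have inv0: "(\<lambda>k. inverse (real (Suc k))) \<longlonglongrightarrow> 0" by (rule LIMSEQ_inverse_real_of_nat)
  have "Cauchy v"
  proof (rule metric_CauchyI)
    fix e :: real assume e: "0 < e"
    obtain M where M: "inverse (real (Suc M)) < e / 2" using reals_Archimedean[of "e / 2"] e by auto
    have "dist (v m) (v n) < e" if "m \<ge> M" "n \<ge> M" for m n
    proof -
      have "inverse (real (Suc m)) \<le> inverse (real (Suc M))" "inverse (real (Suc n)) \<le> inverse (real (Suc M))"
        using that by (auto intro: le_imp_inverse_le)
      then show ?thesis unfolding dist_norm using close[OF v[of m] v[of n]] M by linarith
    qed
    then show "\<exists>M. \<forall>m\<ge>M. \<forall>n\<ge>M. dist (v m) (v n) < e" by blast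
  qed
  then obtain w where w: "v \<longlonglongrightarrow> w" using Cauchy_convergent_iff convergent_def by blast
  have "(f has_vector_derivative w) (at x within {0..T})"
    unfolding has_vector_derivative_def has_derivative_within_alt
  proof (intro conjI bounded_linear_scaleR_left allI impI)
    fix e :: real assume e: "0 < e"
    have "\<forall>\<^sub>F k in sequentially. inverse (real (Suc k)) < e / 2" using inv0 e by (intro order_tendstoD(2)) auto
    moreover have "\<forall>\<^sub>F k in sequentially. dist (v k) w < e / 2" using w e by (intro tendstoD) auto
    ultimately have "\<forall>\<^sub>F k in sequentially. inverse (real (Suc k)) < e / 2 \<and> dist (v k) w < e / 2" by (rule eventually_conj)
    then obtain k where k: "inverse (real (Suc k)) < e / 2" "dist (v k) w < e / 2"
      using eventually_happens'[OF sequentially_bot] by blast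
    obtain d where d: "d > 0" "\<And>a b. \<lbrakk>0 \<le> a; a \<le> x; x \<le> b; b \<le> T; b - a < d\<rbrakk> \<Longrightarrow>
        norm (f b - f a - (b - a) *\<^sub>R v k) \<le> inverse (real (Suc k)) * (b - a)"
      using v[of k] unfolding straddled_def by blast
    have main: "norm (f b - f a - (b - a) *\<^sub>R w) \<le> e * (b - a)"
      if "0 \<le> a" "a \<le> x" "x \<le> b" "b \<le> T" "b - a < d" for a b
    proof -
      have "norm (f b - f a - (b - a) *\<^sub>R w) \<le> norm (f b - f a - (b - a) *\<^sub>R v k) + norm ((b - a) *\<^sub>R (v k - w))"
        using norm_triangle_ineq[of "f b - f a - (b - a) *\<^sub>R v k" "(b - a) *\<^sub>R (v k - w)"] by (simp add: algebra_simps)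
      also have "\<dots> \<le> e / 2 * (b - a) + (b - a) * (e / 2)"
      proof (rule add_mono)
        have "inverse (real (Suc k)) * (b - a) \<le> e / 2 * (b - a)" using k that by (intro mult_right_mono) auto
        then show "norm (f b - f a - (b - a) *\<^sub>R v k) \<le> e / 2 * (b - a)" using d(2)[OF that] by linarith
        have "(b - a) * norm (v k - w) \<le> (b - a) * (e / 2)"
          using k(2) that unfolding dist_norm by (intro mult_left_mono) auto
        then show "norm ((b - a) *\<^sub>R (v k - w)) \<le> (b - a) * (e / 2)" using that by simp
      qed
      finally show ?thesis by (simp add: algebra_simps)
    qed
    show "\<exists>d>0. \<forall>y\<in>{0..T}. norm (y - x) < d \<longrightarrow> norm (f y - f x - (y - x) *\<^sub>R w) \<le> e * norm (y - x)"
    proof (intro exI[of _ d] conjI ballI impI d(1))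
      fix y assume y: "y \<in> {0..T}" "norm (y - x) < d"
      show "norm (f y - f x - (y - x) *\<^sub>R w) \<le> e * norm (y - x)"
      proof (cases "x \<le> y")
        case True then show ?thesis using main[of x y] y x by simp
      next
        case False
        have "norm (f y - f x - (y - x) *\<^sub>R w) = norm (f x - f y - (x - y) *\<^sub>R w)"
          using norm_minus_cancel[of "f y - f x - (y - x) *\<^sub>R w"] by (simp add: algebra_simps)
        then show ?thesis using False main[of y x] y x by simp
      qed
    qed
  qed
  then show ?thesis by blast
qed

lemma absolutely_continuous_on_differentiable_ae:
  fixes f :: "real \<Rightarrow> 'a::{real_inner,banach}"
  assumes ac: "absolutely_continuous_on {0..T} f" and T: "T > 0"
  shows "negligible {x \<in> {0..T}. \<not> (f has_vector_derivative vector_derivative f (at x within {0..T})) (at x within {0..T})}"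
proof (rule negligible_subset)
  show "negligible (\<Union>k. {x \<in> {0..T}. \<not> (\<exists>v. straddled f T (inverse (real (Suc k))) x v)})"
    by (intro negligible_Union_nat negligible_not_straddled[OF ac T]) simp
  show "{x \<in> {0..T}. \<not> (f has_vector_derivative vector_derivative f (at x within {0..T})) (at x within {0..T})}
    \<subseteq> (\<Union>k. {x \<in> {0..T}. \<not> (\<exists>v. straddled f T (inverse (real (Suc k))) x v)})"
  proof (rule subsetI, rule ccontr)
    fix x assume x: "x \<in> {x \<in> {0..T}. \<not> (f has_vector_derivative vector_derivative f (at x within {0..T})) (at x within {0..T})}"
      and nx: "x \<notin> (\<Union>k. {x \<in> {0..T}. \<not> (\<exists>v. straddled f T (inverse (real (Suc k))) x v)})"
    have "\<exists>v. straddled f T c x v" if c: "c > 0" for c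
    proof -
      obtain k where k: "inverse (real (Suc k)) < c" using reals_Archimedean[OF c] by auto
      obtain v where "straddled f T (inverse (real (Suc k))) x v" using nx x by auto
      then obtain d where "d > 0" and d: "\<And>a b. \<lbrakk>0 \<le> a; a \<le> x; x \<le> b; b \<le> T; b - a < d\<rbrakk> \<Longrightarrow>
        norm (f b - f a - (b - a) *\<^sub>R v) \<le> inverse (real (Suc k)) * (b - a)"
        unfolding straddled_def by blast
      have "norm (f b - f a - (b - a) *\<^sub>R v) \<le> c * (b - a)" if "0 \<le> a" "a \<le> x" "x \<le> b" "b \<le> T" "b - a < d" for a b
        using d[OF that] mult_right_mono[of "inverse (real (Suc k))" c "b - a"] k that by linarith
      then have "straddled f T c x v" unfolding straddled_def using \<open>d > 0\<close> by blast
      then show ?thesis by blast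
    qed
    then obtain v where v: "(f has_vector_derivative v) (at x within {0..T})"
      using straddled_all_imp_differentiable[OF T] x by blast
    then have "f differentiable (at x within {0..T})" by (rule differentiableI_vector)
    then show False using x by (simp add: vector_derivative_works)
  qed
qed

text \<open>The straddle lemma: the errors at both ends are subtracted, and since \<open>x\<close>
  lies between \<open>a\<close> and \<open>b\<close> the two distances add up to exactly
  \<open>b - a\<close>.\<close>

lemma has_vector_derivative_straddle:
  fixes f :: "real \<Rightarrow> 'a::real_normed_vector"
  assumes "(f has_vector_derivative v) (at x within S)" and e: "e > 0"
  obtains d where "d > 0" "\<And>a b. \<lbrakk>a \<in> S; b \<in> S; a \<le> x; x \<le> b; \<bar>a - x\<bar> < d; \<bar>b - x\<bar> < d\<rbrakk> \<Longrightarrow>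
    norm (f b - f a - (b - a) *\<^sub>R v) \<le> e * (b - a)"
proof -
  obtain d where d: "d > 0" "\<And>y. y \<in> S \<Longrightarrow> norm (y - x) < d \<Longrightarrow> norm (f y - f x - (y - x) *\<^sub>R v) \<le> e * norm (y - x)"
    using assms unfolding has_vector_derivative_def has_derivative_within_alt by blast
  show ?thesis
  proof (rule that[OF d(1)])
    fix a b assume ab: "a \<in> S" "b \<in> S" "a \<le> x" "x \<le> b" "\<bar>a - x\<bar> < d" "\<bar>b - x\<bar> < d"
    have "f b - f a - (b - a) *\<^sub>R v = (f b - f x - (b - x) *\<^sub>R v) - (f a - f x - (a - x) *\<^sub>R v)"
      by (simp add: algebra_simps)
    also have "norm \<dots> \<le> e * norm (b - x) + e * norm (a - x)"
    proof (rule order_trans[OF norm_triangle_ineq4 add_mono])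
      show "norm (f b - f x - (b - x) *\<^sub>R v) \<le> e * norm (b - x)" by (rule d(2)) (use ab in auto)
      show "norm (f a - f x - (a - x) *\<^sub>R v) \<le> e * norm (a - x)" by (rule d(2)) (use ab in auto)
    qed
    also have "\<dots> = e * (b - a)" using ab by (simp add: algebra_simps)
    finally show "norm (f b - f a - (b - a) *\<^sub>R v) \<le> e * (b - a)" .
  qed
qed

text \<open>A Henstock argument. Cells tagged at points of differentiability are handled by the
  straddle lemma; cells tagged in the exceptional null set lie in an open set of small measure,
  where absolute continuity makes the increments of \<open>f\<close> small.\<close>

lemma absolutely_continuous_on_has_integral:
  fixes f :: "real \<Rightarrow> 'a::euclidean_space"
  assumes ac: "absolutely_continuous_on {0..T} f" and T: "T > 0" and ab: "0 \<le> a" "a \<le> b" "b \<le> T"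
  defines "f' \<equiv> \<lambda>x. vector_derivative f (at x within {0..T})"
  shows "(f' has_integral (f b - f a)) {a..b}"
proof -
  define N where "N = {x \<in> {0..T}. \<not> (f has_vector_derivative f' x) (at x within {0..T})}"
  have N: "negligible N" unfolding N_def f'_def by (rule absolutely_continuous_on_differentiable_ae[OF ac T])
  \<comment> \<open>With value \<open>0\<close> on the null set, the tags in \<open>N\<close>
    contribute nothing to the Riemann sum and only the increments of \<open>f\<close> over their
    cells have to be estimated.\<close>
  define g where "g = (\<lambda>x. if x \<in> N then 0 else f' x)"
  have "(g has_integral (f b - f a)) (cbox a b)"
    unfolding has_integral
  proof (intro allI impI)
    fix e :: real assume e: "e > 0"
    define e1 where "e1 = e / (2 * (b - a + 1))"
    have e1: "e1 > 0" using e ab by (simp add: e1_def)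
    obtain d where d: "0 < d" and D: "\<And>I. finite I \<Longrightarrow> (\<And>u v. (u, v) \<in> I \<Longrightarrow> u \<le> v \<and> {u..v} \<subseteq> {0..T}) \<Longrightarrow>
      disjoint_family_on (\<lambda>(a, b). {a<..<b}) I \<Longrightarrow> (\<Sum>(a, b)\<in>I. b - a) < d \<Longrightarrow>
      (\<Sum>(a, b)\<in>I. norm (f b - f a)) < e / 2"
      using absolutely_continuous_onE[OF ac, of "e / 2"] e by auto
    obtain U where U: "open U" "N \<subseteq> U" "U - N \<in> lmeasurable" "emeasure lebesgue (U - N) < ennreal d"
      using sets_lebesgue_outer_open[OF negligible_imp_sets[OF N] d] by blast
    have Um: "U \<in> lmeasurable"
    proof -
      have "U = (U - N) \<union> N" using U by auto
      then show ?thesis using U(3) N by (metis fmeasurable.Un negligible_imp_measurable)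
    qed
    have Ud: "measure lebesgue U < d"
    proof -
      have "measure lebesgue U \<le> measure lebesgue ((U - N) \<union> N)" using U(2) by (simp add: Un_absorb2)
      also have "\<dots> \<le> measure lebesgue (U - N) + measure lebesgue N"
        by (intro measure_Un_le fmeasurableD[OF U(3)] negligible_imp_sets[OF N])
      also have "\<dots> = measure lebesgue (U - N)" using negligible_imp_measure0[OF N] by simp
      also have "\<dots> < d" using U(3,4) d by (simp add: emeasure_eq_measure2 ennreal_less_iff)
      finally show ?thesis .
    qed
    \<comment> \<open>The gauge: at points of \<open>N\<close> it confines the cell to
      \<open>U\<close>, at points of differentiability it enforces the straddle estimate, and
      elsewhere it is irrelevant.\<close>
    have "\<exists>G. open G \<and> x \<in> G \<and> (x \<in> N \<longrightarrow> G \<subseteq> U) \<and> (x \<in> {0..T} - N \<longrightarrow>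
       (\<forall>u v. u \<in> {0..T} \<inter> G \<and> v \<in> {0..T} \<inter> G \<and> u \<le> x \<and> x \<le> v \<longrightarrow> norm (f v - f u - (v - u) *\<^sub>R f' x) \<le> e1 * (v - u)))" for x
    proof (cases "x \<in> N")
      case True then show ?thesis using U by blast
    next
      case False
      show ?thesis
      proof (cases "x \<in> {0..T}")
        case True
        then have "(f has_vector_derivative f' x) (at x within {0..T})" using False by (simp add: N_def)
        then obtain r where r: "r > 0" "\<And>a b. \<lbrakk>a \<in> {0..T}; b \<in> {0..T}; a \<le> x; x \<le> b; \<bar>a - x\<bar> < r; \<bar>b - x\<bar> < r\<rbrakk> \<Longrightarrow>
          norm (f b - f a - (b - a) *\<^sub>R f' x) \<le> e1 * (b - a)"
          using has_vector_derivative_straddle[OF _ e1] by blast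
        show ?thesis
          by (rule exI[of _ "ball x r"]) (use r False in \<open>auto simp: dist_real_def abs_minus_commute\<close>)
      next
        case nT: False then show ?thesis using False by (intro exI[of _ UNIV]) auto
      qed
    qed
    then obtain \<gamma> where \<gamma>: "\<And>x. open (\<gamma> x)" "\<And>x. x \<in> \<gamma> x" "\<And>x. x \<in> N \<Longrightarrow> \<gamma> x \<subseteq> U"
      "\<And>x u v. \<lbrakk>x \<in> {0..T} - N; u \<in> {0..T} \<inter> \<gamma> x; v \<in> {0..T} \<inter> \<gamma> x; u \<le> x; x \<le> v\<rbrakk> \<Longrightarrow>
         norm (f v - f u - (v - u) *\<^sub>R f' x) \<le> e1 * (v - u)"
      by metis
    show "\<exists>\<gamma>. gauge \<gamma> \<and> (\<forall>\<D>. \<D> tagged_division_of cbox a b \<and> \<gamma> fine \<D> \<longrightarrow>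
        norm ((\<Sum>(x, K)\<in>\<D>. measure lborel K *\<^sub>R g x) - (f b - f a)) < e)"
    proof (intro exI conjI allI impI)
      show "gauge \<gamma>" using \<gamma> by (auto simp: gauge_def)
      fix p assume "p tagged_division_of cbox a b \<and> \<gamma> fine p"
      then have p: "p tagged_division_of cbox a b" and fine: "\<gamma> fine p" by auto
      have finp: "finite p" using p by (rule tagged_division_ofD(1))
      have K: "K = {Inf K..Sup K} \<and> Inf K \<le> x \<and> x \<le> Sup K \<and> 0 \<le> Inf K \<and> Sup K \<le> T \<and> {Inf K..Sup K} \<subseteq> \<gamma> x
          \<and> measure lborel K = Sup K - Inf K"
        if "(x, K) \<in> p" for x K
      proof -
        obtain u v where k: "K = cbox u v" using tagged_division_ofD(4)[OF p \<open>(x, K) \<in> p\<close>] by blast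
        have "x \<in> K" "K \<subseteq> cbox a b" using tagged_division_ofD(2,3)[OF p that] by auto
        then have uv: "u \<le> v" "x \<in> {u..v}" "{u..v} \<subseteq> {a..b}" by (auto simp: k)
        then have "Inf K = u" "Sup K = v" by (auto simp: k)
        moreover have "K \<subseteq> \<gamma> x" using fine that by (rule fineD)
        moreover have "a \<le> u" "v \<le> b" using uv by auto
        ultimately show ?thesis using uv ab by (auto simp: k)
      qed
      have tot: "b - a = (\<Sum>(x,K)\<in>p. Sup K - Inf K)" "f b - f a = (\<Sum>(x,K)\<in>p. f (Sup K) - f (Inf K))"
        using additive_tagged_division_1[where f = "\<lambda>x. x"] additive_tagged_division_1[where f = f] \<open>a \<le> b\<close> p by auto
      \<comment> \<open>Degenerate cells are left out of \<open>B\<close>: the same degenerate cell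
        might occur with several tags, whereas \<open>F\<close> has to be injective.\<close>
      define B where "B = {(x, K) \<in> p. x \<in> N \<and> Inf K < Sup K}"
      have finB: "finite B" using finp by (auto simp: B_def intro: finite_subset[OF _ finp])
      have Bp: "B \<subseteq> p" by (auto simp: B_def)
      have dj: "{Inf K<..<Sup K} \<inter> {Inf K'<..<Sup K'} = {}" if "(x, K) \<in> p" "(x', K') \<in> p" "(x, K) \<noteq> (x', K')" for x K x' K'
      proof -
        have "interior K \<inter> interior K' = {}" using p that by (meson tagged_division_ofD(5))
        moreover have "interior K = {Inf K<..<Sup K}" "interior K' = {Inf K'<..<Sup K'}"
          using K[OF that(1)] K[OF that(2)] interior_atLeastAtMost_real by metis+
        ultimately show ?thesis by simp
      qed
      define F where "F = (\<lambda>q::real \<times> real set. (Inf (snd q), Sup (snd q)))"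
      have inj: "inj_on F B"
      proof (rule inj_onI, rule ccontr)
        fix q q' assume q: "q \<in> B" "q' \<in> B" "F q = F q'" "q \<noteq> q'"
        obtain x K x' K' where e: "q = (x, K)" "q' = (x', K')" by (cases q, cases q')
        have "{Inf K<..<Sup K} \<inter> {Inf K'<..<Sup K'} = {}" using dj[of x K x' K'] q Bp by (auto simp: e)
        then have "{Inf K<..<Sup K} = {}" using q by (simp add: e F_def)
        then show False using q(1) by (simp add: B_def e)
      qed
      have "(\<Sum>(u, v)\<in>F ` B. norm (f v - f u)) < e / 2"
      proof (rule D)
        show "finite (F ` B)" using finB by simp
        show "u \<le> v \<and> {u..v} \<subseteq> {0..T}" if "(u, v) \<in> F ` B" for u v
        proof -
          obtain x K where q: "(x, K) \<in> B" "u = Inf K" "v = Sup K" using \<open>(u, v) \<in> F ` B\<close> by (auto simp: F_def)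
          have "(x, K) \<in> p" using q Bp by auto
          then have "Inf K \<le> x" "x \<le> Sup K" "0 \<le> Inf K" "Sup K \<le> T" using K by blast+
          then show ?thesis using q by auto
        qed
        show dF: "disjoint_family_on (\<lambda>(a, b). {a<..<b}) (F ` B)"
          unfolding disjoint_family_on_def
        proof (intro ballI impI)
          fix m n assume "m \<in> F ` B" "n \<in> F ` B" "m \<noteq> n"
          then obtain q q' where q: "q \<in> B" "q' \<in> B" "m = F q" "n = F q'" "q \<noteq> q'" by blast
          obtain x K x' K' where e: "q = (x, K)" "q' = (x', K')" by (cases q, cases q')
          show "(case m of (a, b) \<Rightarrow> {a<..<b}) \<inter> (case n of (a, b) \<Rightarrow> {a<..<b}) = {}"
            using dj[of x K x' K'] q Bp by (auto simp: e F_def)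
        qed
        have "(\<Sum>(u, v)\<in>F ` B. v - u) \<le> measure lebesgue U"
        proof (rule sum_interval_lengths_le_measure[OF _ _ dF Um])
          fix u v assume "(u, v) \<in> F ` B"
          then obtain x K where q: "(x, K) \<in> B" "u = Inf K" "v = Sup K" by (auto simp: F_def)
          then have "x \<in> N" "(x, K) \<in> p" by (auto simp: B_def)
          then have "Inf K \<le> x" "x \<le> Sup K" "{Inf K..Sup K} \<subseteq> \<gamma> x" "\<gamma> x \<subseteq> U" using K \<gamma>(3) by blast+
          then have "Inf K \<le> Sup K" "{Inf K..Sup K} \<subseteq> U" by auto
          then show "u \<le> v \<and> {u<..<v} \<subseteq> U"
            unfolding q(2,3) using greaterThanLessThan_subseteq_atLeastAtMost_iff by blast
        qed (use finB in auto)
        then show "(\<Sum>(a, b)\<in>F ` B. b - a) < d" using Ud by linarith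
      qed
      then have bad: "(\<Sum>(x, K)\<in>B. norm (f (Sup K) - f (Inf K))) < e / 2"
        by (subst (asm) sum.reindex[OF inj]) (simp add: F_def case_prod_beta)
      have "norm ((\<Sum>(x, K)\<in>p. measure lborel K *\<^sub>R g x) - (f b - f a))
          = norm (\<Sum>(x, K)\<in>p. measure lborel K *\<^sub>R g x - (f (Sup K) - f (Inf K)))"
        unfolding tot(2) by (simp add: sum_subtractf case_prod_beta)
      also have "\<dots> \<le> (\<Sum>(x, K)\<in>p. e1 * (Sup K - Inf K) + (if (x, K) \<in> B then norm (f (Sup K) - f (Inf K)) else 0))"
      proof (rule sum_norm_le, clarify)
        fix x K assume xK: "(x, K) \<in> p"
        note k = K[OF xK]
        show "norm (measure lborel K *\<^sub>R g x - (f (Sup K) - f (Inf K))) \<le> e1 * (Sup K - Inf K) + (if (x, K) \<in> B then norm (f (Sup K) - f (Inf K)) else 0)"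
        proof (cases "x \<in> N")
          case True
          have "0 \<le> e1 * (Sup K - Inf K)" using e1 k by simp
          then show ?thesis using True k xK
            by (cases "Inf K = Sup K") (auto simp: g_def B_def norm_minus_commute)
        next
          case False
          have "norm (f (Sup K) - f (Inf K) - (Sup K - Inf K) *\<^sub>R f' x) \<le> e1 * (Sup K - Inf K)"
            using False k by (intro \<gamma>(4)) auto
          then show ?thesis using False k by (simp add: g_def B_def norm_minus_commute)
        qed
      qed
      also have "\<dots> = e1 * (b - a) + (\<Sum>(x, K)\<in>B. norm (f (Sup K) - f (Inf K)))"
      proof -
        have "(\<Sum>q\<in>p. if q \<in> B then norm (f (Sup (snd q)) - f (Inf (snd q))) else 0) = (\<Sum>q\<in>B. norm (f (Sup (snd q)) - f (Inf (snd q))))"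
          using finp Bp by (simp add: sum.inter_restrict[symmetric] Int_absorb1)
        then show ?thesis
          by (simp add: tot(1) sum.distrib sum_distrib_left case_prod_beta)
      qed
      also have "\<dots> < e1 * (b - a) + e / 2" using bad by simp
      also have "\<dots> \<le> e / 2 + e / 2"
      proof -
        have "e1 * (b - a) \<le> e1 * (b - a + 1)" using e1 by simp
        also have "\<dots> = e / 2" using ab unfolding e1_def by (simp add: field_simps)
        finally show ?thesis by simp
      qed
      finally show "norm ((\<Sum>(x, K)\<in>p. measure lborel K *\<^sub>R g x) - (f b - f a)) < e" by simp
    qed
  qed
  then have "(f' has_integral (f b - f a)) (cbox a b)"
    by (rule has_integral_spike[OF N, rotated]) (auto simp: g_def)
  then show ?thesis by simp
qed

text \<open>By the previous lemma the integrals of the derivative over a division are increments of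
  \<open>f\<close>, so the bounded variation of \<open>f\<close> bounds them in norm.\<close>

lemma absolutely_continuous_on_absolutely_integrable:
  fixes f :: "real \<Rightarrow> 'a::euclidean_space"
  assumes ac: "absolutely_continuous_on {0..T} f" and T: "T > 0"
  shows "(\<lambda>x. vector_derivative f (at x within {0..T})) absolutely_integrable_on {0..T}"
proof -
  let ?f' = "\<lambda>x. vector_derivative f (at x within {0..T})"
  note ftc = absolutely_continuous_on_has_integral[OF ac T]
  obtain V where V: "\<And>I. finite I \<Longrightarrow> (\<And>a b. (a, b) \<in> I \<Longrightarrow> a < b \<and> {a..b} \<subseteq> {0..T}) \<Longrightarrow>
      disjoint_family_on (\<lambda>(a, b). {a<..<b}) I \<Longrightarrow> (\<Sum>(a, b)\<in>I. norm (f b - f a)) \<le> V"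
    using absolutely_continuous_on_variation[OF ac T] by blast
  have "?f' absolutely_integrable_on cbox 0 T"
  proof (rule bounded_variation_absolutely_integrable_interval[of _ _ _ V])
    show "?f' integrable_on cbox 0 T" using ftc[of 0 T] T by (auto simp: integrable_on_def)
    fix d assume d: "d division_of cbox 0 T"
    have find: "finite d" using d by (rule division_ofD(1))
    have K: "K = {Inf K..Sup K} \<and> Inf K \<le> Sup K \<and> 0 \<le> Inf K \<and> Sup K \<le> T \<and> integral K ?f' = f (Sup K) - f (Inf K)" if "K \<in> d" for K
    proof -
      obtain u v where k: "K = cbox u v" using division_ofD(4)[OF d \<open>K \<in> d\<close>] by blast
      have ne: "K \<noteq> {}" and sub: "K \<subseteq> cbox 0 T" using division_ofD(2,3)[OF d that] by auto
      then have uv: "u \<le> v" "0 \<le> u" "v \<le> T" by (auto simp: k)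
      then have "Inf K = u" "Sup K = v" by (auto simp: k)
      then show ?thesis using ftc[of u v] uv by (auto simp: k integral_unique)
    qed
    define B where "B = {K \<in> d. Inf K < Sup K}"
    have Bd: "B \<subseteq> d" "finite B" using find by (auto simp: B_def)
    define F where "F = (\<lambda>K::real set. (Inf K, Sup K))"
    have inj: "inj_on F B"
    proof (rule inj_onI)
      fix k l assume kl: "k \<in> B" "l \<in> B" "F k = F l"
      then have "k = {Inf k..Sup k}" "l = {Inf l..Sup l}" using K Bd by blast+
      then show "k = l" using kl(3) unfolding F_def by (metis prod.inject)
    qed
    have "(\<Sum>K\<in>d. norm (integral K ?f')) = (\<Sum>K\<in>B. norm (integral K ?f'))"
    proof (rule sum.mono_neutral_right[OF find Bd(1)], clarify)
      fix K assume "K \<in> d" "K \<notin> B"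
      then have "Inf K = Sup K" using K[of K] by (auto simp: B_def)
      then show "norm (integral K ?f') = 0" using K[OF \<open>K \<in> d\<close>] by simp
    qed
    also have "\<dots> = (\<Sum>(a, b)\<in>F ` B. norm (f b - f a))"
      using K Bd by (subst sum.reindex[OF inj]) (auto simp: F_def intro!: sum.cong)
    also have "\<dots> \<le> V"
    proof (rule V)
      show "finite (F ` B)" using Bd by simp
      show "a < b \<and> {a..b} \<subseteq> {0..T}" if "(a, b) \<in> F ` B" for a b
      proof -
        obtain k where k: "k \<in> B" "a = Inf k" "b = Sup k" using \<open>(a, b) \<in> F ` B\<close> by (auto simp: F_def)
        then have "Inf k < Sup k" "0 \<le> Inf k" "Sup k \<le> T" using K Bd by (auto simp: B_def)
        then show ?thesis using k by auto
      qed
      show "disjoint_family_on (\<lambda>(a, b). {a<..<b}) (F ` B)"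
        unfolding disjoint_family_on_def
      proof (intro ballI impI)
        fix m n assume "m \<in> F ` B" "n \<in> F ` B" "m \<noteq> n"
        then obtain k l where kl: "k \<in> B" "l \<in> B" "m = F k" "n = F l" "k \<noteq> l" by blast
        have "interior k \<inter> interior l = {}" using d kl Bd by (meson division_ofD(5) subsetD)
        moreover have "interior k = {Inf k<..<Sup k}" "interior l = {Inf l<..<Sup l}"
          using K kl Bd interior_atLeastAtMost_real by (metis subsetD)+
        ultimately show "(case m of (a, b) \<Rightarrow> {a<..<b}) \<inter> (case n of (a, b) \<Rightarrow> {a<..<b}) = {}"
          by (simp add: kl F_def)
      qed
    qed
    finally show "(\<Sum>K\<in>d. norm (integral K ?f')) \<le> V" .
  qed
  then show ?thesis by simp
qed

section \<open>Superlinear convex Lagrangians\<close>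

text \<open>The epigraph is separated from the open vertical ray below \<open>(b, g b)\<close>. The
  ray is not open in the product, so its supremum \<open>g b\<close> is reached only through a
  limit.\<close>

lemma convex_on_subgradient:
  fixes g :: "'a::euclidean_space \<Rightarrow> real"
  assumes "convex_on UNIV g"
  obtains q where "\<And>v. g b + q \<bullet> (v - b) \<le> g v"
proof -
  define S where "S = {p::'a \<times> real. g (fst p) \<le> snd p}"
  define T where "T = {p::'a \<times> real. fst p = b \<and> snd p < g b}"
  have "S = epigraph UNIV g" by (auto simp: S_def epigraph_def)
  then have cS: "convex S" using convex_epigraphI[OF assms] by simp
  have "T = {b} \<times> {..<g b}" by (auto simp: T_def)
  then have cT: "convex T" by (simp add: convex_Times)
  have "(b, g b) \<in> S" "(b, g b - 1) \<in> T" "S \<inter> T = {}" by (auto simp: S_def T_def)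
  then obtain w c where w: "w \<noteq> 0" "\<And>p. p \<in> S \<Longrightarrow> w \<bullet> p \<le> c" "\<And>p. p \<in> T \<Longrightarrow> c \<le> w \<bullet> p"
    using separating_hyperplane_sets[OF cS cT] by blast
  obtain \<alpha> \<beta> where ab: "w = (\<alpha>, \<beta>)" by (cases w)
  have s: "\<alpha> \<bullet> v + \<beta> * y \<le> c" if "g v \<le> y" for v y using w(2)[of "(v, y)"] that by (simp add: S_def ab)
  have t: "c \<le> \<alpha> \<bullet> b + \<beta> * y" if "y < g b" for y using w(3)[of "(b, y)"] that by (simp add: T_def ab)
  have "\<beta> \<le> 0"
  proof (rule ccontr)
    assume "\<not> \<beta> \<le> 0"
    then show False using s[of b "g b + 1"] t[of "g b - 1"] by (simp add: algebra_simps)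
  qed
  \<comment> \<open>A vertical hyperplane is impossible because \<open>g\<close> is finite on both
    sides of it; the point \<open>b + \<alpha>\<close> exhibits this.\<close>
  moreover have "\<beta> \<noteq> 0"
  proof
    assume b0: "\<beta> = 0"
    then have "\<alpha> \<bullet> (b + \<alpha>) \<le> \<alpha> \<bullet> b" using s[of "b + \<alpha>" "g (b + \<alpha>)"] t[of "g b - 1"] by simp
    then have "\<alpha> \<bullet> \<alpha> \<le> 0" by (simp add: inner_add_right)
    then have "\<alpha> = 0" using inner_ge_zero[of \<alpha>] inner_eq_zero_iff[of \<alpha>] by linarith
    then show False using w(1) b0 by (simp add: ab zero_prod_def)
  qed
  ultimately have neg: "\<beta> < 0" by simp
  have cb: "c \<le> \<alpha> \<bullet> b + \<beta> * g b"
  proof (rule field_le_epsilon)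
    fix e :: real assume e: "0 < e"
    have "e / \<beta> < 0" using e neg by (simp add: divide_pos_neg)
    then have "c \<le> \<alpha> \<bullet> b + \<beta> * (g b + e / \<beta>)" by (intro t) simp
    then show "c \<le> \<alpha> \<bullet> b + \<beta> * g b + e" using neg by (simp add: distrib_left)
  qed
  show ?thesis
  proof (rule that)
    fix v
    have "\<alpha> \<bullet> v + \<beta> * g v \<le> \<alpha> \<bullet> b + \<beta> * g b" using s[of v "g v"] cb by simp
    then have "\<alpha> \<bullet> (v - b) \<le> - \<beta> * (g v - g b)" by (simp add: algebra_simps inner_diff_right)
    then have "(\<alpha> \<bullet> (v - b)) / (- \<beta>) \<le> g v - g b"
      using neg by (subst pos_divide_le_eq) (simp_all add: mult.commute)
    then show "g b + (\<alpha> /\<^sub>R (- \<beta>)) \<bullet> (v - b) \<le> g v" by (simp add: divide_inverse mult.commute)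
  qed
qed

locale tonelli =
  fixes L :: "'a::euclidean_space \<Rightarrow> 'a \<Rightarrow> real" and \<Theta> :: "'a \<Rightarrow> real"
  assumes nonneg: "0 \<le> L x u"
    and cont: "continuous_on UNIV (\<lambda>(x, u). L x u)"
    and conv: "convex_on UNIV (L x)"
    and superlinear: "filterlim (\<lambda>u. \<Theta> u / norm u) at_top at_infinity"
    and ge: "\<Theta> u \<le> L x u"
begin

lemma superlinearE:
  obtains R where "R > 0" "\<And>u x. R \<le> norm u \<Longrightarrow> A * norm u \<le> L x u"
proof -
  have "\<forall>\<^sub>F u in at_infinity. A \<le> \<Theta> u / norm u" using superlinear by (auto simp: filterlim_at_top)
  then obtain R where R: "\<And>u. R \<le> norm u \<Longrightarrow> A \<le> \<Theta> u / norm u" by (auto simp: eventually_at_infinity)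
  show ?thesis
  proof (rule that[of "max R 1"])
    fix u :: 'a and x assume u: "max R 1 \<le> norm u"
    then have "A \<le> \<Theta> u / norm u" "norm u > 0" using R by auto
    then have "A * norm u \<le> \<Theta> u" by (simp add: pos_le_divide_eq)
    then show "A * norm u \<le> L x u" using ge[of u x] by simp
  qed simp
qed

text \<open>The source of uniform absolute continuity: speed is bounded up to an arbitrarily small
  multiple of the cost, and the total cost stays bounded.\<close>

lemma superlinear_bound:
  assumes e: "e > 0"
  obtains R where "R > 0" "\<And>u x. norm u \<le> R + e * L x u"
proof -
  obtain R where R: "R > 0" "\<And>u x. R \<le> norm u \<Longrightarrow> (1 / e) * norm u \<le> L x u" using superlinearE by blast
  show ?thesis
  proof (rule that[OF R(1)])
    fix u :: 'a and x
    show "norm u \<le> R + e * L x u"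
    proof (cases "R \<le> norm u")
      case True then show ?thesis using R(2)[OF True, of x] e R(1) by (simp add: field_simps)
    next
      case False then show ?thesis using e nonneg[of x u] mult_nonneg_nonneg[of e "L x u"] by linarith
    qed
  qed
qed

lemma bounded_on_compact:
  assumes K: "compact (K :: 'a set)"
  obtains C where "C \<ge> 0" "\<And>x u. x \<in> K \<Longrightarrow> norm u \<le> R \<Longrightarrow> L x u \<le> C"
proof -
  have "compact (K \<times> cball (0::'a) R)" using K by (intro compact_Times) auto
  then have "bounded ((\<lambda>(x, u). L x u) ` (K \<times> cball 0 R))"
    by (intro compact_imp_bounded compact_continuous_image continuous_on_subset[OF cont]) auto
  then obtain C where C: "\<And>y. y \<in> (\<lambda>(x, u). L x u) ` (K \<times> cball 0 R) \<Longrightarrow> norm y \<le> C"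
    unfolding bounded_iff by blast
  show ?thesis
  proof (rule that[of "max C 0"])
    fix x u :: 'a assume "x \<in> K" "norm u \<le> R"
    then have "norm (L x u) \<le> C" by (intro C image_eqI[of _ _ "(x, u)"]) auto
    then show "L x u \<le> max C 0" by auto
  qed simp
qed

lemma uniformly_continuous_on_compact:
  assumes K: "compact (K :: 'a set)" and e: "e > 0"
  obtains r where "r > 0" "\<And>x y u. x \<in> K \<Longrightarrow> norm (y - x) \<le> r \<Longrightarrow> norm u \<le> R \<Longrightarrow> \<bar>L y u - L x u\<bar> \<le> e"
proof -
  \<comment> \<open>The closed unit neighbourhood of \<open>K\<close> is still compact and contains
    the perturbed point \<open>y\<close>, which may lie outside \<open>K\<close>.\<close>
  define K1 where "K1 = {x + y | x y. x \<in> K \<and> y \<in> cball 0 1}"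
  have K1: "compact K1" unfolding K1_def using K by (intro compact_sums) auto
  have "compact (K1 \<times> cball (0::'a) R)" using K1 by (intro compact_Times) auto
  then have "uniformly_continuous_on (K1 \<times> cball 0 R) (\<lambda>(x, u). L x u)"
    by (intro compact_uniformly_continuous continuous_on_subset[OF cont]) auto
  then obtain d where d: "d > 0" "\<And>p q. p \<in> K1 \<times> cball 0 R \<Longrightarrow> q \<in> K1 \<times> cball 0 R \<Longrightarrow> dist q p < d \<Longrightarrow>
      dist ((\<lambda>(x, u). L x u) q) ((\<lambda>(x, u). L x u) p) < e"
    using e unfolding uniformly_continuous_on_def by metis
  show ?thesis
  proof (rule that[of "min 1 (d / 2)"])
    fix x y u :: 'a assume x: "x \<in> K" and y: "norm (y - x) \<le> min 1 (d / 2)" and u: "norm u \<le> R"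
    have "y = x + (y - x)" "x = x + 0" by auto
    then have "x \<in> K1" "y \<in> K1" unfolding K1_def using x y by (fastforce simp: mem_cball_0)+
    then show "\<bar>L y u - L x u\<bar> \<le> e"
      using d(2)[of "(x, u)" "(y, u)"] u y d(1) by (auto simp: dist_Pair_Pair dist_norm)
  qed (use d in auto)
qed

text \<open>The affine minorant of \<open>L y\<close> at \<open>b\<close> persists for nearby \<open>x\<close> and for \<^emph>\<open>all\<close> \<open>v\<close>: uniform continuity
  handles bounded \<open>v\<close>, superlinear growth the others.\<close>

lemma uniform_affine_minorant:
  assumes K: "compact (K :: 'a set)" and e: "e > 0"
  obtains r where "r > 0" "\<And>y b. y \<in> K \<Longrightarrow> norm b \<le> R \<Longrightarrow>
    \<exists>q. (\<forall>v. L y b + q \<bullet> (v - b) \<le> L y v) \<and> (\<forall>x v. norm (x - y) \<le> r \<longrightarrow> L y b + q \<bullet> (v - b) - e \<le> L x v)"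
proof -
  obtain C where C: "C \<ge> 0" "\<And>x u. x \<in> K \<Longrightarrow> norm u \<le> R + 1 \<Longrightarrow> L x u \<le> C"
    using bounded_on_compact[OF K] by blast
  \<comment> \<open>For \<open>norm v \<ge> 1\<close> the affine function is at most
    \<open>C + C * (norm v + \<bar>R\<bar>)\<close>, hence at most this slope times
    \<open>norm v\<close>.\<close>
  obtain R1 where R1: "R1 > 0" "\<And>u x. R1 \<le> norm u \<Longrightarrow> (2 * C + C * \<bar>R\<bar> + 1) * norm u \<le> L x u"
    using superlinearE by blast
  define R2 where "R2 = max R1 1"
  obtain r where r: "r > 0" "\<And>x y u. x \<in> K \<Longrightarrow> norm (y - x) \<le> r \<Longrightarrow> norm u \<le> R2 \<Longrightarrow> \<bar>L y u - L x u\<bar> \<le> e"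
    using uniformly_continuous_on_compact[OF K e] by blast
  show ?thesis
  proof (rule that[OF r(1)])
    fix y b :: 'a assume y: "y \<in> K" and b: "norm b \<le> R"
    obtain q where q: "\<And>v. L y b + q \<bullet> (v - b) \<le> L y v" using convex_on_subgradient[OF conv] by blast
    \<comment> \<open>Moving one unit from \<open>b\<close> in the direction of \<open>q\<close>
      raises the affine minorant by \<open>norm q\<close>; this is why \<open>C\<close> bounds
      \<open>L\<close> up to radius \<open>R + 1\<close>.\<close>
    have nq: "norm q \<le> C"
    proof (cases "q = 0")
      case False
      have "L y b + q \<bullet> ((b + sgn q) - b) \<le> L y (b + sgn q)" by (rule q)
      also have "\<dots> \<le> C" using b y norm_triangle_ineq[of b "sgn q"] by (intro C(2)) (auto simp: norm_sgn False)
      finally have "q \<bullet> sgn q \<le> C" using nonneg[of y b] by simp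
      moreover have "q \<bullet> sgn q = norm q"
        using False by (simp add: sgn_div_norm dot_square_norm power2_eq_square)
      ultimately show ?thesis by simp
    qed (use C in simp)
    have "L y b + q \<bullet> (v - b) - e \<le> L x v" if x: "norm (x - y) \<le> r" for x v
    proof (cases "norm v \<le> R2")
      case True
      then show ?thesis using q[of v] r(2)[OF y x True] by linarith
    next
      case False
      have "q \<bullet> (v - b) \<le> norm q * norm (v - b)" by (rule norm_cauchy_schwarz)
      also have "\<dots> \<le> C * (norm v + \<bar>R\<bar>)"
        using nq b C(1) norm_triangle_ineq4[of v b] by (intro mult_mono) auto
      finally have "L y b + q \<bullet> (v - b) \<le> C + C * (norm v + \<bar>R\<bar>)" using C(2)[OF y, of b] b by simp
      also have "\<dots> \<le> (2 * C + C * \<bar>R\<bar> + 1) * norm v"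
      proof -
        have "(C + C * \<bar>R\<bar>) * 1 \<le> (C + C * \<bar>R\<bar>) * norm v" using False C(1) by (intro mult_left_mono) (auto simp: R2_def)
        then show ?thesis using False by (simp add: algebra_simps R2_def)
      qed
      also have "\<dots> \<le> L x v" using False by (intro R1(2)) (simp add: R2_def)
      finally show ?thesis using e by simp
    qed
    then show "\<exists>q. (\<forall>v. L y b + q \<bullet> (v - b) \<le> L y v) \<and> (\<forall>x v. norm (x - y) \<le> r \<longrightarrow> L y b + q \<bullet> (v - b) - e \<le> L x v)"
      using q by blast
  qed
qed

end

section \<open>Subsolutions and the cost of an arc\<close>

text \<open>Proximal subgradients are Frechet subgradients, since the quadratic error vanishes after
  division by \<open>norm (w - z)\<close>. The penalized extremum problems below produce exactly
  such quadratic supports.\<close>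

lemma subdifferentialI:
  fixes z :: "'a::{real_inner, perfect_space}"
  assumes "\<forall>\<^sub>F w in nhds z. W z + p \<bullet> (w - z) - k * (norm (w - z))\<^sup>2 \<le> W w"
  shows "p \<in> subdifferential W z"
proof -
  have "((\<lambda>w. - k * norm (w - z)) \<longlongrightarrow> - k * norm (z - z)) (at z)"
    by (intro tendsto_intros)
  then have "((\<lambda>w. ereal (- k * norm (w - z))) \<longlongrightarrow> ereal 0) (at z)" by (subst tendsto_ereal) auto
  then have "Liminf (at z) (\<lambda>w. ereal (- k * norm (w - z))) = 0"
    by (intro lim_imp_Liminf) (auto simp: zero_ereal_def)
  moreover have "Liminf (at z) (\<lambda>w. ereal (- k * norm (w - z))) \<le> Liminf (at z) (\<lambda>w. ereal ((W w - W z - p \<bullet> (w - z)) / norm (w - z)))"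
  proof (rule Liminf_mono)
    have "\<forall>\<^sub>F w in at z. W z + p \<bullet> (w - z) - k * (norm (w - z))\<^sup>2 \<le> W w"
      using assms by (simp add: eventually_nhds_conv_at)
    moreover have "\<forall>\<^sub>F w in at z. w \<noteq> z" by (simp add: eventually_at_filter)
    ultimately show "\<forall>\<^sub>F w in at z. ereal (- k * norm (w - z)) \<le> ereal ((W w - W z - p \<bullet> (w - z)) / norm (w - z))"
      by eventually_elim (simp add: pos_le_divide_eq power2_eq_square algebra_simps)
  qed
  ultimately show ?thesis by (simp add: subdifferential_def)
qed

lemma superdifferentialI:
  fixes z :: "'a::{real_inner, perfect_space}"
  assumes "\<forall>\<^sub>F w in nhds z. W w \<le> W z + p \<bullet> (w - z) + k * (norm (w - z))\<^sup>2"
  shows "p \<in> superdifferential W z"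
proof -
  have "- p \<in> subdifferential (\<lambda>w. - W w) z"
    using assms by (intro subdifferentialI[of _ _ _ k]) (auto elim: eventually_mono)
  then show ?thesis unfolding superdifferential_def by force
qed

locale hamilton_jacobi = tonelli L \<Theta> for L :: "'a::euclidean_space \<Rightarrow> 'a \<Rightarrow> real" and \<Theta> :: "'a \<Rightarrow> real" +
  fixes W :: "real \<times> 'a \<Rightarrow> real" and \<phi> :: "'a \<Rightarrow> ennreal"
  assumes W_nonneg: "t > 0 \<Longrightarrow> W (t, x) \<ge> 0"
    and W_cont: "continuous_on ({0<..} \<times> UNIV) W"
    and super: "t > 0 \<Longrightarrow> (p, q) \<in> subdifferential W (t, x) \<Longrightarrow> ereal p + hamiltonian L x (- q) \<ge> 0"
    and sub: "t > 0 \<Longrightarrow> (p, q) \<in> superdifferential W (t, x) \<Longrightarrow> ereal p + hamiltonian L x (- q) \<le> 0"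
    and init: "Liminf (at_right 0 \<times>\<^sub>F nhds x) (\<lambda>(h, y). ennreal (W (h, y))) = \<phi> x"
begin

lemma superdifferential_bound:
  assumes "t > 0" "(p, q) \<in> superdifferential W (t, x)"
  shows "p - q \<bullet> u \<le> L x u"
proof -
  have "ereal (- q \<bullet> u - L x u) \<le> hamiltonian L x (- q)" unfolding hamiltonian_def by (rule SUP_upper) simp
  then have "ereal p + ereal (- q \<bullet> u - L x u) \<le> ereal p + hamiltonian L x (- q)" by (rule add_left_mono)
  also have "\<dots> \<le> 0" using sub[OF assms] .
  finally show ?thesis by simp
qed

text \<open>Doubling of variables along the segment: in the penalized maximum only the right end point
  has to be excluded, because the inequality obtained at the left end point has the useful sign.\<close>

lemma transport_step:
  assumes s: "0 < s" "s < t" and r: "r > 0"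
    and c: "\<And>\<rho> x'. 0 \<le> \<rho> \<Longrightarrow> \<rho> \<le> s \<Longrightarrow> norm (x' - (x + \<rho> *\<^sub>R u)) \<le> r \<Longrightarrow> L x' u \<le> c"
  shows "W (t, x) \<le> W (t - s, x + s *\<^sub>R u) + c * s"
proof (rule ccontr)
  assume "\<not> ?thesis"
  then have g0: "W (t, x) - W (t - s, x + s *\<^sub>R u) - c * s > 0" by simp
  define g where "g = W (t, x) - W (t - s, x + s *\<^sub>R u) - c * s"
  \<comment> \<open>Half of the gap \<open>g\<close> makes the rate strictly larger than
    \<open>c\<close>; the other half keeps \<open>F (s, 0)\<close> below
    \<open>F (0, 0)\<close>.\<close>
  define c' where "c' = c + g / (2 * s)"
  have g: "g > 0" using g0 by (simp add: g_def)
  have c'c: "c < c'" using g s by (simp add: c'_def)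
  have c's: "W (t - s, x + s *\<^sub>R u) + c' * s = W (t, x) - g / 2" using s by (simp add: c'_def g_def field_simps)
  define d where "d = (- 1 :: real, u)"
  define z0 where "z0 = (t, x)"
  \<comment> \<open>The bound by \<open>r\<close> keeps the spatial shift where \<open>c\<close> is
    valid; the bound by \<open>(t - s) / 2\<close> keeps all times positive.\<close>
  define r1 where "r1 = min r ((t - s) / 2)"
  have "r1 \<le> (t - s) / 2" unfolding r1_def by (rule min.cobounded2)
  then have "r1 < t - s" using s by (simp add: field_simps)
  moreover have "r1 > 0" "r1 \<le> r" using r s by (auto simp: r1_def)
  ultimately have r1: "r1 > 0" "r1 \<le> r" "r1 < t - s" by auto
  define F where "F = (\<lambda>(\<rho>, w). W (z0 + \<rho> *\<^sub>R d + w) + c' * \<rho>)"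
  have pos: "fst (z0 + \<rho> *\<^sub>R d + w) > 0" if "\<rho> \<in> {0..s}" "w \<in> cball 0 r1" for \<rho> w
  proof -
    have "\<bar>fst w\<bar> \<le> r1" using that norm_fst_le[of "fst w" "snd w"] by (simp add: mem_cball_0)
    then have "0 < t - \<rho> + fst w" using that(1) r1(3) unfolding atLeastAtMost_iff by linarith
    then show ?thesis by (simp add: z0_def d_def)
  qed
  have Fc: "continuous_on ({0..s} \<times> cball 0 r1) F"
    unfolding F_def case_prod_beta
  proof (intro continuous_intros continuous_on_compose2[OF W_cont])
    show "(\<lambda>p. z0 + fst p *\<^sub>R d + snd p) ` ({0..s} \<times> cball 0 r1) \<subseteq> {0<..} \<times> UNIV"
    proof
      fix z assume "z \<in> (\<lambda>p. z0 + fst p *\<^sub>R d + snd p) ` ({0..s} \<times> cball 0 r1)"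
      then obtain \<rho> w where "z = z0 + \<rho> *\<^sub>R d + w" "\<rho> \<in> {0..s}" "w \<in> cball 0 r1" by force
      then have "0 < fst z" using pos by simp
      then show "z \<in> {0<..} \<times> UNIV" by (simp add: mem_Times_iff)
    qed
  qed
  have F0: "F (0, 0) = W (t, x)" by (simp add: F_def z0_def)
  have Fs: "F (s, 0) = W (t, x) - g / 2" using c's by (simp add: F_def z0_def d_def)
  have "(s, 0) \<in> {0..s} \<times> cball (0::real \<times> 'a) r1" using s r1 by simp
  then obtain e where e: "e > 0" "\<And>p. p \<in> {0..s} \<times> cball 0 r1 \<Longrightarrow> dist p (s, 0) < e \<Longrightarrow> dist (F p) (F (s, 0)) < g / 2"
    using Fc g unfolding continuous_on_iff by (metis half_gt_zero)
  define r2 where "r2 = min r1 (e / 2)"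
  have r2: "r2 > 0" "r2 \<le> r1" "r2 < e" using r1 e by (auto simp: r2_def)
  \<comment> \<open>This excludes the right end point: no maximum with value at least
    \<open>F (0, 0)\<close> can have \<rho> equal to \<open>s\<close>.\<close>
  have end_low: "F (s, w) < W (t, x)" if "w \<in> cball 0 r2" for w
  proof -
    have "dist (F (s, w)) (F (s, 0)) < g / 2"
      by (rule e(2)) (use that r2 s in \<open>auto simp: dist_Pair_Pair\<close>)
    then show ?thesis using Fs unfolding dist_real_def by linarith
  qed
  have comp: "compact ({0..s} \<times> cball (0::real \<times> 'a) r2)" by (intro compact_Times) auto
  have Fc2: "continuous_on ({0..s} \<times> cball 0 r2) F" by (rule continuous_on_subset[OF Fc]) (use r2 in auto)
  have "bounded (F ` ({0..s} \<times> cball 0 r2))"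
    by (intro compact_imp_bounded compact_continuous_image Fc2 comp)
  then obtain M where M: "\<And>p. p \<in> {0..s} \<times> cball 0 r2 \<Longrightarrow> norm (F p) \<le> M"
    unfolding bounded_iff by blast
  \<comment> \<open>The penalty at \<open>norm w = r2\<close> outweighs the bound \<open>M\<close>
    of \<open>F\<close>, so the maximum is interior in \<open>w\<close>.\<close>
  define k where "k = (\<bar>M\<bar> + \<bar>W (t, x)\<bar> + 1) / r2\<^sup>2"
  have k: "k > 0" using r2 by (simp add: k_def)
  have kr: "M - k * r2\<^sup>2 < W (t, x)" using r2 by (simp add: k_def)
  define \<Psi> where "\<Psi> = (\<lambda>p. F p - k * (norm (snd p))\<^sup>2)"
  have "continuous_on ({0..s} \<times> cball 0 r2) \<Psi>" unfolding \<Psi>_def by (intro continuous_intros Fc2)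
  moreover have "{0..s} \<times> cball (0::real \<times> 'a) r2 \<noteq> {}" using s r2 by auto
  ultimately obtain q where q: "q \<in> {0..s} \<times> cball 0 r2" "\<And>p. p \<in> {0..s} \<times> cball 0 r2 \<Longrightarrow> \<Psi> p \<le> \<Psi> q"
    using continuous_attains_sup[OF comp] by blast
  obtain \<rho> w where rw: "q = (\<rho>, w)" by (cases q)
  have "\<Psi> (0, 0) \<le> \<Psi> q" by (rule q(2)) (use s r2 in auto)
  then have big: "W (t, x) \<le> F (\<rho>, w) - k * (norm w)\<^sup>2" by (simp add: \<Psi>_def F0 rw)
  have \<rho>: "0 \<le> \<rho>" "\<rho> \<le> s" "norm w \<le> r2" using q(1) by (auto simp: rw)
  have \<rho>s: "\<rho> < s"
  proof (rule ccontr)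
    assume "\<not> \<rho> < s"
    then have "\<rho> = s" using \<rho> by simp
    moreover have "0 \<le> k * (norm w)\<^sup>2" using k by simp
    moreover have "F (s, w) < W (t, x)" using \<rho> by (intro end_low) simp
    ultimately show False using big by simp
  qed
  have wr: "norm w < r2"
  proof (rule ccontr)
    assume "\<not> norm w < r2"
    then have "norm w = r2" using \<rho> by simp
    then show False using M[of "(\<rho>, w)"] q(1) big kr by (auto simp: rw)
  qed
  define z where "z = z0 + \<rho> *\<^sub>R d + w"
  obtain t1 x1 where z: "z = (t1, x1)" by (cases z)
  have t1: "t1 > 0" using pos[of \<rho> w] \<rho> r2 z by (simp add: z_def[symmetric])
  \<comment> \<open>With \<rho> held fixed, maximality in \<open>w\<close> gives a quadratic upper
    support of \<open>W\<close> at \<open>z\<close> whose slope is the gradient of the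
    penalty.\<close>
  have "(2 * k) *\<^sub>R w \<in> superdifferential W z"
  proof (rule superdifferentialI[of _ _ _ k])
    have "\<forall>\<^sub>F v in nhds z. dist v z < r2 - norm w" using wr by (simp add: eventually_nhds_metric) (metis diff_gt_0_iff_gt)
    then show "\<forall>\<^sub>F v in nhds z. W v \<le> W z + (2 * k) *\<^sub>R w \<bullet> (v - z) + k * (norm (v - z))\<^sup>2"
    proof eventually_elim
      case (elim v)
      define w' where "w' = w + (v - z)"
      have "norm w' \<le> norm w + norm (v - z)" unfolding w'_def by (rule norm_triangle_ineq)
      then have "\<Psi> (\<rho>, w') \<le> \<Psi> q" using elim \<rho> by (intro q(2)) (auto simp: dist_norm)
      then have "W v - k * (norm w')\<^sup>2 \<le> W z - k * (norm w)\<^sup>2"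
        by (simp add: \<Psi>_def F_def rw z_def w'_def)
      moreover have "(norm w')\<^sup>2 = (norm w)\<^sup>2 + 2 * (w \<bullet> (v - z)) + (norm (v - z))\<^sup>2"
        unfolding w'_def power2_norm_eq_inner by (simp add: inner_add inner_commute)
      ultimately show ?case by (simp add: algebra_simps)
    qed
  qed
  then have "((2 * k) * fst w, (2 * k) *\<^sub>R snd w) \<in> superdifferential W (t1, x1)" by (simp add: z scaleR_prod_def)
  from superdifferential_bound[OF t1 this, of u]
  have "2 * k * fst w - (2 * k) *\<^sub>R snd w \<bullet> u \<le> L x1 u" by simp
  also have "L x1 u \<le> c"
  proof (rule c[OF \<rho>(1,2)])
    have "x1 - (x + \<rho> *\<^sub>R u) = snd w" using arg_cong[OF z, of snd] by (simp add: z_def z0_def d_def algebra_simps)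
    moreover have "norm (snd w) \<le> norm w" using norm_snd_le[of "snd w" "fst w"] by simp
    ultimately show "norm (x1 - (x + \<rho> *\<^sub>R u)) \<le> r" using \<rho> r1 r2 by simp
  qed
  finally have wd: "- (2 * k * (w \<bullet> d)) \<le> c" by (simp add: d_def inner_prod_def algebra_simps)
  \<comment> \<open>The second variation moves \<rho> forward by \<open>h\<close> and
    \<open>w\<close> back by \<open>h\<close> times \<open>d\<close>, so the argument of
    \<open>W\<close> does not change and only rate and penalty are compared. It needs \<rho>
    strictly below \<open>s\<close> but may start at \<rho> equal to \<open>0\<close>. Together with
    \<open>wd\<close> it contradicts \<open>c < c'\<close>.\<close>
  have "c' + 2 * k * (w \<bullet> d) \<le> 0 + \<epsilon>" if \<epsilon>: "\<epsilon> > 0" for \<epsilon>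
  proof -
    define h where "h = min (s - \<rho>) (min ((r2 - norm w) / (norm d + 1)) (\<epsilon> / (k * ((norm d)\<^sup>2 + 1))))"
    have h: "h > 0" unfolding h_def using \<rho>s wr \<epsilon> k by (simp add: add_nonneg_pos)
    have h1: "h \<le> s - \<rho>" unfolding h_def by (rule min.cobounded1)
    have "h \<le> (r2 - norm w) / (norm d + 1)" unfolding h_def by (rule min.coboundedI2, rule min.cobounded1)
    then have "h * (norm d + 1) \<le> r2 - norm w" by (simp add: pos_le_divide_eq add_nonneg_pos)
    then have h2: "h * norm d \<le> r2 - norm w" using h by (simp add: distrib_left)
    have "h \<le> \<epsilon> / (k * ((norm d)\<^sup>2 + 1))" unfolding h_def by (rule min.coboundedI2, rule min.cobounded2)
    then have "h * (k * ((norm d)\<^sup>2 + 1)) \<le> \<epsilon>" using k by (simp add: pos_le_divide_eq add_nonneg_pos)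
    moreover have "k * h * (norm d)\<^sup>2 \<le> h * (k * ((norm d)\<^sup>2 + 1))" using h k by (simp add: algebra_simps)
    ultimately have h3: "k * h * (norm d)\<^sup>2 \<le> \<epsilon>" by linarith
    define w' where "w' = w - h *\<^sub>R d"
    have "norm w' \<le> norm w + h * norm d" unfolding w'_def using h norm_triangle_ineq4[of w "h *\<^sub>R d"] by simp
    then have "\<Psi> (\<rho> + h, w') \<le> \<Psi> q" using \<rho> h h1 h2 by (intro q(2)) auto
    then have "c' * (\<rho> + h) - k * (norm w')\<^sup>2 \<le> c' * \<rho> - k * (norm w)\<^sup>2"
      by (simp add: \<Psi>_def F_def rw w'_def algebra_simps)
    then have "c' * h \<le> k * (norm w')\<^sup>2 - k * (norm w)\<^sup>2" by (simp add: algebra_simps)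
    also have "(norm w')\<^sup>2 = (norm w)\<^sup>2 - 2 * h * (w \<bullet> d) + h\<^sup>2 * (norm d)\<^sup>2"
      unfolding w'_def power2_norm_eq_inner by (simp add: inner_diff inner_commute power2_eq_square)
    finally have "h * (c' + 2 * k * (w \<bullet> d)) \<le> h * (k * h * (norm d)\<^sup>2)"
      by (simp add: algebra_simps power2_eq_square)
    then have "c' + 2 * k * (w \<bullet> d) \<le> k * h * (norm d)\<^sup>2" using h by simp
    then show ?thesis using h3 by simp
  qed
  then have "c' + 2 * k * (w \<bullet> d) \<le> 0" by (rule field_le_epsilon)
  then show False using wd c'c by simp
qed

text \<open>The segment estimate is iterated by removing the edge at \<open>p 0\<close>, which is
  travelled at the largest time. Each edge has its own travel time and its own cost bound; \<rho> is
  the fraction of the edge already travelled.\<close>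

lemma polygon_bound:
  assumes h: "h > 0" and r: "r > 0" and \<tau>: "\<And>i. i < N \<Longrightarrow> \<tau> i > 0"
    and c: "\<And>i \<rho> x'. i < N \<Longrightarrow> 0 \<le> \<rho> \<Longrightarrow> \<rho> \<le> 1 \<Longrightarrow> norm (x' - (p i + \<rho> *\<^sub>R (p (Suc i) - p i))) \<le> r \<Longrightarrow>
        L x' ((p (Suc i) - p i) /\<^sub>R \<tau> i) \<le> c i"
  shows "W (h + (\<Sum>i<N. \<tau> i), p 0) \<le> W (h, p N) + (\<Sum>i<N. c i * \<tau> i)"
  using \<tau> c
proof (induction N arbitrary: p \<tau> c)
  case 0 then show ?case by simp
next
  case (Suc N)
  have IH: "W (h + (\<Sum>i<N. \<tau> (Suc i)), p (Suc 0)) \<le> W (h, p (Suc N)) + (\<Sum>i<N. c (Suc i) * \<tau> (Suc i))"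
    by (rule Suc.IH[of "\<lambda>i. \<tau> (Suc i)" "\<lambda>i. p (Suc i)" "\<lambda>i. c (Suc i)"]) (use Suc.prems in auto)
  have \<tau>0: "\<tau> 0 > 0" using Suc.prems(1) by simp
  define T where "T = h + (\<Sum>i<N. \<tau> (Suc i))"
  have T: "T > 0" unfolding T_def using Suc.prems(1) h by (intro add_pos_nonneg sum_nonneg) (auto intro: less_imp_le)
  define u where "u = (p (Suc 0) - p 0) /\<^sub>R \<tau> 0"
  have "W (\<tau> 0 + T, p 0) \<le> W (\<tau> 0 + T - \<tau> 0, p 0 + \<tau> 0 *\<^sub>R u) + c 0 * \<tau> 0"
  proof (rule transport_step[OF \<tau>0 _ r])
    fix \<rho> x' assume \<rho>: "0 \<le> \<rho>" "\<rho> \<le> \<tau> 0" and x': "norm (x' - (p 0 + \<rho> *\<^sub>R u)) \<le> r"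
    have e: "\<rho> *\<^sub>R u = (\<rho> / \<tau> 0) *\<^sub>R (p (Suc 0) - p 0)" by (simp add: u_def divide_inverse)
    show "L x' u \<le> c 0" unfolding u_def
      by (rule Suc.prems(2)[of 0 "\<rho> / \<tau> 0"]) (use \<rho> x' \<tau>0 in \<open>auto simp: e\<close>)
  qed (use T in simp)
  moreover have "p 0 + \<tau> 0 *\<^sub>R u = p (Suc 0)" using \<tau>0 by (simp add: u_def)
  ultimately show ?case using IH
    unfolding sum.lessThan_Suc_shift by (simp add: T_def algebra_simps)
qed

end

section \<open>Dyadic lower bounds for the cost of an arc\<close>

lemma sum_indicator_disjoint:
  fixes g :: "'i \<Rightarrow> real"
  assumes "finite J" "disjoint_family_on A J" and nn: "\<And>i. i \<in> J \<Longrightarrow> s \<in> A i \<Longrightarrow> g i \<le> b" and "0 \<le> b"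
  shows "(\<Sum>i\<in>J. indicator (A i) s * g i) \<le> b"
proof (cases "\<exists>i\<in>J. s \<in> A i")
  case True
  then obtain i where i: "i \<in> J" "s \<in> A i" by blast
  have "(\<Sum>j\<in>J. indicator (A j) s * g j) = (\<Sum>j\<in>J. if j = i then g i else 0)"
    using assms(2) i by (intro sum.cong refl) (auto simp: disjoint_family_on_def indicator_def)
  then show ?thesis using i assms(1) nn by simp
next
  case False
  then have "(\<Sum>i\<in>J. indicator (A i) s * g i) = (\<Sum>i\<in>J. 0)" by (intro sum.cong refl) auto
  then show ?thesis using assms by simp
qed

text \<open>The affine minorants used below may be negative; \<open>ennreal\<close> replaces them by
  their positive parts, which can only increase the integral.\<close>

lemma integral_le_nn_integral:
  assumes "integrable M g"
  shows "ennreal (integral\<^sup>L M g) \<le> (\<integral>\<^sup>+ s. ennreal (g s) \<partial>M)"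
proof -
  have int: "integrable M (\<lambda>s. max 0 (g s))" using assms by simp
  have "ennreal (integral\<^sup>L M g) \<le> ennreal (integral\<^sup>L M (\<lambda>s. max 0 (g s)))"
    by (intro ennreal_leI integral_mono assms int) auto
  also have "\<dots> = (\<integral>\<^sup>+ s. ennreal (max 0 (g s)) \<partial>M)"
    by (rule nn_integral_eq_integral[OF int, symmetric]) auto
  also have "\<dots> = (\<integral>\<^sup>+ s. ennreal (g s) \<partial>M)"
    by (intro nn_integral_cong) (auto simp: max_def ennreal_neg)
  finally show ?thesis .
qed

lemma norm_capped_speed:
  fixes v :: "'a::real_normed_vector"
  assumes "R > 0" "h > 0"
  shows "norm (v /\<^sub>R max h (norm v / R)) \<le> R"
proof -
  have pos: "0 < max h (norm v / R)" using assms by auto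
  have "norm v / R \<le> max h (norm v / R)" by simp
  then have "norm v \<le> max h (norm v / R) * R" using assms by (simp only: pos_divide_le_eq)
  then have "norm v / max h (norm v / R) \<le> R" using pos by (simp only: pos_divide_le_eq mult.commute)
  then show ?thesis using pos by (simp add: divide_inverse mult.commute)
qed

text \<open>\<open>\<tau> i\<close> is the time needed to travel the \<open>i\<close>-th increment at speed at most \<open>R\<close>. By convexity the cost
  of slowing down exceeds the original cost by at most \<open>C0\<close> per unit of additional time.\<close>

lemma (in tonelli) cost_ge_dyadic_sum:
  assumes ac: "absolutely_continuous_on {0..t} y" and t: "t > 0" and e: "e > 0" and R: "R > 0"
    and C0: "\<And>s. s \<in> {0..t} \<Longrightarrow> L (y s) 0 \<le> C0"
    and J: "(\<integral>\<^sup>+ s\<in>{0..t}. ennreal (L (y s) (vector_derivative y (at s within {0..t}))) \<partial>lebesgue) = ennreal J" "J \<ge> 0"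
  obtains n0 where "\<And>n h x \<Delta> \<tau>. n \<ge> n0 \<Longrightarrow> h = t / 2^n \<Longrightarrow> x = (\<lambda>i. y (real i * h)) \<Longrightarrow>
    \<Delta> = (\<lambda>i. x (Suc i) - x i) \<Longrightarrow> \<tau> = (\<lambda>i. max h (norm (\<Delta> i) / R)) \<Longrightarrow>
    (\<Sum>i<2^n. \<tau> i * L (x i) (\<Delta> i /\<^sub>R \<tau> i) - (\<tau> i - h) * C0) \<le> J + e * t"
proof -
  define f' where "f' = (\<lambda>s. vector_derivative y (at s within {0..t}))"
  have yc: "continuous_on {0..t} y" by (rule absolutely_continuous_on_imp_continuous_on[OF ac])
  have K: "compact (y ` {0..t})" by (intro compact_continuous_image yc) auto
  obtain r where r: "r > 0" "\<And>x b. x \<in> y ` {0..t} \<Longrightarrow> norm b \<le> R \<Longrightarrow>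
    \<exists>q. (\<forall>v. L x b + q \<bullet> (v - b) \<le> L x v) \<and> (\<forall>x' v. norm (x' - x) \<le> r \<longrightarrow> L x b + q \<bullet> (v - b) - e \<le> L x' v)"
    using uniform_affine_minorant[OF K e] by blast
  have "uniformly_continuous_on {0..t} y" by (intro compact_uniformly_continuous yc) auto
  then obtain d where d: "d > 0" "\<And>s s'. s \<in> {0..t} \<Longrightarrow> s' \<in> {0..t} \<Longrightarrow> dist s' s < d \<Longrightarrow> dist (y s') (y s) < r"
    using r(1) unfolding uniformly_continuous_on_def by metis
  obtain n0 where n0: "\<And>n. n \<ge> n0 \<Longrightarrow> t / 2^n < d" using dyadic_mesh_less[OF d(1)] by blast
  show ?thesis
  proof (rule that)
    fix n h x \<Delta> \<tau>
    assume n: "n \<ge> n0" and h_def: "h = t / 2^n" and x_def: "x = (\<lambda>i. y (real i * h))"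
      and \<Delta>_def: "\<Delta> = (\<lambda>i. x (Suc i) - x i)" and \<tau>_def: "\<tau> = (\<lambda>i. max h (norm (\<Delta> i) / R))"
    have h0: "h > 0" using t by (simp add: h_def)
    have hd: "h < d" using n0[OF n] by (simp add: h_def)
    have grid: "real i * h \<in> {0..t}" if "i \<le> 2^n" for i
      unfolding h_def by (rule dyadic_grid_mem[OF t that])
    define b where "b = (\<lambda>i. \<Delta> i /\<^sub>R \<tau> i)"
    have \<tau>h: "\<tau> i \<ge> h" for i by (simp add: \<tau>_def)
    have \<tau>0: "\<tau> i > 0" for i using \<tau>h[of i] h0 by linarith
    have bR: "norm (b i) \<le> R" for i unfolding b_def \<tau>_def by (rule norm_capped_speed[OF R h0])
    have xK: "x i \<in> y ` {0..t}" if "i < 2^n" for i using grid[of i] that by (auto simp: x_def)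
    have "\<forall>i. \<exists>q. i < 2^n \<longrightarrow> (\<forall>v. L (x i) (b i) + q \<bullet> (v - b i) \<le> L (x i) v) \<and>
       (\<forall>x' v. norm (x' - x i) \<le> r \<longrightarrow> L (x i) (b i) + q \<bullet> (v - b i) - e \<le> L x' v)"
      using r(2)[OF xK bR] by blast
    then obtain q where q: "\<And>i v. i < 2^n \<Longrightarrow> L (x i) (b i) + q i \<bullet> (v - b i) \<le> L (x i) v"
       "\<And>i x' v. i < 2^n \<Longrightarrow> norm (x' - x i) \<le> r \<Longrightarrow> L (x i) (b i) + q i \<bullet> (v - b i) - e \<le> L x' v"
      by metis
    \<comment> \<open>The affine minorant of \<open>L\<close> taken at the capped slope
      \<open>b i\<close> but evaluated at the true velocity. Its integral over the cell is explicit,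
      because that of the velocity is \<Delta> \<open>i\<close>.\<close>
    define l where "l = (\<lambda>i s. L (x i) (b i) + q i \<bullet> (f' s - b i) - e)"
    define A where "A = (\<lambda>i. {real i * h<..<real (Suc i) * h})"
    have sep: "real (Suc i) * h \<le> real j * h" if "i < j" for i j
      using grid_mono[OF h0 that] .
    have Asub: "A i \<subseteq> {real i * h..real (Suc i) * h}" "{real i * h..real (Suc i) * h} \<subseteq> {0..t}" if "i < 2^n" for i
      using grid[of i] grid[of "Suc i"] that by (auto simp: A_def)
    have disj: "disjoint_family_on A {..<2^n}"
      unfolding disjoint_family_on_def
    proof (intro ballI impI)
      fix i j :: nat assume "i \<noteq> j"
      then consider "i < j" | "j < i" by linarith
      then show "A i \<inter> A j = {}"
      proof cases
        case 1 then show ?thesis using sep[OF 1] by (auto simp: A_def)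
      next
        case 2 then show ?thesis using sep[OF 2] by (auto simp: A_def)
      qed
    qed
    have fi: "f' absolutely_integrable_on {real i * h..real (Suc i) * h}" if "i < 2^n" for i
      unfolding f'_def
      by (rule set_integrable_subset[OF absolutely_continuous_on_absolutely_integrable[OF ac t] _ Asub(2)[OF that]]) auto
    have li: "l i absolutely_integrable_on {real i * h..real (Suc i) * h}" if "i < 2^n" for i
    proof -
      have "(\<lambda>s. f' s \<bullet> q i + (L (x i) (b i) - q i \<bullet> b i - e)) absolutely_integrable_on {real i * h..real (Suc i) * h}"
        by (intro set_integral_add absolutely_integrable_component[OF fi[OF that]] absolutely_integrable_continuous_real continuous_on_const)
      moreover have "l i = (\<lambda>s. f' s \<bullet> q i + (L (x i) (b i) - q i \<bullet> b i - e))"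
        by (auto simp: l_def inner_diff_right inner_commute fun_eq_iff)
      ultimately show ?thesis by simp
    qed
    have il: "\<tau> i * L (x i) (b i) - (\<tau> i - h) * C0 - e * h \<le> integral (A i) (l i)" if i: "i < 2^n" for i
    proof -
      have hi: "measure lborel {real i * h..real (Suc i) * h} = h" using h0 by (simp add: algebra_simps)
      have "(f' has_integral \<Delta> i) {real i * h..real (Suc i) * h}"
        unfolding f'_def \<Delta>_def x_def using grid[of i] grid[of "Suc i"] i h0
        by (intro absolutely_continuous_on_has_integral[OF ac t]) (auto intro!: mult_right_mono)
      from has_integral_linear[OF this bounded_linear_inner_left, of "q i"]
      have "((\<lambda>s. f' s \<bullet> q i) has_integral \<Delta> i \<bullet> q i) {real i * h..real (Suc i) * h}"
        by (simp add: o_def)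
      moreover have "((\<lambda>s. L (x i) (b i) - q i \<bullet> b i - e) has_integral h *\<^sub>R (L (x i) (b i) - q i \<bullet> b i - e)) {real i * h..real (Suc i) * h}"
        using has_integral_const_real[of "L (x i) (b i) - q i \<bullet> b i - e" "real i * h" "real (Suc i) * h"] unfolding hi .
      ultimately have "((\<lambda>s. f' s \<bullet> q i + (L (x i) (b i) - q i \<bullet> b i - e)) has_integral
          \<Delta> i \<bullet> q i + h *\<^sub>R (L (x i) (b i) - q i \<bullet> b i - e)) {real i * h..real (Suc i) * h}"
        by (rule has_integral_add)
      moreover have "l i = (\<lambda>s. f' s \<bullet> q i + (L (x i) (b i) - q i \<bullet> b i - e))"
        by (auto simp: l_def inner_diff_right inner_commute fun_eq_iff)
      ultimately have "integral {real i * h..real (Suc i) * h} (l i) = \<Delta> i \<bullet> q i + h * (L (x i) (b i) - q i \<bullet> b i - e)"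
        by (simp add: integral_unique)
      then have I: "integral (A i) (l i) = \<Delta> i \<bullet> q i + h * (L (x i) (b i) - q i \<bullet> b i - e)"
        unfolding A_def integral_open_interval_real[symmetric] .
      have "\<Delta> i = \<tau> i *\<^sub>R b i" using \<tau>0[of i] by (simp add: b_def)
      then have Dq: "\<Delta> i \<bullet> q i = \<tau> i * (q i \<bullet> b i)" by (metis inner_commute inner_scaleR_right)
      \<comment> \<open>Testing the subgradient at velocity \<open>0\<close> bounds
        \<open>q i \<bullet> b i\<close> from below. Multiplied by the extra time \<tau>
        \<open>i - h\<close>, it pays for running the slower velocity for the full time \<tau>
        \<open>i\<close>.\<close>
      have "L (x i) 0 \<le> C0" using C0[OF grid[of i]] i by (simp add: x_def)
      then have "L (x i) (b i) - C0 \<le> q i \<bullet> b i" using q(1)[OF i, of 0] by (simp add: inner_diff_right)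
      then have "(\<tau> i - h) * (L (x i) (b i) - C0) \<le> (\<tau> i - h) * (q i \<bullet> b i)"
        using \<tau>h[of i] by (intro mult_left_mono) auto
      then show ?thesis unfolding I Dq by (simp add: algebra_simps)
    qed
    have lA: "integrable lebesgue (\<lambda>s. indicator (A i) s * l i s)" "(LINT s|lebesgue. indicator (A i) s * l i s) = integral (A i) (l i)"
      if "i < 2^n" for i
    proof -
      have "l i absolutely_integrable_on A i"
        by (rule set_integrable_subset[OF li[OF that]]) (use Asub[OF that] in \<open>auto simp: A_def\<close>)
      then show "integrable lebesgue (\<lambda>s. indicator (A i) s * l i s)" "(LINT s|lebesgue. indicator (A i) s * l i s) = integral (A i) (l i)"
        using set_lebesgue_integral_eq_integral(2)[of "A i" "l i"] by (auto simp: set_integrable_def set_lebesgue_integral_def)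
    qed
    define g where "g = (\<lambda>s. \<Sum>i<2^n. indicator (A i) s * l i s)"
    have gint: "integrable lebesgue g" unfolding g_def by (intro Bochner_Integration.integrable_sum lA(1)) auto
    have gval: "(LINT s|lebesgue. g s) = (\<Sum>i<2^n. integral (A i) (l i))"
      unfolding g_def using lA by (subst Bochner_Integration.integral_sum) auto
    have "ennreal (LINT s|lebesgue. g s) \<le> (\<integral>\<^sup>+ s. ennreal (g s) \<partial>lebesgue)" by (rule integral_le_nn_integral[OF gint])
    also have "\<dots> \<le> (\<integral>\<^sup>+ s\<in>{0..t}. ennreal (L (y s) (f' s)) \<partial>lebesgue)"
    proof (rule nn_integral_mono)
      fix s
      have "g s \<le> indicator {0..t} s * L (y s) (f' s)"
        unfolding g_def
      proof (rule sum_indicator_disjoint[OF _ disj])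
        fix i :: nat assume "i \<in> {..<2^n}" and s: "s \<in> A i"
        then have i: "i < 2^n" by simp
        have st: "s \<in> {0..t}" using Asub[OF i] s by blast
        have "dist s (real i * h) < d" using s hd by (auto simp: A_def dist_real_def algebra_simps)
        then have "norm (y s - x i) \<le> r" using d(2)[OF grid[of i] st] i by (simp add: x_def dist_norm)
        then show "l i s \<le> indicator {0..t} s * L (y s) (f' s)" using q(2)[OF i, of "y s" "f' s"] st by (simp add: l_def)
      qed (use nonneg in auto)
      then show "ennreal (g s) \<le> ennreal (L (y s) (f' s)) * indicator {0..t} s"
        by (auto simp: indicator_def ennreal_neg split: if_splits intro: ennreal_leI)
    qed
    also have "\<dots> = ennreal J" using J(1) by (simp add: f'_def)
    finally have "(\<Sum>i<2^n. integral (A i) (l i)) \<le> J" using J(2) unfolding gval by (simp add: ennreal_le_iff)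
    moreover have "(\<Sum>i<2^n. \<tau> i * L (x i) (b i) - (\<tau> i - h) * C0 - e * h) \<le> (\<Sum>i<2^n. integral (A i) (l i))"
      by (rule sum_mono) (use il in auto)
    moreover have "(\<Sum>i<(2::nat)^n. e * h) = e * t" by (simp add: h_def)
    ultimately have "(\<Sum>i<2^n. \<tau> i * L (x i) (b i) - (\<tau> i - h) * C0) \<le> J + e * t"
      unfolding sum_subtractf by linarith
    then show "(\<Sum>i<2^n. \<tau> i * L (x i) (\<Delta> i /\<^sub>R \<tau> i) - (\<tau> i - h) * C0) \<le> J + e * t"
      unfolding b_def .
  qed
qed

section \<open>The bound of \<open>W\<close> by the cost of an arbitrary arc\<close>

context hamilton_jacobi
begin

text \<open>A limit inferior below \<open>c\<close> is witnessed arbitrarily close to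
  \<open>(0, z)\<close>: otherwise \<open>W \<ge> c\<close> on a whole one-sided neighbourhood. The
  point \<open>v\<close> need not be \<open>z\<close>, which forces the later shift of the
  polygon.\<close>

lemma init_approx:
  assumes "\<phi> z < ennreal c" "e > 0"
  obtains h v where "0 < h" "h < e" "norm (v - z) < e" "W (h, v) < c"
proof -
  have "\<exists>h v. 0 < h \<and> h < e \<and> norm (v - z) < e \<and> W (h, v) < c"
  proof (rule ccontr)
    assume "\<not> ?thesis"
    then have no: "c \<le> W (h, v)" if "0 < h" "h < e" "norm (v - z) < e" for h v using that not_le by blast
    have "\<forall>\<^sub>F h in at_right 0. 0 < h \<and> h < e"
      using assms(2) by (auto simp: eventually_at_right[of 0 1] intro!: exI[of _ e])
    moreover have "\<forall>\<^sub>F v in nhds z. norm (v - z) < e" using assms(2) by (auto simp: eventually_nhds_metric dist_norm)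
    ultimately have "\<forall>\<^sub>F p in at_right 0 \<times>\<^sub>F nhds z. (0 < fst p \<and> fst p < e) \<and> norm (snd p - z) < e"
      by (auto simp: eventually_prod_filter)
    then have "\<forall>\<^sub>F p in at_right 0 \<times>\<^sub>F nhds z. ennreal c \<le> (\<lambda>(h, y). ennreal (W (h, y))) p"
      by eventually_elim (auto intro!: ennreal_leI no)
    then have "ennreal c \<le> \<phi> z" unfolding init[symmetric] by (rule Liminf_bounded)
    then show False using assms(1) by simp
  qed
  then show ?thesis using that by blast
qed

lemma value_le_cost:
  assumes ac: "absolutely_continuous_on {0..t} y" and t: "t > 0"
  shows "ennreal (W (t, y 0)) \<le> bolza_cost L \<phi> t y"
proof (cases "bolza_cost L \<phi> t y = top")
  case False
  define Jn where "Jn = (\<integral>\<^sup>+ s\<in>{0..t}. ennreal (L (y s) (vector_derivative y (at s within {0..t}))) \<partial>lebesgue)"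
  have fin: "Jn \<noteq> top" "\<phi> (y t) \<noteq> top" using False by (auto simp: bolza_cost_def Jn_def)
  obtain J where J: "J \<ge> 0" "Jn = ennreal J" using fin(1) by (cases Jn) auto
  obtain P where P: "P \<ge> 0" "\<phi> (y t) = ennreal P" using fin(2) by (cases "\<phi> (y t)") auto
  have yc: "continuous_on {0..t} y" by (rule absolutely_continuous_on_imp_continuous_on[OF ac])
  have K: "compact (y ` {0..t})" by (intro compact_continuous_image yc) auto
  obtain C0 where C0: "C0 \<ge> 0" "\<And>x u. x \<in> y ` {0..t} \<Longrightarrow> norm u \<le> 0 \<Longrightarrow> L x u \<le> C0"
    using bounded_on_compact[OF K] by blast
  obtain V where V: "V \<ge> 0" "\<And>m. (\<Sum>i<2^m. (t / 2^m) * norm (dyadic_slope y t m i)) \<le> V"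
    using absolutely_continuous_on_dyadic_variation[OF ac t] by blast
  \<comment> \<open>The error consists of \<open>e * t\<close> from the dyadic sum,
    \<open>e * (t + 1)\<close> from the uniform continuity of \<open>L\<close>, and one
    \<open>e\<close> each for the terminal value, for the delay weighted by \<open>C0\<close>, and
    for the continuity of \<open>W\<close>.\<close>
  have main: "W (t, y 0) \<le> J + P + e * (2 * t + 4)" if e: "e > 0" for e
  proof -
    have "(t, y 0) \<in> {0<..} \<times> UNIV" using t by simp
    then obtain \<theta>0 where \<theta>0: "\<theta>0 > 0" "\<And>z. z \<in> {0<..} \<times> UNIV \<Longrightarrow> dist z (t, y 0) < \<theta>0 \<Longrightarrow> dist (W z) (W (t, y 0)) < e"
      using W_cont e unfolding continuous_on_iff by metis
    \<comment> \<open>The starting point will move by the terminal time \<open>h'\<close>, the delay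
      \<open>E\<close> and the shift \<open>w\<close>, each of which gets a third of
      \<theta>\<open>0\<close>.\<close>
    define \<theta> where "\<theta> = min 1 (\<theta>0 / 3)"
    have \<theta>: "\<theta> > 0" "\<theta> \<le> 1" "3 * \<theta> \<le> \<theta>0" using \<theta>0 by (auto simp: \<theta>_def)
    \<comment> \<open>The first summand makes the delay \<open>V / R\<close> at most \<theta>, the
      second makes its cost \<open>C0 * V / R\<close> at most \<open>e\<close>, and the third keeps
      \<open>R\<close> positive.\<close>
    define R where "R = V / \<theta> + C0 * V / e + 1"
    have R1: "V / \<theta> \<le> R" "C0 * V / e \<le> R" "R > 0"
      using V(1) C0(1) \<theta> e by (auto simp: R_def add_nonneg_pos)
    have VR: "V / R \<le> \<theta>" "C0 * (V / R) \<le> e" using R1 \<theta> e by (auto simp: field_simps)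
    obtain r where r: "r > 0" "\<And>x x' u. x \<in> y ` {0..t} \<Longrightarrow> norm (x' - x) \<le> r \<Longrightarrow> norm u \<le> R \<Longrightarrow> \<bar>L x' u - L x u\<bar> \<le> e"
      using uniformly_continuous_on_compact[OF K e] by blast
    have "uniformly_continuous_on {0..t} y" by (intro compact_uniformly_continuous yc) auto
    moreover have "r / 3 > 0" using r(1) by simp
    ultimately obtain d where d: "d > 0" "\<And>s s'. s \<in> {0..t} \<Longrightarrow> s' \<in> {0..t} \<Longrightarrow> dist s' s < d \<Longrightarrow> dist (y s') (y s) < r / 3"
      unfolding uniformly_continuous_on_def by metis
    have C0': "L (y s) 0 \<le> C0" if "s \<in> {0..t}" for s using C0(2)[of "y s" 0] that by auto
    obtain n0 where n0: "\<And>n h x \<Delta> \<tau>. n \<ge> n0 \<Longrightarrow> h = t / 2^n \<Longrightarrow> x = (\<lambda>i. y (real i * h)) \<Longrightarrow>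
      \<Delta> = (\<lambda>i. x (Suc i) - x i) \<Longrightarrow> \<tau> = (\<lambda>i. max h (norm (\<Delta> i) / R)) \<Longrightarrow>
      (\<Sum>i<2^n. \<tau> i * L (x i) (\<Delta> i /\<^sub>R \<tau> i) - (\<tau> i - h) * C0) \<le> J + e * t"
      using cost_ge_dyadic_sum[OF ac t e R1(3) C0' J(2)[unfolded Jn_def] J(1)] by blast
    obtain n1 where n1: "\<And>n. n \<ge> n1 \<Longrightarrow> t / 2^n < d" using dyadic_mesh_less[OF d(1)] by blast
    define n where "n = max n0 n1"
    have n: "n \<ge> n0" "n \<ge> n1" by (auto simp: n_def)
    define h where "h = t / 2^n"
    have h0: "h > 0" using t by (simp add: h_def)
    have hT: "2^n * h = t" by (simp add: h_def)
    have hd: "h < d" using n1[OF n(2)] by (simp add: h_def)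
    have grid: "real i * h \<in> {0..t}" if "i \<le> 2^n" for i
      unfolding h_def by (rule dyadic_grid_mem[OF t that])
    define x where "x = (\<lambda>i. y (real i * h))"
    define \<Delta> where "\<Delta> = (\<lambda>i. x (Suc i) - x i)"
    define \<tau> where "\<tau> = (\<lambda>i. max h (norm (\<Delta> i) / R))"
    define b where "b = (\<lambda>i. \<Delta> i /\<^sub>R \<tau> i)"
    have \<tau>h: "\<tau> i \<ge> h" for i by (simp add: \<tau>_def)
    have \<tau>0: "\<tau> i > 0" for i using \<tau>h[of i] h0 by linarith
    have bR: "norm (b i) \<le> R" for i unfolding b_def \<tau>_def by (rule norm_capped_speed[OF R1(3) h0])
    have cost: "(\<Sum>i<2^n. \<tau> i * L (x i) (b i) - (\<tau> i - h) * C0) \<le> J + e * t"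
      unfolding b_def by (rule n0[OF n(1) h_def x_def \<Delta>_def \<tau>_def])
    \<comment> \<open>The delay of the polygon: the total travel time under the speed cap minus
      \<open>t\<close>.\<close>
    define E where "E = (\<Sum>i<2^n. \<tau> i) - t"
    have E: "E = (\<Sum>i<2^n. \<tau> i - h)" by (simp add: E_def sum_subtractf h_def)
    have E0: "E \<ge> 0" unfolding E using \<tau>h by (intro sum_nonneg) auto
    have "E \<le> (\<Sum>i<2^n. norm (\<Delta> i) / R)"
      unfolding E
    proof (rule sum_mono)
      fix i
      have "0 \<le> norm (\<Delta> i) / R" using R1(3) by simp
      then show "\<tau> i - h \<le> norm (\<Delta> i) / R" using h0 by (auto simp: \<tau>_def max_def)
    qed
    also have "\<dots> = (\<Sum>i<2^n. norm (\<Delta> i)) / R" by (simp add: sum_divide_distrib)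
    also have "(\<Sum>i<2^n. norm (\<Delta> i)) = (\<Sum>i<2^n. (t / 2^n) * norm (dyadic_slope y t n i))"
    proof (rule sum.cong[OF refl])
      fix i show "norm (\<Delta> i) = (t / 2^n) * norm (dyadic_slope y t n i)"
        using t dyadic_slope_scale[OF t, of n y i] by (simp add: \<Delta>_def x_def h_def dyadic_slope_def)
    qed
    also have "\<dots> / R \<le> V / R" using V(2)[of n] R1(3) by (intro divide_right_mono) auto
    finally have EV: "E \<le> V / R" .
    have "\<phi> (y t) < ennreal (P + e)" using P e by (simp add: ennreal_less_iff)
    moreover have "min \<theta> (r / 3) > 0" using \<theta> r by simp
    ultimately obtain h' v where hv: "0 < h'" "h' < min \<theta> (r / 3)" "norm (v - y t) < min \<theta> (r / 3)" "W (h', v) < P + e"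
      using init_approx by blast
    \<comment> \<open>The whole polygon is translated, so its edges, and hence its velocities, are
      unchanged while it now ends at \<open>v\<close>.\<close>
    define w where "w = v - y t"
    have "W (h' + (\<Sum>i<2^n. \<tau> i), x 0 + w) \<le> W (h', x (2^n) + w) + (\<Sum>i<2^n. (L (x i) (b i) + e) * \<tau> i)"
    proof (rule polygon_bound[where p = "\<lambda>i. x i + w" and r = "r / 3", OF hv(1) \<open>r / 3 > 0\<close> \<tau>0])
      fix i \<rho> x' assume i: "i < (2::nat)^n" and \<rho>: "0 \<le> \<rho>" "\<rho> \<le> 1"
        and x': "norm (x' - (x i + w + \<rho> *\<^sub>R (x (Suc i) + w - (x i + w)))) \<le> r / 3"
      have "dist (real (Suc i) * h) (real i * h) < d" using hd h0 by (simp add: dist_real_def algebra_simps)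
      then have "norm (\<Delta> i) < r / 3"
        using d(2)[OF grid[of i] grid[of "Suc i"]] i by (simp add: \<Delta>_def x_def dist_norm)
      moreover have "norm (\<rho> *\<^sub>R \<Delta> i) \<le> norm (\<Delta> i)" using \<rho> by (simp add: mult_left_le_one_le)
      ultimately have n1: "norm (\<rho> *\<^sub>R \<Delta> i) \<le> r / 3" by linarith
      have n2: "norm (x' - (x i + w + \<rho> *\<^sub>R \<Delta> i)) \<le> r / 3" using x' by (simp add: \<Delta>_def)
      have n3: "norm w \<le> r / 3" using hv(3) by (simp add: w_def)
      \<comment> \<open>The radius \<open>r\<close> is shared by three displacements: the
        neighbourhood demanded by the segment estimate, the translation, and the way along the
        edge.\<close>
      have "x' - x i = ((x' - (x i + w + \<rho> *\<^sub>R \<Delta> i)) + w) + \<rho> *\<^sub>R \<Delta> i" by simp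
      also have "norm \<dots> \<le> (r / 3 + r / 3) + r / 3"
        by (intro norm_triangle_mono n1 n2 n3)
      finally have "norm (x' - x i) \<le> r" by simp
      moreover have "x i \<in> y ` {0..t}" using grid[of i] i by (simp add: x_def)
      ultimately have "L x' (b i) \<le> L (x i) (b i) + e" using r(2)[OF _ _ bR, of "x i" x' i] by linarith
      then show "L x' ((x (Suc i) + w - (x i + w)) /\<^sub>R \<tau> i) \<le> L (x i) (b i) + e" by (simp add: b_def \<Delta>_def)
    qed
    also have "x (2^n) + w = v" using hT by (simp add: x_def w_def)
    also have "(\<Sum>i<2^n. (L (x i) (b i) + e) * \<tau> i) = (\<Sum>i<2^n. \<tau> i * L (x i) (b i) - (\<tau> i - h) * C0) + C0 * E + e * (t + E)"
      by (simp add: E_def E algebra_simps sum.distrib sum_subtractf sum_distrib_left)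
        (simp add: h_def)
    also have "W (h', v) + \<dots> \<le> (P + e) + ((J + e * t) + e + e * (t + 1))"
    proof -
      have "C0 * E \<le> e" using mult_left_mono[OF EV C0(1)] VR(2) by linarith
      moreover have "e * (t + E) \<le> e * (t + 1)" using EV VR(1) \<theta>(2) e by (intro mult_left_mono) auto
      ultimately show ?thesis using cost hv(4) by linarith
    qed
    finally have 1: "W (h' + (t + E), y 0 + w) \<le> P + e + (J + e * t + e + e * (t + 1))"
      by (simp add: E_def x_def)
    have "dist (W (h' + (t + E), y 0 + w)) (W (t, y 0)) < e"
    proof (rule \<theta>0(2))
      have "dist (h' + (t + E), y 0 + w) (t, y 0) = norm (h' + E, w)" by (simp add: dist_norm)
      also have "\<dots> \<le> norm (h' + E) + norm w" by (rule norm_Pair_le)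
      also have "\<dots> < \<theta>0" using hv E0 EV VR(1) \<theta> by (simp add: w_def)
      finally show "dist (h' + (t + E), y 0 + w) (t, y 0) < \<theta>0" .
    qed (use hv(1) t E0 in simp)
    then have "W (t, y 0) \<le> W (h' + (t + E), y 0 + w) + e" unfolding dist_real_def by linarith
    with 1 show ?thesis by (simp add: algebra_simps)
  qed
  have "W (t, y 0) \<le> J + P"
  proof (rule field_le_epsilon)
    fix e :: real assume "e > 0"
    then show "W (t, y 0) \<le> J + P + e" using main[of "e / (2 * t + 4)"] t by simp
  qed
  then have "ennreal (W (t, y 0)) \<le> ennreal J + ennreal P" using J P by (simp flip: ennreal_plus add: ennreal_leI)
  then show ?thesis unfolding bolza_cost_def Jn_def[symmetric] J(2) P(2) .
qed simp

end

section \<open>Supersolutions and discrete descent\<close>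

lemma norm_fst_snd_le: "norm (fst z) \<le> norm z" "norm (snd z) \<le> norm z"
  using norm_fst_le[of "fst z" "snd z"] norm_snd_le[of "snd z" "fst z"] by simp_all

lemma norm_add_scaleR_squared:
  "(norm (a + c *\<^sub>R d))\<^sup>2 = (norm a)\<^sup>2 + 2 * c * (a \<bullet> d) + c\<^sup>2 * (norm d)\<^sup>2"
  for a d :: "'a::real_inner"
  unfolding power2_norm_eq_inner by (simp add: inner_add inner_commute power2_eq_square)

context hamilton_jacobi
begin

text \<open>Since \<open>W\<close> is nonnegative, a competitor farther from \<open>z\<close> than
  \<rho> pays at least \<open>W z\<close> in penalty alone, so the search is confined to a compact
  set. The half-space of times at least \<sigma>\<open>/ 2\<close> keeps it where \<open>W\<close>
  is continuous.\<close>

lemma Moreau_minimizer: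
  assumes \<sigma>: "\<sigma> > 0" and k: "k > 0" and z: "\<sigma> \<le> fst z"
  obtains m where "\<sigma> / 2 \<le> fst m" "\<And>w. \<sigma> / 2 \<le> fst w \<Longrightarrow> W m + k * (norm (z - m))\<^sup>2 \<le> W w + k * (norm (z - w))\<^sup>2"
proof -
  define D where "D = {w :: real \<times> 'a. \<sigma> / 2 \<le> fst w}"
  have Dpos: "D \<subseteq> {0<..} \<times> UNIV" using \<sigma> by (auto simp: D_def mem_Times_iff)
  have zD: "z \<in> D" using z \<sigma> by (simp add: D_def)
  have Wz: "0 \<le> W w" if "w \<in> D" for w using W_nonneg[of "fst w" "snd w"] that Dpos by (auto simp: mem_Times_iff)
  define \<rho> where "\<rho> = sqrt (W z / k)"
  have \<rho>: "k * \<rho>\<^sup>2 = W z" "\<rho> \<ge> 0" using k Wz[OF zD] by (auto simp: \<rho>_def)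
  have "closed D" unfolding D_def by (intro closed_Collect_le continuous_intros)
  then have comp: "compact (D \<inter> cball z \<rho>)" by (simp add: closed_Int_compact)
  have "continuous_on (D \<inter> cball z \<rho>) (\<lambda>w. W w + k * (norm (z - w))\<^sup>2)"
    using Dpos by (intro continuous_intros continuous_on_subset[OF W_cont]) auto
  moreover have "D \<inter> cball z \<rho> \<noteq> {}" using zD \<rho> by auto
  ultimately obtain m where m: "m \<in> D \<inter> cball z \<rho>"
    "\<And>w. w \<in> D \<inter> cball z \<rho> \<Longrightarrow> W m + k * (norm (z - m))\<^sup>2 \<le> W w + k * (norm (z - w))\<^sup>2"
    using continuous_attains_inf[OF comp] by blast
  show ?thesis
  proof (rule that)
    show "\<sigma> / 2 \<le> fst m" using m(1) by (simp add: D_def)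
    fix w :: "real \<times> 'a" assume "\<sigma> / 2 \<le> fst w"
    then have w: "w \<in> D" by (simp add: D_def)
    show "W m + k * (norm (z - m))\<^sup>2 \<le> W w + k * (norm (z - w))\<^sup>2"
    proof (cases "w \<in> cball z \<rho>")
      case True then show ?thesis using m(2) w by simp
    next
      case False
      then have "\<rho> \<le> norm (z - w)" by (simp add: dist_norm)
      then have "\<rho>\<^sup>2 \<le> (norm (z - w))\<^sup>2" using \<rho> by (intro power_mono) auto
      then have "W z \<le> k * (norm (z - w))\<^sup>2" using k \<rho>(1) by (metis mult_le_cancel_left_pos)
      moreover have "W m + k * (norm (z - m))\<^sup>2 \<le> W z + k * (norm (z - z))\<^sup>2" by (rule m(2)) (use zD \<rho> in auto)
      ultimately show ?thesis using Wz[OF w] by simp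
    qed
  qed
qed

text \<open>\<open>p\<close> lists the vertices of a polygon run backwards in time from \<open>t\<close> to \<open>\<sigma>\<close> with time step \<open>\<delta>\<close>; \<open>p'\<close> and
  \<open>(\<tau>, \<xi>)\<close> are nearby points at which the cost and the final value are evaluated.\<close>

definition descent :: "real \<Rightarrow> 'a \<Rightarrow> real \<Rightarrow> real \<Rightarrow> nat \<Rightarrow> real \<Rightarrow>
    (nat \<Rightarrow> 'a) \<Rightarrow> (nat \<Rightarrow> 'a) \<Rightarrow> (nat \<Rightarrow> 'a) \<Rightarrow> real \<Rightarrow> 'a \<Rightarrow> bool" where
  "descent t x \<sigma> e N \<delta> p p' u \<tau> \<xi> \<longleftrightarrow> p 0 = x \<and>
     (\<forall>i<N. p (Suc i) = p i + \<delta> *\<^sub>R u i \<and> norm (p' i - p i) \<le> e) \<and>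
     0 < \<tau> \<and> \<bar>\<tau> - \<sigma>\<bar> \<le> e \<and> norm (\<xi> - p N) \<le> e \<and>
     W (\<tau>, \<xi>) + (\<Sum>i<N. \<delta> * L (p' i) (u i)) \<le> W (t, x) + e"

text \<open>Euler steps for the Moreau envelope of \<open>W\<close>: the velocity is nearly optimal in the Hamiltonian
  at the proximal point, where the proximal subgradient of \<open>W\<close> is available. The envelope decreases
  along them up to an error of second order in the step size, because for a fixed penalization
  parameter the subgradients, hence the velocities, are bounded.\<close>

lemma discrete_descent:
  assumes \<sigma>: "0 < \<sigma>" "\<sigma> < t" and e: "e > 0"
  obtains \<delta>0 where "\<delta>0 > 0" "\<And>N \<delta>. 0 < \<delta> \<Longrightarrow> \<delta> \<le> \<delta>0 \<Longrightarrow> real N * \<delta> = t - \<sigma> \<Longrightarrow>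
     \<exists>p p' u \<tau> \<xi>. descent t x \<sigma> e N \<delta> p p' u \<tau> \<xi>"
proof -
  \<comment> \<open>A level that the envelope never exceeds along the descent; all constants are
    uniform on this sublevel set.\<close>
  define M where "M = W (t, x) + e"
  have M0: "M > 0" using W_nonneg[of t x] \<sigma> e by (simp add: M_def)
  define r where "r = min e (\<sigma> / 2)"
  have r: "r > 0" "r \<le> e" "r \<le> \<sigma> / 2" using e \<sigma> by (auto simp: r_def)
  \<comment> \<open>Large enough that below level \<open>M\<close> the proximal point is within
    \<open>r\<close>: within \<open>e\<close> for the final estimate, and within
    \<sigma>\<open>/ 2\<close> so that it avoids the boundary of the half-space.\<close>
  define k where "k = (M + 1) / r\<^sup>2"
  have k: "k > 0" "M < k * r\<^sup>2" using M0 r by (auto simp: k_def)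
  \<comment> \<open>A step of length \<delta> loses at most \<open>2 * e1 *\<close> \<delta>, and
    the steps have total length at most \<open>t\<close>.\<close>
  define e1 where "e1 = e / (2 * t)"
  have e1: "e1 > 0" using e \<sigma> by (simp add: e1_def)
  define P where "P = 2 * k * r"
  have P: "P > 0" using k r by (simp add: P_def)
  \<comment> \<open>\<open>P\<close> will bound the proximal subgradients; with this growth rate a
    velocity longer than \<open>R\<close> cannot be nearly optimal in the Hamiltonian.\<close>
  obtain R0 where R0: "R0 > 0" "\<And>u x. R0 \<le> norm u \<Longrightarrow> (2 * P + e1) * norm u \<le> L x u"
    using superlinearE by blast
  define R where "R = max R0 1"
  have "\<forall>z. \<exists>m. \<sigma> \<le> fst z \<longrightarrow> \<sigma> / 2 \<le> fst m \<and> (\<forall>w. \<sigma> / 2 \<le> fst w \<longrightarrow> W m + k * (norm (z - m))\<^sup>2 \<le> W w + k * (norm (z - w))\<^sup>2)"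
    using Moreau_minimizer[OF \<sigma>(1) k(1)] by metis
  then obtain m where m: "\<And>z. \<sigma> \<le> fst z \<Longrightarrow> \<sigma> / 2 \<le> fst (m z)"
    "\<And>z w. \<sigma> \<le> fst z \<Longrightarrow> \<sigma> / 2 \<le> fst w \<Longrightarrow> W (m z) + k * (norm (z - m z))\<^sup>2 \<le> W w + k * (norm (z - w))\<^sup>2"
    by metis
  define Wk where "Wk = (\<lambda>z. W (m z) + k * (norm (z - m z))\<^sup>2)"
  have Wm: "0 \<le> W (m z)" if "\<sigma> \<le> fst z" for z
    using W_nonneg[of "fst (m z)" "snd (m z)"] m(1)[OF that] \<sigma>(1) by simp
  have near: "norm (z - m z) < r" if "\<sigma> \<le> fst z" "Wk z \<le> M" for z
  proof -
    have "k * (norm (z - m z))\<^sup>2 < k * r\<^sup>2" using Wm[OF that(1)] that(2) k(2) by (simp add: Wk_def)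
    then have "(norm (z - m z))\<^sup>2 < r\<^sup>2" using k(1) by simp
    then show ?thesis using r(1) by (simp add: power2_less_imp_less)
  qed
  have "\<exists>u. norm u \<le> R \<and> (2 * k) *\<^sub>R (z - m z) \<bullet> (-1, u) \<le> e1 - L (snd (m z)) u" if z: "\<sigma> \<le> fst z" "Wk z \<le> M" for z
  proof -
    let ?p = "(2 * k) *\<^sub>R (z - m z)"
    obtain s y where sy: "m z = (s, y)" by (cases "m z")
    obtain a q where aq: "?p = (a, q)" by (cases ?p)
    have np: "norm ?p \<le> P" using near[OF z] k by (simp add: P_def)
    have "\<bar>fst (z - m z)\<bar> \<le> norm (z - m z)" using norm_fst_snd_le(1)[of "z - m z"] by simp
    \<comment> \<open>The strict inequality turns the minimum over the closed half-space into an
      unconstrained local minimum, as the subdifferential requires.\<close>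
    then have s1: "s > \<sigma> / 2" using near[OF z] z(1) r(3) sy by auto
    then have s0: "s > 0" using \<sigma>(1) by linarith
    have "?p \<in> subdifferential W (m z)"
    proof (rule subdifferentialI[of _ _ _ k])
      have "open {w :: real \<times> 'a. \<sigma> / 2 < fst w}" by (intro open_Collect_less continuous_intros)
      then have "\<forall>\<^sub>F w in nhds (m z). w \<in> {w. \<sigma> / 2 < fst w}"
        using s1 sy by (intro eventually_nhds_in_open) auto
      then show "\<forall>\<^sub>F w in nhds (m z). W (m z) + ?p \<bullet> (w - m z) - k * (norm (w - m z))\<^sup>2 \<le> W w"
      proof eventually_elim
        case (elim w)
        have "W (m z) + k * (norm (z - m z))\<^sup>2 \<le> W w + k * (norm (z - w))\<^sup>2" using m(2)[OF z(1), of w] elim by simp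
        moreover have "(norm (z - w))\<^sup>2 = (norm (z - m z))\<^sup>2 - 2 * ((z - m z) \<bullet> (w - m z)) + (norm (w - m z))\<^sup>2"
          unfolding power2_norm_eq_inner by (simp add: inner_diff inner_commute)
        ultimately show ?case by (simp add: algebra_simps)
      qed
    qed
    then have "(a, q) \<in> subdifferential W (s, y)" unfolding aq unfolding sy .
    then have "ereal a + hamiltonian L y (- q) \<ge> 0" by (rule super[OF s0])
    then have "ereal (- a) \<le> hamiltonian L y (- q)" by (cases "hamiltonian L y (- q)") auto
    moreover have "ereal (- a - e1) < ereal (- a)" using e1 by simp
    ultimately have "ereal (- a - e1) < hamiltonian L y (- q)" by (rule less_le_trans[rotated])
    then obtain u where u: "- a - e1 < - q \<bullet> u - L y u" unfolding hamiltonian_def less_SUP_iff by auto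
    have anq: "\<bar>a\<bar> \<le> P" "norm q \<le> P"
      using np norm_fst_le[of a q] norm_snd_le[of q a] by (auto simp: aq)
    have "norm u \<le> R"
    proof (rule ccontr)
      assume "\<not> norm u \<le> R"
      then have nu: "norm u > 1" "R0 \<le> norm u" by (auto simp: R_def)
      have "- q \<bullet> u \<le> norm q * norm u" using norm_cauchy_schwarz[of "- q" u] by simp
      also have "\<dots> \<le> P * norm u" using anq by (intro mult_right_mono) auto
      finally have "L y u < P + P * norm u + e1" using u anq by linarith
      also have "\<dots> \<le> (2 * P + e1) * norm u"
      proof -
        have "(P + e1) * 1 \<le> (P + e1) * norm u" using nu P e1 by (intro mult_left_mono) auto
        then show ?thesis by (simp add: algebra_simps)
      qed
      also have "\<dots> \<le> L y u" using R0(2) nu by simp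
      finally show False by simp
    qed
    moreover have "?p \<bullet> (-1, u) = - a + q \<bullet> u" by (simp only: aq) simp
    ultimately show ?thesis using u by (intro exI[of _ u]) (simp add: sy)
  qed
  then obtain U where U: "\<And>z. \<sigma> \<le> fst z \<Longrightarrow> Wk z \<le> M \<Longrightarrow> norm (U z) \<le> R"
     "\<And>z. \<sigma> \<le> fst z \<Longrightarrow> Wk z \<le> M \<Longrightarrow> (2 * k) *\<^sub>R (z - m z) \<bullet> (-1, U z) \<le> e1 - L (snd (m z)) (U z)"
    by metis
  \<comment> \<open>The quadratic term of the expansion is at most \<open>k *\<close>
    \<delta>\<open>^2 * (1 + R^2)\<close>; below this threshold it is at most \<open>e1 *\<close>
    \<delta>.\<close>
  define \<delta>0 where "\<delta>0 = e1 / (k * (1 + R\<^sup>2))"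
  have R2: "1 + R\<^sup>2 > 0" by (simp add: add_pos_nonneg)
  show ?thesis
  proof (rule that)
    show "\<delta>0 > 0" using e1 k R2 by (simp add: \<delta>0_def)
    fix N :: nat and \<delta> assume \<delta>: "0 < \<delta>" "\<delta> \<le> \<delta>0" and N: "real N * \<delta> = t - \<sigma>"
    have k\<delta>: "k * \<delta> * (1 + R\<^sup>2) \<le> e1"
    proof -
      have "k * (1 + R\<^sup>2) > 0" using k R2 by simp
      then have "\<delta> * (k * (1 + R\<^sup>2)) \<le> e1" using \<delta>(2) unfolding \<delta>0_def by (simp only: pos_le_divide_eq)
      then show ?thesis by (simp only: mult.assoc mult.left_commute)
    qed
    have step: "Wk (z + \<delta> *\<^sub>R (-1, U z)) + \<delta> * L (snd (m z)) (U z) \<le> Wk z + 2 * e1 * \<delta>"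
      if z: "\<sigma> \<le> fst z" "Wk z \<le> M" and z': "\<sigma> \<le> fst (z + \<delta> *\<^sub>R (-1, U z))" for z
    proof -
      let ?d = "(-1 :: real, U z)"
      \<comment> \<open>The old proximal point \<open>m z\<close> serves as competitor in the
        envelope at the new point, so only the quadratic term is expanded and \<open>W\<close>
        itself is never differentiated.\<close>
      have "Wk (z + \<delta> *\<^sub>R ?d) \<le> W (m z) + k * (norm ((z + \<delta> *\<^sub>R ?d) - m z))\<^sup>2"
        unfolding Wk_def by (rule m(2)[OF z' m(1)[OF z(1)]])
      also have "(norm ((z + \<delta> *\<^sub>R ?d) - m z))\<^sup>2 = (norm (z - m z))\<^sup>2 + 2 * \<delta> * ((z - m z) \<bullet> ?d) + \<delta>\<^sup>2 * (norm ?d)\<^sup>2"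
      proof -
        have "(z + \<delta> *\<^sub>R ?d) - m z = (z - m z) + \<delta> *\<^sub>R ?d" by simp
        then show ?thesis by (simp only: norm_add_scaleR_squared)
      qed
      also have "W (m z) + k * ((norm (z - m z))\<^sup>2 + 2 * \<delta> * ((z - m z) \<bullet> ?d) + \<delta>\<^sup>2 * (norm ?d)\<^sup>2)
          = Wk z + \<delta> * ((2 * k) *\<^sub>R (z - m z) \<bullet> ?d) + \<delta> * (k * \<delta> * (norm ?d)\<^sup>2)"
        by (simp add: Wk_def algebra_simps power2_eq_square)
      also have "\<dots> \<le> Wk z + \<delta> * (e1 - L (snd (m z)) (U z)) + \<delta> * e1"
      proof -
        have "(norm ?d)\<^sup>2 = 1 + (norm (U z))\<^sup>2" by (simp add: norm_Pair)
        also have "\<dots> \<le> 1 + R\<^sup>2" using U(1)[OF z] by (simp add: power_mono)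
        finally have "k * \<delta> * (norm ?d)\<^sup>2 \<le> k * \<delta> * (1 + R\<^sup>2)" using k \<delta> by (intro mult_left_mono) auto
        then have "k * \<delta> * (norm ?d)\<^sup>2 \<le> e1" using k\<delta> by linarith
        then show ?thesis using U(2)[OF z] \<delta>(1) by (intro add_mono mult_left_mono) auto
      qed
      finally show ?thesis by (simp add: algebra_simps)
    qed
    define zs where "zs = (\<lambda>i. ((\<lambda>z. z + \<delta> *\<^sub>R (-1, U z)) ^^ i) (t, x))"
    have zs0: "zs 0 = (t, x)" by (simp add: zs_def)
    have zsS: "zs (Suc i) = zs i + \<delta> *\<^sub>R (-1, U (zs i))" for i by (simp add: zs_def)
    have fz: "fst (zs i) = t - real i * \<delta>" for i by (induction i) (auto simp: zs0 zsS algebra_simps)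
    have fz\<sigma>: "\<sigma> \<le> fst (zs i)" if "i \<le> N" for i
    proof -
      have "real i * \<delta> \<le> real N * \<delta>" using that \<delta>(1) by (intro mult_right_mono) auto
      then show ?thesis using N by (simp add: fz)
    qed
    define S where "S = (\<lambda>i. \<Sum>j<i. \<delta> * L (snd (m (zs j))) (U (zs j)))"
    have S0: "S i \<ge> 0" for i unfolding S_def using \<delta>(1) nonneg by (intro sum_nonneg mult_nonneg_nonneg) auto
    have "real N * \<delta> \<le> t" using N \<sigma> by simp
    have small: "2 * e1 * (real i * \<delta>) \<le> e" if "i \<le> N" for i
    proof -
      have "real i * \<delta> \<le> t" using fz\<sigma>[OF that] fz[of i] \<sigma>(1) by linarith
      then have "2 * e1 * (real i * \<delta>) \<le> 2 * e1 * t" using e1 by (intro mult_left_mono) auto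
      also have "\<dots> = e" using \<sigma> by (simp add: e1_def)
      finally show ?thesis .
    qed
    \<comment> \<open>The invariant itself yields \<open>Wk (zs i) \<le> M\<close>, which licenses
      the next step.\<close>
    have inv: "Wk (zs i) + S i \<le> W (t, x) + 2 * e1 * (real i * \<delta>)" if "i \<le> N" for i
      using that
    proof (induction i)
      case 0
      have "Wk (t, x) \<le> W (t, x) + k * (norm ((t, x) - (t, x)))\<^sup>2"
        unfolding Wk_def using \<sigma> by (intro m(2)) auto
      then show ?case by (simp add: zs0 S_def)
    next
      case (Suc i)
      have "Wk (zs i) \<le> M" using Suc small[of i] S0[of i] by (simp add: M_def)
      from step[OF fz\<sigma> this] fz\<sigma>[OF Suc.prems]
      have "Wk (zs (Suc i)) + \<delta> * L (snd (m (zs i))) (U (zs i)) \<le> Wk (zs i) + 2 * e1 * \<delta>"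
        using Suc.prems by (simp add: zsS)
      moreover have "Wk (zs i) + S i \<le> W (t, x) + 2 * e1 * (real i * \<delta>)" using Suc by simp
      ultimately show ?case by (simp add: S_def algebra_simps)
    qed
    have WM: "Wk (zs i) \<le> M" if "i \<le> N" for i using inv[OF that] small[OF that] S0[of i] by (simp add: M_def)
    have close: "norm (snd (m (zs i)) - snd (zs i)) \<le> e" "\<bar>fst (m (zs i)) - fst (zs i)\<bar> \<le> e" if "i \<le> N" for i
    proof -
      have "norm (m (zs i) - zs i) < r" using near[OF fz\<sigma>[OF that] WM[OF that]] by (simp add: norm_minus_commute)
      then show "norm (snd (m (zs i)) - snd (zs i)) \<le> e" "\<bar>fst (m (zs i)) - fst (zs i)\<bar> \<le> e"
        using r(2) norm_fst_snd_le[of "m (zs i) - zs i"]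
        by auto
    qed
    show "\<exists>p p' u \<tau> \<xi>. descent t x \<sigma> e N \<delta> p p' u \<tau> \<xi>"
      unfolding descent_def
    proof (intro exI conjI allI impI)
      show "snd (zs 0) = x" by (simp add: zs0)
      show "snd (zs (Suc i)) = snd (zs i) + \<delta> *\<^sub>R U (zs i)" for i by (simp add: zsS)
      show "norm (snd (m (zs i)) - snd (zs i)) \<le> e" if "i < N" for i using close that by simp
      show "0 < fst (m (zs N))" using m(1)[OF fz\<sigma>[of N]] \<sigma>(1) by simp
      have "fst (zs N) = \<sigma>" using N by (simp add: fz)
      then show "\<bar>fst (m (zs N)) - \<sigma>\<bar> \<le> e" using close(2)[of N] by simp
      show "norm (snd (m (zs N)) - snd (zs N)) \<le> e" using close(1)[of N] by simp
      have "W (m (zs N)) \<le> Wk (zs N)" using k by (simp add: Wk_def)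
      then show "W (fst (m (zs N)), snd (m (zs N))) + (\<Sum>i<N. \<delta> * L (snd (m (zs i))) (U (zs i))) \<le> W (t, x) + e"
        using inv[of N] small[of N] by (simp add: S_def)
    qed
  qed
qed

end

section \<open>Lower semicontinuity of the cost\<close>

context tonelli
begin

text \<open>The last cell is left out because the discrete arcs stop before the final time.\<close>

definition truncated_sum :: "(real \<Rightarrow> 'a) \<Rightarrow> real \<Rightarrow> real \<Rightarrow> real \<Rightarrow> nat \<Rightarrow> real" where
  "truncated_sum g T R e m = (\<Sum>j<2^m - 1. if norm (dyadic_slope g T m j) \<le> R
     then (T / 2^m) * (L (g (real j * (T / 2^m))) (dyadic_slope g T m j) - e) else 0)"

text \<open>The coarse level \<open>m\<close> is fixed while \<open>n\<close> tends to infinity. On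
  each coarse cell all values of \<open>L\<close> along the fine polygon dominate one affine
  function of the velocity, taken at the coarse slope of \<open>g\<close>. Its sum depends only on
  the increment of the polygon over the cell, which converges to that of \<open>g\<close>, so
  convergence of the velocities never enters. Cells of slope above \<open>R\<close> are dropped
  using \<open>L \<ge> 0\<close>.\<close>

lemma dyadic_lower_bound:
  assumes T: "T > 0" and gc: "continuous_on {0..T} g"
    and Kn: "\<And>n. n \<le> K n" and Nn: "\<And>n. 2 ^ K n - 2 ^ (K n - n) \<le> N n"
    and rec: "\<And>n i. i < N n \<Longrightarrow> p n (Suc i) = p n i + (T / 2 ^ K n) *\<^sub>R u n i"
    and near: "\<And>e. e > 0 \<Longrightarrow> \<exists>n0. \<forall>n\<ge>n0. \<forall>i\<le>N n. norm (p n i - g (real i * (T / 2 ^ K n))) \<le> e"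
    and near': "\<And>e. e > 0 \<Longrightarrow> \<exists>n0. \<forall>n\<ge>n0. \<forall>i<N n. norm (p' n i - p n i) \<le> e"
    and S: "(\<lambda>n. \<Sum>i<N n. (T / 2 ^ K n) * L (p' n i) (u n i)) \<longlonglongrightarrow> S"
    and e: "e > 0"
  obtains m0 where "\<And>m. m \<ge> m0 \<Longrightarrow> truncated_sum g T R e m \<le> S"
proof -
  have C: "compact (g ` {0..T})" by (intro compact_continuous_image gc) auto
  obtain r where r: "r > 0" "\<And>y b. y \<in> g ` {0..T} \<Longrightarrow> norm b \<le> R \<Longrightarrow>
    \<exists>q. (\<forall>v. L y b + q \<bullet> (v - b) \<le> L y v) \<and> (\<forall>x v. norm (x - y) \<le> r \<longrightarrow> L y b + q \<bullet> (v - b) - e \<le> L x v)"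
    using uniform_affine_minorant[OF C e] by blast
  have r3: "r / 3 > 0" using r(1) by simp
  have "uniformly_continuous_on {0..T} g" by (intro compact_uniformly_continuous gc) auto
  then obtain d where d: "d > 0" "\<And>s s'. s \<in> {0..T} \<Longrightarrow> s' \<in> {0..T} \<Longrightarrow> dist s' s < d \<Longrightarrow> dist (g s') (g s) < r / 3"
    using r3 unfolding uniformly_continuous_on_def by metis
  obtain m0 where m0: "\<And>m. m \<ge> m0 \<Longrightarrow> T / 2^m < d" using dyadic_mesh_less[OF d(1)] by blast
  show ?thesis
  proof (rule that)
    fix m assume m: "m \<ge> m0"
    define h where "h = T / 2^m"
    have h0: "h > 0" using T by (simp add: h_def)
    have hT: "2^m * h = T" by (simp add: h_def)
    have hd: "h < d" using m0[OF m] by (simp add: h_def)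
    define a where "a = dyadic_slope g T m"
    define x where "x = (\<lambda>j. g (real j * h))"
    have xC: "x j \<in> g ` {0..T}" if "j \<le> 2^m" for j
      unfolding x_def h_def by (rule imageI[OF dyadic_grid_mem[OF T that]])
    have "\<forall>j. \<exists>q. j \<le> 2^m \<and> norm (a j) \<le> R \<longrightarrow> (\<forall>y v. norm (y - x j) \<le> r \<longrightarrow> L (x j) (a j) + q \<bullet> (v - a j) - e \<le> L y v)"
      using r(2)[OF xC] by blast
    then obtain q where q: "\<And>j y v. j \<le> 2^m \<Longrightarrow> norm (a j) \<le> R \<Longrightarrow> norm (y - x j) \<le> r \<Longrightarrow>
        L (x j) (a j) + q j \<bullet> (v - a j) - e \<le> L y v" by metis
    define B where "B = (\<lambda>n. (2::nat) ^ (K n - m))"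
    define E where "E = (\<lambda>n j. (p n (Suc j * B n) - p n (j * B n)) - (x (Suc j) - x j))"
    define f where "f = (\<lambda>n j. if norm (a j) \<le> R then h * (L (x j) (a j) - e) + q j \<bullet> E n j else 0)"
    \<comment> \<open>The polygon omits at most \<open>2 ^ (K n - n)\<close> fine steps, no more
      than one coarse cell once \<open>n \<ge> m\<close>; hence all coarse cells but the last are
      covered.\<close>
    have idx: "i \<le> N n" if n: "n \<ge> m" and i: "i \<le> (2^m - 1) * B n" for n i
    proof -
      have "(2::nat)^m * B n = 2 ^ K n" using Kn[of n] n by (simp add: B_def flip: power_add)
      then have "(2^m - 1) * B n = 2 ^ K n - B n" by (simp add: diff_mult_distrib)
      moreover have "(2::nat) ^ (K n - n) \<le> B n" unfolding B_def using n by (intro power_increasing) auto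
      ultimately show ?thesis using i Nn[of n] by linarith
    qed
    have Bh: "real (B n) * (T / 2 ^ K n) = h" if n: "n \<ge> m" for n
    proof -
      have "(2::real) ^ K n = 2^m * 2 ^ (K n - m)" using Kn[of n] n by (simp flip: power_add)
      then show ?thesis by (simp add: h_def B_def)
    qed
    have JB: "Suc j * B n \<le> (2^m - 1) * B n" if "j < 2^m - 1" for j n
      using that by (intro mult_right_mono) auto
    have Elim: "(\<lambda>n. E n j) \<longlonglongrightarrow> 0" if j: "j < 2^m - 1" for j
    proof (rule LIMSEQ_I)
      fix \<epsilon> :: real assume \<epsilon>: "\<epsilon> > 0"
      then obtain n0 where n0: "\<And>n i. n \<ge> n0 \<Longrightarrow> i \<le> N n \<Longrightarrow> norm (p n i - g (real i * (T / 2 ^ K n))) \<le> \<epsilon> / 3"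
        using near[of "\<epsilon> / 3"] by auto
      have "norm (E n j - 0) < \<epsilon>" if n: "n \<ge> max n0 m" for n
      proof -
        have pos: "real (l * B n) * (T / 2 ^ K n) = real l * h" for l
        proof -
          have "m \<le> n" using n by simp
          then show ?thesis using Bh by (simp only: of_nat_mult mult.assoc)
        qed
        have l1: "norm (p n (Suc j * B n) - x (Suc j)) \<le> \<epsilon> / 3"
          using n0[of n "Suc j * B n"] idx[OF _ JB[OF j]] n unfolding pos x_def by simp
        have "j * B n \<le> Suc j * B n" by simp
        then have l2: "norm (p n (j * B n) - x j) \<le> \<epsilon> / 3"
          using n0[of n "j * B n"] idx[OF _ order_trans[OF _ JB[OF j]]] n unfolding pos x_def by simp
        have "E n j = (p n (Suc j * B n) - x (Suc j)) - (p n (j * B n) - x j)" by (simp add: E_def)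
        then have "norm (E n j) \<le> \<epsilon> / 3 + \<epsilon> / 3" using norm_triangle_ineq4 l1 l2 by (metis add_mono order_trans)
        then show ?thesis using \<epsilon> by simp
      qed
      then show "\<exists>n0. \<forall>n\<ge>n0. norm (E n j - 0) < \<epsilon>" by blast
    qed
    have flim: "(\<lambda>n. \<Sum>j<2^m - 1. f n j) \<longlonglongrightarrow> (\<Sum>j<2^m - 1. if norm (a j) \<le> R then h * (L (x j) (a j) - e) else 0)"
    proof (rule tendsto_sum)
      fix j :: nat assume "j \<in> {..<2^m - 1}"
      then have "(\<lambda>n. h * (L (x j) (a j) - e) + q j \<bullet> E n j) \<longlonglongrightarrow> h * (L (x j) (a j) - e) + q j \<bullet> 0"
        by (intro tendsto_intros Elim) auto
      then show "(\<lambda>n. f n j) \<longlonglongrightarrow> (if norm (a j) \<le> R then h * (L (x j) (a j) - e) else 0)"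
        by (simp add: f_def)
    qed
    obtain n1 where n1: "\<And>n i. n \<ge> n1 \<Longrightarrow> i \<le> N n \<Longrightarrow> norm (p n i - g (real i * (T / 2 ^ K n))) \<le> r / 3"
      using near[OF r3] by auto
    obtain n2 where n2: "\<And>n i. n \<ge> n2 \<Longrightarrow> i < N n \<Longrightarrow> norm (p' n i - p n i) \<le> r / 3"
      using near'[OF r3] by auto
    have low: "(\<Sum>j<2^m - 1. f n j) \<le> (\<Sum>i<N n. (T / 2 ^ K n) * L (p' n i) (u n i))" if n: "n \<ge> max m (max n1 n2)" for n
    proof -
      define \<delta> where "\<delta> = T / 2 ^ K n"
      have \<delta>: "\<delta> > 0" using T by (simp add: \<delta>_def)
      have Bd: "real (B n) * \<delta> = h" using Bh[of n] n by (simp add: \<delta>_def)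
      have B0: "B n > 0" by (simp add: B_def)
      have blk: "f n j \<le> (\<Sum>i\<in>{j * B n..<j * B n + B n}. \<delta> * L (p' n i) (u n i))" if j: "j < 2^m - 1" for j
      proof (cases "norm (a j) \<le> R")
        case False
        then show ?thesis using \<delta> nonneg by (auto simp: f_def intro!: sum_nonneg mult_nonneg_nonneg)
      next
        case True
        have iN: "i < N n" if "i \<in> {j * B n..<j * B n + B n}" for i
        proof -
          have "Suc i \<le> Suc j * B n" using that by simp
          then show ?thesis using idx[OF _ order_trans[OF _ JB[OF j]], of n "Suc i"] n by simp
        qed
        have "(\<Sum>i\<in>{j * B n..<j * B n + B n}. \<delta> * (L (x j) (a j) + q j \<bullet> (u n i - a j) - e)) \<le>
            (\<Sum>i\<in>{j * B n..<j * B n + B n}. \<delta> * L (p' n i) (u n i))"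
        proof (intro sum_mono mult_left_mono)
          fix i assume i: "i \<in> {j * B n..<j * B n + B n}"
          have ij: "real (j * B n) \<le> real i" "real i \<le> real (j * B n + B n)" using i by (auto simp del: of_nat_add of_nat_mult)
          then have "real (j * B n) * \<delta> \<le> real i * \<delta>" "real i * \<delta> \<le> real (j * B n + B n) * \<delta>"
            using \<delta> by (auto intro!: mult_right_mono simp del: of_nat_add of_nat_mult)
          then have ih: "real j * h \<le> real i * \<delta>" "real i * \<delta> \<le> real j * h + h"
            by (simp_all only: of_nat_add of_nat_mult distrib_right mult.assoc Bd)
          have jm: "real j + 1 \<le> 2^m"
          proof -
            have "Suc j \<le> 2^m" using j by simp
            then have "real (Suc j) \<le> real (2^m)" by (simp only: of_nat_le_iff)
            then show ?thesis by simp
          qed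
          have "(real j + 1) * h \<le> 2^m * h" using jm h0 by (intro mult_right_mono) auto
          then have jT: "real j * h + h \<le> T" using hT by (simp add: algebra_simps)
          have near1: "norm (p' n i - p n i) \<le> r / 3" using n2[of n i] iN[OF i] n by simp
          have near2: "norm (p n i - g (real i * \<delta>)) \<le> r / 3" using n1[of n i] iN[OF i] n by (simp add: \<delta>_def)
          have "dist (real i * \<delta>) (real j * h) \<le> h" using ih by (simp add: dist_real_def)
          then have "dist (g (real i * \<delta>)) (g (real j * h)) < r / 3"
            using hd ih jT h0 \<delta> by (intro d(2)) auto
          then have near3: "norm (g (real i * \<delta>) - x j) \<le> r / 3" by (simp add: x_def dist_norm)
          have "p' n i - x j = ((p' n i - p n i) + (p n i - g (real i * \<delta>))) + (g (real i * \<delta>) - x j)" by simp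
          also have "norm \<dots> \<le> (r / 3 + r / 3) + r / 3" by (intro norm_triangle_mono near1 near2 near3)
          finally have "norm (p' n i - x j) \<le> r" by simp
          then show "L (x j) (a j) + q j \<bullet> (u n i - a j) - e \<le> L (p' n i) (u n i)"
            using q[of j] True j by auto
        qed (use \<delta> in simp)
        moreover have "(\<Sum>i\<in>{j * B n..<j * B n + B n}. \<delta> * (L (x j) (a j) + q j \<bullet> (u n i - a j) - e)) = f n j"
        proof -
          have "(\<Sum>i\<in>{j * B n..<j * B n + B n}. \<delta> *\<^sub>R u n i) = (\<Sum>i\<in>{j * B n..<j * B n + B n}. p n (Suc i) - p n i)"
            using iN rec by (intro sum.cong refl) (simp add: \<delta>_def)
          also have "\<dots> = p n (j * B n + B n) - p n (j * B n)" by (subst sum_Suc_diff') auto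
          finally have su: "(\<Sum>i\<in>{j * B n..<j * B n + B n}. \<delta> *\<^sub>R u n i) = p n (Suc j * B n) - p n (j * B n)" by (simp add: add.commute)
          have ha: "h *\<^sub>R a j = x (Suc j) - x j" using dyadic_slope_scale[OF T, of m g j] by (simp add: a_def h_def x_def)
          have "(\<Sum>i\<in>{j * B n..<j * B n + B n}. \<delta> * (L (x j) (a j) + q j \<bullet> (u n i - a j) - e)) =
              (\<Sum>i\<in>{j * B n..<j * B n + B n}. \<delta> * (L (x j) (a j) - e - q j \<bullet> a j) + q j \<bullet> (\<delta> *\<^sub>R u n i))"
            by (intro sum.cong refl) (simp add: algebra_simps inner_diff_right)
          also have "\<dots> = (real (B n) * \<delta>) * (L (x j) (a j) - e - q j \<bullet> a j) + q j \<bullet> (\<Sum>i\<in>{j * B n..<j * B n + B n}. \<delta> *\<^sub>R u n i)"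
            by (simp add: sum.distrib inner_sum_right)
          also have "\<dots> = h * (L (x j) (a j) - e) + q j \<bullet> ((p n (Suc j * B n) - p n (j * B n)) - h *\<^sub>R a j)"
            unfolding Bd su by (simp add: algebra_simps inner_diff_right)
          also have "\<dots> = f n j" using True unfolding ha by (simp add: f_def E_def)
          finally show ?thesis .
        qed
        ultimately show ?thesis by simp
      qed
      have "(\<Sum>j<2^m - 1. f n j) \<le> (\<Sum>j<2^m - 1. \<Sum>i\<in>{j * B n..<j * B n + B n}. \<delta> * L (p' n i) (u n i))"
        using blk by (intro sum_mono) auto
      also have "\<dots> = (\<Sum>i<(2^m - 1) * B n. \<delta> * L (p' n i) (u n i))" by (rule sum.nat_group)
      also have "\<dots> \<le> (\<Sum>i<N n. \<delta> * L (p' n i) (u n i))"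
        using idx[of n "(2^m - 1) * B n"] n \<delta> nonneg by (intro sum_mono2) (auto intro!: mult_nonneg_nonneg)
      finally show ?thesis by (simp add: \<delta>_def)
    qed
    have "(\<Sum>j<2^m - 1. if norm (a j) \<le> R then h * (L (x j) (a j) - e) else 0) \<le> S"
      by (rule tendsto_le[OF sequentially_bot S flim])
        (use low in \<open>auto simp: eventually_sequentially intro!: exI[of _ "max m (max n1 n2)"]\<close>)
    then show "truncated_sum g T R e m \<le> S"
      unfolding truncated_sum_def a_def x_def h_def .
  qed
qed

end

text \<open>The dyadic cell around \<open>s\<close> straddles \<open>s\<close>, so its slope
  converges to the derivative. Because \<open>s < T\<close>, this cell is eventually not the last
  one, which \<open>truncated_sum\<close> omits.\<close>

lemma dyadic_slope_tendsto_derivative: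
  assumes T: "T > 0" and der: "(g has_vector_derivative v) (at s within {0..T})" and s: "0 \<le> s" "s < T"
    and m: "filterlim m at_top sequentially"
  shows "(\<lambda>k. dyadic_slope g T (m k) (nat \<lfloor>s / (T / 2 ^ m k)\<rfloor>)) \<longlonglongrightarrow> v"
    "(\<lambda>k. real (nat \<lfloor>s / (T / 2 ^ m k)\<rfloor>) * (T / 2 ^ m k)) \<longlonglongrightarrow> s"
    "\<forall>\<^sub>F k in sequentially. nat \<lfloor>s / (T / 2 ^ m k)\<rfloor> < 2 ^ m k - 1"
    "\<And>k. s \<in> {real (nat \<lfloor>s / (T / 2 ^ m k)\<rfloor>) * (T / 2 ^ m k)..<real (Suc (nat \<lfloor>s / (T / 2 ^ m k)\<rfloor>)) * (T / 2 ^ m k)}"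
proof -
  define d where "d = (\<lambda>k. T / 2 ^ m k)"
  define j where "j = (\<lambda>k. nat \<lfloor>s / d k\<rfloor>)"
  have d0: "d k > 0" for k using T by (simp add: d_def)
  have "(\<lambda>n. T / 2 ^ n) \<longlonglongrightarrow> 0" by (rule LIMSEQ_divide_realpow_zero) simp
  then have dlim: "d \<longlonglongrightarrow> 0" unfolding d_def by (rule filterlim_compose[OF _ m])
  have js: "real (j k) * d k \<le> s" "s < real (Suc (j k)) * d k" for k
    using grid_cell[OF s(1) d0[of k]] unfolding j_def by auto
  have js2: "s < real (j k) * d k + d k" for k using js(2)[of k] by (simp add: algebra_simps)
  then show "s \<in> {real (nat \<lfloor>s / (T / 2 ^ m k)\<rfloor>) * (T / 2 ^ m k)..<real (Suc (nat \<lfloor>s / (T / 2 ^ m k)\<rfloor>)) * (T / 2 ^ m k)}" for k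
    using js[of k] unfolding j_def d_def by simp
  have "(\<lambda>k. real (j k) * d k) \<longlonglongrightarrow> s"
  proof (rule tendsto_sandwich[of "\<lambda>k. s - d k" _ sequentially "\<lambda>_. s"])
    show "(\<lambda>k. s - d k) \<longlonglongrightarrow> s" using tendsto_diff[OF tendsto_const dlim, of s] by simp
    show "\<forall>\<^sub>F k in sequentially. s - d k \<le> real (j k) * d k"
      using js2 by (intro always_eventually allI) (simp add: less_imp_le algebra_simps)
    show "\<forall>\<^sub>F k in sequentially. real (j k) * d k \<le> s" using js(1) by simp
  qed simp
  then show "(\<lambda>k. real (nat \<lfloor>s / (T / 2 ^ m k)\<rfloor>) * (T / 2 ^ m k)) \<longlonglongrightarrow> s" by (simp add: j_def d_def)
  have ev: "\<forall>\<^sub>F k in sequentially. s + d k < T"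
    using order_tendstoD(2)[OF dlim, of "T - s"] s by (simp add: algebra_simps)
  then show "\<forall>\<^sub>F k in sequentially. nat \<lfloor>s / (T / 2 ^ m k)\<rfloor> < 2 ^ m k - 1"
  proof eventually_elim
    case (elim k)
    have "real (j k) * d k + d k < T" using js(1)[of k] elim by linarith
    moreover have "real (Suc (j k)) * d k = real (j k) * d k + d k" by (simp add: algebra_simps)
    moreover have "real (2 ^ m k) * d k = T" by (simp add: d_def)
    ultimately have "real (Suc (j k)) * d k < real (2 ^ m k) * d k" by linarith
    then have "real (Suc (j k)) < real (2 ^ m k)" using d0[of k] by (simp only: mult_less_cancel_right_pos)
    then have "Suc (j k) < 2 ^ m k" by (simp only: of_nat_less_iff)
    then show ?case by (simp add: j_def d_def)
  qed
  have "(\<lambda>k. dyadic_slope g T (m k) (j k)) \<longlonglongrightarrow> v"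
  proof (rule tendstoI)
    fix e :: real assume e: "e > 0"
    then have "e / 2 > 0" by simp
    then obtain r where r: "r > 0" "\<And>a b. \<lbrakk>a \<in> {0..T}; b \<in> {0..T}; a \<le> s; s \<le> b; \<bar>a - s\<bar> < r; \<bar>b - s\<bar> < r\<rbrakk> \<Longrightarrow>
        norm (g b - g a - (b - a) *\<^sub>R v) \<le> e / 2 * (b - a)"
      using has_vector_derivative_straddle[OF der] by blast
    have "\<forall>\<^sub>F k in sequentially. d k < r" using order_tendstoD(2)[OF dlim] r by simp
    with ev show "\<forall>\<^sub>F k in sequentially. dist (dyadic_slope g T (m k) (j k)) v < e"
    proof eventually_elim
      case (elim k)
      let ?a = "real (j k) * d k" and ?b = "real (Suc (j k)) * d k"
      have ba: "?b = ?a + d k" by (simp add: algebra_simps)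
      have "0 \<le> ?a" using d0[of k] by simp
      then have "norm (g ?b - g ?a - (?b - ?a) *\<^sub>R v) \<le> e / 2 * (?b - ?a)"
        using js[of k] js2[of k] elim s d0[of k] unfolding ba by (intro r(2)) auto
      moreover have "g ?b - g ?a = d k *\<^sub>R dyadic_slope g T (m k) (j k)"
        unfolding d_def by (rule dyadic_slope_scale[OF T, symmetric])
      moreover have "?b - ?a = d k" using ba by simp
      ultimately have "norm (d k *\<^sub>R (dyadic_slope g T (m k) (j k) - v)) \<le> e / 2 * d k"
        by (simp only: scaleR_diff_right)
      then have "d k * norm (dyadic_slope g T (m k) (j k) - v) \<le> d k * (e / 2)"
        using d0[of k] by (simp add: mult.commute)
      then have "norm (dyadic_slope g T (m k) (j k) - v) \<le> e / 2" using d0[of k] by (simp only: mult_le_cancel_left_pos)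
      then show ?case using e by (simp add: dist_norm)
    qed
  qed
  then show "(\<lambda>k. dyadic_slope g T (m k) (nat \<lfloor>s / (T / 2 ^ m k)\<rfloor>)) \<longlonglongrightarrow> v" by (simp add: j_def d_def)
qed

section \<open>Fatou's lemma for the dyadic step functions\<close>

context tonelli
begin

text \<open>The truncated sums are integrals of step functions up to a vanishing error, and these
  step functions converge almost everywhere to the integrand of the cost, so Fatou's lemma
  applies.\<close>

lemma lower_semicontinuity:
  assumes T: "T > 0" and ac: "absolutely_continuous_on {0..T} g"
    and bound: "\<And>R e. e > 0 \<Longrightarrow> \<exists>m0. \<forall>m\<ge>m0. truncated_sum g T R e m \<le> S"
  shows "(\<integral>\<^sup>+ s\<in>{0..T}. ennreal (L (g s) (vector_derivative g (at s within {0..T}))) \<partial>lebesgue) \<le> ennreal S"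
proof -
  define e where "e = (\<lambda>k. inverse (real (Suc k)))"
  have e0: "e k > 0" for k by (simp add: e_def)
  \<comment> \<open>A diagonal choice: at stage \<open>k\<close> the slope cap is \<open>k\<close>
    and the error is \<open>1 / (k + 1)\<close>, at a level \<open>m k\<close> fine enough for
    both.\<close>
  have "\<forall>k. \<exists>m. k \<le> m \<and> truncated_sum g T (real k) (e k) m \<le> S"
  proof
    fix k
    obtain m0 where "\<And>m. m \<ge> m0 \<Longrightarrow> truncated_sum g T (real k) (e k) m \<le> S"
      using bound[OF e0[of k], of "real k"] by blast
    then have "k \<le> max k m0 \<and> truncated_sum g T (real k) (e k) (max k m0) \<le> S" by simp
    then show "\<exists>m. k \<le> m \<and> truncated_sum g T (real k) (e k) m \<le> S" by blast
  qed
  then obtain m where mQ: "\<And>k. k \<le> m k \<and> truncated_sum g T (real k) (e k) (m k) \<le> S" by metis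
  then have m: "\<And>k. m k \<ge> k" by blast
  have mlim: "filterlim m at_top sequentially"
    by (rule filterlim_at_top_mono[OF filterlim_ident]) (use m in auto)
  define d where "d = (\<lambda>k. T / 2 ^ m k)"
  have d0: "d k > 0" for k using T by (simp add: d_def)
  define c where "c = (\<lambda>k j. if norm (dyadic_slope g T (m k) j) \<le> real k
      then L (g (real j * d k)) (dyadic_slope g T (m k) j) else 0)"
  have c0: "c k j \<ge> 0" for k j using nonneg by (simp add: c_def)
  define A where "A = (\<lambda>k j. {real j * d k..<real (Suc j) * d k})"
  have [measurable]: "A k j \<in> sets lebesgue" for k j by (simp add: A_def)
  define w where "w = (\<lambda>k s. \<Sum>j<2 ^ m k - 1. ennreal (c k j) * indicator (A k j) s)"
  have wint: "(\<integral>\<^sup>+ s. w k s \<partial>lebesgue) \<le> ennreal (S + T * e k)" for k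
  proof -
    have "(\<integral>\<^sup>+ s. w k s \<partial>lebesgue) = (\<Sum>j<2 ^ m k - 1. ennreal (c k j) * emeasure lebesgue (A k j))"
      unfolding w_def by (subst nn_integral_sum) (auto simp: nn_integral_cmult_indicator)
    also have "\<dots> = (\<Sum>j<2 ^ m k - 1. ennreal (c k j * d k))"
    proof (rule sum.cong[OF refl])
      fix j
      have "emeasure lebesgue (A k j) = ennreal (d k)"
        using d0[of k] by (simp add: A_def algebra_simps)
      then show "ennreal (c k j) * emeasure lebesgue (A k j) = ennreal (c k j * d k)"
        using c0 d0[of k] by (simp add: ennreal_mult)
    qed
    also have "\<dots> = ennreal (\<Sum>j<2 ^ m k - 1. c k j * d k)"
      using c0 d0[of k] by (intro sum_ennreal) (simp add: less_imp_le)
    also have "\<dots> \<le> ennreal (S + T * e k)"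
    proof (rule ennreal_leI)
      have "(\<Sum>j<2 ^ m k - 1. c k j * d k) \<le> (\<Sum>j<2 ^ m k - 1. (if norm (dyadic_slope g T (m k) j) \<le> real k
        then d k * (L (g (real j * d k)) (dyadic_slope g T (m k) j) - e k) else 0) + d k * e k)"
        using d0[of k] e0[of k] by (intro sum_mono) (auto simp: c_def algebra_simps)
      also have "\<dots> \<le> S + real (2 ^ m k - 1) * (d k * e k)"
        using mQ[of k] unfolding sum.distrib truncated_sum_def d_def by simp
      also have "real (2 ^ m k - 1) * (d k * e k) \<le> real (2 ^ m k) * (d k * e k)"
        using d0[of k] e0[of k] by (intro mult_right_mono) auto
      also have "real (2 ^ m k) * (d k * e k) = T * e k" by (simp add: d_def)
      finally show "(\<Sum>j<2 ^ m k - 1. c k j * d k) \<le> S + T * e k" by simp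
    qed
    finally show ?thesis .
  qed
  have "(\<lambda>k. S + T * e k) \<longlonglongrightarrow> S + T * 0" unfolding e_def by (intro tendsto_intros LIMSEQ_inverse_real_of_nat)
  then have "(\<lambda>k. ennreal (S + T * e k)) \<longlonglongrightarrow> ennreal S" by (intro tendsto_ennrealI) simp
  then have lim: "liminf (\<lambda>k. ennreal (S + T * e k)) = ennreal S" by (intro lim_imp_Liminf) auto
  define f' where "f' = (\<lambda>s. vector_derivative g (at s within {0..T}))"
  \<comment> \<open>The end point \<open>T\<close> is added because the half-open cells do not
    contain it.\<close>
  define Z where "Z = {s \<in> {0..T}. \<not> (g has_vector_derivative f' s) (at s within {0..T})} \<union> {T}"
  have "negligible Z" unfolding Z_def f'_def
    using absolutely_continuous_on_differentiable_ae[OF ac T] by (intro negligible_Un) auto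
  then have "Z \<in> null_sets lebesgue" by (simp add: negligible_iff_null_sets)
  then have ae: "AE s in lebesgue. s \<notin> Z" by (rule AE_not_in)
  have gc: "continuous_on {0..T} g" by (rule absolutely_continuous_on_imp_continuous_on[OF ac])
  have wlim: "(\<lambda>k. w k s) \<longlonglongrightarrow> ennreal (L (g s) (f' s))" if s: "s \<in> {0..T}" "s \<notin> Z" for s
  proof -
    define j where "j = (\<lambda>k. nat \<lfloor>s / (T / 2 ^ m k)\<rfloor>)"
    have s': "0 \<le> s" "s < T" "(g has_vector_derivative f' s) (at s within {0..T})"
      using s by (auto simp: Z_def)
    note dy = dyadic_slope_tendsto_derivative[OF T s'(3,1,2) mlim]
    have x: "(\<lambda>k. real (j k) * d k) \<longlonglongrightarrow> s" unfolding j_def d_def by (rule dy(2))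
    have slope: "(\<lambda>k. dyadic_slope g T (m k) (j k)) \<longlonglongrightarrow> f' s" unfolding j_def by (rule dy(1))
    have jlt: "\<forall>\<^sub>F k in sequentially. j k < 2 ^ m k - 1" unfolding j_def by (rule dy(3))
    have sA: "s \<in> A k (j k)" for k unfolding A_def j_def d_def by (rule dy(4))
    have dis: "i = j k" if iA: "s \<in> A k i" for i k
    proof (rule ccontr)
      note sep = grid_mono[OF d0[of k]]
      assume "i \<noteq> j k"
      then consider "i < j k" | "j k < i" by linarith
      then show False
      proof cases
        case 1 then show False using sep[OF 1] iA sA[of k] unfolding A_def atLeastLessThan_iff by linarith
      next
        case 2 then show False using sep[OF 2] iA sA[of k] unfolding A_def atLeastLessThan_iff by linarith
      qed
    qed
    have xin: "real (j k) * d k \<in> {0..T}" for k using sA[of k] s'(2) d0[of k] by (simp add: A_def)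
    have gx: "(\<lambda>k. g (real (j k) * d k)) \<longlonglongrightarrow> g s"
      by (rule continuous_on_tendsto_compose[OF gc x]) (use s xin in auto)
    have "(\<lambda>k. (\<lambda>(x, u). L x u) (g (real (j k) * d k), dyadic_slope g T (m k) (j k))) \<longlonglongrightarrow> (\<lambda>(x, u). L x u) (g s, f' s)"
      by (rule continuous_on_tendsto_compose[OF cont]) (auto intro!: tendsto_Pair gx slope)
    then have Llim: "(\<lambda>k. ennreal (L (g (real (j k) * d k)) (dyadic_slope g T (m k) (j k)))) \<longlonglongrightarrow> ennreal (L (g s) (f' s))"
      by (intro tendsto_ennrealI) simp
    \<comment> \<open>The slopes at \<open>s\<close> converge, hence stay bounded, whereas the cap
      tends to infinity; eventually the cap is inactive at \<open>s\<close>.\<close>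
    have "\<forall>\<^sub>F k in sequentially. norm (dyadic_slope g T (m k) (j k)) < norm (f' s) + 1"
      by (rule order_tendstoD(2)[OF tendsto_norm[OF slope]]) simp
    moreover have "\<forall>\<^sub>F k in sequentially. norm (f' s) + 1 \<le> real k"
      using filterlim_real_sequentially by (auto simp: filterlim_at_top)
    ultimately have "\<forall>\<^sub>F k in sequentially. ennreal (L (g (real (j k) * d k)) (dyadic_slope g T (m k) (j k))) = w k s"
      using jlt
    proof eventually_elim
      case (elim k)
      have "w k s = (\<Sum>i<2 ^ m k - 1. if i = j k then ennreal (c k i) else 0)"
        unfolding w_def
      proof (rule sum.cong[OF refl])
        fix i show "ennreal (c k i) * indicator (A k i) s = (if i = j k then ennreal (c k i) else 0)"
        proof (cases "i = j k")
          case True then show ?thesis using sA[of k] by (simp add: True)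
        next
          case False
          then have "s \<notin> A k i" using dis by blast
          then show ?thesis using False by simp
        qed
      qed
      also have "\<dots> = ennreal (c k (j k))" using elim(3) by simp
      finally show ?case using elim(1,2) by (simp add: c_def)
    qed
    then show ?thesis by (rule Lim_transform_eventually[OF Llim])
  qed
  have "(\<integral>\<^sup>+ s\<in>{0..T}. ennreal (L (g s) (f' s)) \<partial>lebesgue) \<le> (\<integral>\<^sup>+ s. liminf (\<lambda>k. w k s) \<partial>lebesgue)"
  proof (rule nn_integral_mono_AE)
    show "AE s in lebesgue. ennreal (L (g s) (f' s)) * indicator {0..T} s \<le> liminf (\<lambda>k. w k s)"
      using ae
    proof eventually_elim
      case (elim s)
      show ?case
      proof (cases "s \<in> {0..T}")
        case True
        have "liminf (\<lambda>k. w k s) = ennreal (L (g s) (f' s))"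
          by (rule lim_imp_Liminf[OF sequentially_bot wlim[OF True elim]])
        then show ?thesis using True by simp
      qed simp
    qed
  qed
  also have "\<dots> \<le> liminf (\<lambda>k. \<integral>\<^sup>+ s. w k s \<partial>lebesgue)"
  proof (rule nn_integral_liminf)
    show "w k \<in> borel_measurable lebesgue" for k
      unfolding w_def by measurable
  qed
  also have "\<dots> \<le> liminf (\<lambda>k. ennreal (S + T * e k))"
    by (intro Liminf_mono always_eventually allI wint)
  also have "\<dots> = ennreal S" by (rule lim)
  finally show ?thesis by (simp add: f'_def)
qed

end

section \<open>Optimal arcs\<close>

text \<open>The time spent in the interval from \<open>c\<close> to \<open>c + d\<close> up to time
  \<open>s\<close>.\<close>

definition ramp :: "real \<Rightarrow> real \<Rightarrow> real \<Rightarrow> real" where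
  "ramp d c s = max 0 (min d (s - c))"

text \<open>Written as a sum of ramps, an increment of the polygon is the sum of the velocities
  weighted by the overlaps of the given interval with the cells; no case distinction on the cells is
  needed.\<close>

definition polygon :: "'a::real_normed_vector \<Rightarrow> real \<Rightarrow> (nat \<Rightarrow> 'a) \<Rightarrow> nat \<Rightarrow> real \<Rightarrow> 'a" where
  "polygon x d u N s = x + (\<Sum>i<N. ramp d (real i * d) s *\<^sub>R u i)"

lemma ramp_before: "s \<le> c \<Longrightarrow> ramp d c s = 0"
  by (auto simp: ramp_def max_def min_def)

lemma polygon_0 [simp]: "d > 0 \<Longrightarrow> polygon x d u N 0 = x"
  by (simp add: polygon_def ramp_before)

lemma polygon_grid:
  assumes d: "d > 0" and l: "l \<le> N" and rec: "\<And>i. i < N \<Longrightarrow> p (Suc i) = p i + d *\<^sub>R u i"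
  shows "polygon (p 0) d u N (real l * d) = p l"
proof -
  have ramp: "ramp d (real i * d) (real l * d) = (if i < l then d else 0)" for i
  proof (cases "i < l")
    case True
    then have "real (Suc i) * d \<le> real l * d" by (rule grid_mono[OF d])
    then show ?thesis using True d by (simp add: ramp_def algebra_simps)
  next
    case False
    then have "real l * d \<le> real i * d" using d by (intro mult_right_mono) auto
    then show ?thesis using False by (simp add: ramp_before)
  qed
  have "polygon (p 0) d u N (real l * d) = p 0 + (\<Sum>i\<in>{..<N}. if i \<in> {..<l} then d *\<^sub>R u i else 0)"
    unfolding polygon_def ramp by (intro arg_cong2[of _ _ _ _ "(+)"] refl sum.cong) auto
  also have "\<dots> = p 0 + (\<Sum>i<l. d *\<^sub>R u i)"
    using l by (subst sum.inter_restrict[symmetric]) (auto simp: Int_absorb1)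
  also have "\<dots> = p l" using l
  proof (induction l)
    case (Suc l)
    then have "p l = p 0 + (\<Sum>i<l. d *\<^sub>R u i)" by simp
    then show ?case using rec[of l] Suc.prems by (simp add: add.assoc)
  qed simp
  finally show ?thesis .
qed

lemma ramp_diff:
  assumes "a \<le> b" "d > 0"
  shows "ramp d c b - ramp d c a = measure lebesgue ({a<..<b} \<inter> {c<..<c + d})"
proof -
  have "{a<..<b} \<inter> {c<..<c + d} = {max a c<..<min b (c + d)}" by auto
  then show ?thesis using assms by (auto simp: ramp_def max_def min_def measure_completion)
qed

lemma sum_measure_disjoint_le:
  assumes "finite J" "disjoint_family_on A J" "\<And>j. j \<in> J \<Longrightarrow> A j \<in> lmeasurable \<and> A j \<subseteq> U" "U \<in> lmeasurable"
  shows "(\<Sum>j\<in>J. measure lebesgue (A j)) \<le> measure lebesgue U"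
proof -
  have "(\<Sum>j\<in>J. measure lebesgue (A j)) = measure lebesgue (\<Union>j\<in>J. A j)"
  proof (rule measure_finite_Union[symmetric, OF assms(1) _ assms(2)])
    show "A ` J \<subseteq> sets lebesgue" using assms(3) by (auto simp: fmeasurableD)
    show "emeasure lebesgue (A j) \<noteq> \<infinity>" if "j \<in> J" for j
      using fmeasurableD2 assms(3)[OF that] by (metis infinity_ennreal_def)
  qed
  also have "\<dots> \<le> measure lebesgue U"
    using assms by (intro measure_mono_fmeasurable) (auto intro!: sets.finite_UN fmeasurableD)
  finally show ?thesis .
qed

text \<open>The overlaps \<open>D p i\<close> form a matrix whose sums over \<open>i\<close> are at
  most the interval lengths and whose sums over \<open>p\<close> are at most \<open>d\<close>. The
  first bound is used for the constant part \<open>R\<close> of the speed, the second for the part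
  controlled by the cost.\<close>

lemma polygon_variation:
  assumes d: "d > 0" and fin: "finite I" and le: "\<And>a b. (a, b) \<in> I \<Longrightarrow> a \<le> b"
    and disj: "disjoint_family_on (\<lambda>(a, b). {a<..<b}) I"
    and u: "\<And>i. i < N \<Longrightarrow> norm (u i) \<le> R + e * l i" and l: "\<And>i. 0 \<le> l i" and "0 \<le> e" "0 \<le> R"
  shows "(\<Sum>(a, b)\<in>I. norm (polygon x d u N b - polygon x d u N a)) \<le> R * (\<Sum>(a, b)\<in>I. b - a) + e * (\<Sum>i<N. d * l i)"
proof -
  define A where "A = (\<lambda>p i. {fst p<..<snd p} \<inter> {real i * d<..<real i * d + d})"
  define D where "D = (\<lambda>p i. measure lebesgue (A p i))"
  have sep: "real i * d + d \<le> real j * d" if "i < j" for i j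
    using grid_mono[OF d that] by (simp add: algebra_simps)
  have D0: "D p i \<ge> 0" for p i by (simp add: D_def)
  have Am: "A p i \<in> lmeasurable" for p i
    by (rule bounded_set_imp_lmeasurable) (auto simp: A_def intro: bounded_subset[OF bounded_box])
  have Dx: "(\<Sum>i<N. D p i) \<le> snd p - fst p" if p: "p \<in> I" for p
  proof -
    have "(\<Sum>i<N. D p i) \<le> measure lebesgue {fst p<..<snd p}"
      unfolding D_def
    proof (rule sum_measure_disjoint_le)
      show "disjoint_family_on (A p) {..<N}"
        unfolding disjoint_family_on_def
      proof (intro ballI impI)
        fix i j :: nat assume "i \<noteq> j"
        then consider "i < j" | "j < i" by linarith
        then show "A p i \<inter> A p j = {}"
        proof cases
          case 1 then show ?thesis using sep[OF 1] by (auto simp: A_def)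
        next
          case 2 then show ?thesis using sep[OF 2] by (auto simp: A_def)
        qed
      qed
    qed (use Am in \<open>auto simp: A_def\<close>)
    also have "\<dots> = snd p - fst p" using le[of "fst p" "snd p"] p by (simp add: measure_completion)
    finally show ?thesis .
  qed
  have Di: "(\<Sum>p\<in>I. D p i) \<le> d" for i
  proof -
    have "(\<Sum>p\<in>I. D p i) \<le> measure lebesgue {real i * d<..<real i * d + d}"
      unfolding D_def
    proof (rule sum_measure_disjoint_le[OF fin])
      show "disjoint_family_on (\<lambda>p. A p i) I"
        using disj unfolding disjoint_family_on_def A_def by (fastforce simp: case_prod_beta)
    qed (use Am in \<open>auto simp: A_def\<close>)
    also have "\<dots> = d" using d by (simp add: measure_completion)
    finally show ?thesis .
  qed
  have "(\<Sum>(a, b)\<in>I. norm (polygon x d u N b - polygon x d u N a)) \<le> (\<Sum>p\<in>I. \<Sum>i<N. D p i * (R + e * l i))"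
  proof (rule sum_mono)
    fix p assume p: "p \<in> I"
    have pl: "fst p \<le> snd p" using le[of "fst p" "snd p"] p by simp
    have "polygon x d u N (snd p) - polygon x d u N (fst p) = (\<Sum>i<N. D p i *\<^sub>R u i)"
      using ramp_diff[OF pl d] by (simp add: polygon_def D_def A_def flip: sum_subtractf scaleR_diff_left)
    also have "norm \<dots> \<le> (\<Sum>i<N. D p i * (R + e * l i))"
      using u by (intro sum_norm_le) (simp add: D0 mult_left_mono)
    finally show "(case p of (a, b) \<Rightarrow> norm (polygon x d u N b - polygon x d u N a)) \<le> (\<Sum>i<N. D p i * (R + e * l i))"
      by (simp add: case_prod_beta)
  qed
  also have "\<dots> = R * (\<Sum>p\<in>I. \<Sum>i<N. D p i) + e * (\<Sum>i<N. l i * (\<Sum>p\<in>I. D p i))"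
  proof -
    have "(\<Sum>p\<in>I. \<Sum>i<N. D p i * (R + e * l i)) = (\<Sum>p\<in>I. \<Sum>i<N. R * D p i) + (\<Sum>p\<in>I. \<Sum>i<N. e * (l i * D p i))"
      by (simp add: sum.distrib[symmetric] algebra_simps)
    also have "(\<Sum>p\<in>I. \<Sum>i<N. e * (l i * D p i)) = (\<Sum>i<N. \<Sum>p\<in>I. e * (l i * D p i))" by (rule sum.swap)
    finally show ?thesis by (simp add: sum_distrib_left)
  qed
  also have "\<dots> \<le> R * (\<Sum>p\<in>I. snd p - fst p) + e * (\<Sum>i<N. l i * d)"
    using Dx Di l assms(7,8) by (intro add_mono mult_left_mono sum_mono) auto
  finally show ?thesis by (simp add: case_prod_beta mult.commute)
qed

section \<open>Construction of the optimal arc\<close>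

context hamilton_jacobi
begin

text \<open>The other half of the initial condition: along every sequence approaching
  \<open>(0, z)\<close> with positive times, the values of \<open>W\<close> cannot fall below \<phi>
  \<open>z\<close> in the limit.\<close>

lemma init_le_limit:
  assumes z: "\<xi> \<longlonglongrightarrow> z" and \<tau>: "\<tau> \<longlonglongrightarrow> 0" "\<And>n. \<tau> n > 0"
    and b: "\<And>n. W (\<tau> n, \<xi> n) \<le> b n" "b \<longlonglongrightarrow> c"
  shows "\<phi> z \<le> ennreal c"
proof (rule dense_le)
  fix a assume "a < \<phi> z"
  then have "\<forall>\<^sub>F p in at_right 0 \<times>\<^sub>F nhds z. a < (\<lambda>(h, y). ennreal (W (h, y))) p"
    unfolding init[symmetric] by (rule less_LiminfD)
  moreover have "filterlim (\<lambda>n. (\<tau> n, \<xi> n)) (at_right 0 \<times>\<^sub>F nhds z) sequentially"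
    using z \<tau> less_imp_neq[OF \<tau>(2)] by (intro filterlim_Pair) (auto simp: filterlim_at)
  ultimately have "\<forall>\<^sub>F n in sequentially. a < (\<lambda>(h, y). ennreal (W (h, y))) (\<tau> n, \<xi> n)"
    by (rule eventually_compose_filterlim)
  then have "\<forall>\<^sub>F n in sequentially. a \<le> ennreal (b n)"
    by eventually_elim (use b(1) in \<open>auto intro: order_trans[OF less_imp_le] ennreal_leI\<close>)
  then show "a \<le> ennreal c"
    by (rule tendsto_lowerbound[OF tendsto_ennrealI[OF b(2)]]) simp
qed

text \<open>The time steps are dyadic so that the grid refines every coarser dyadic grid.\<close>

lemma dyadic_descent:
  assumes t: "t > 0"
  shows "\<exists>K N p p' u \<tau> \<xi>. n \<le> K \<and> 2 ^ K - 2 ^ (K - n) \<le> N \<and> real N * (t / 2 ^ K) = t - t / 2 ^ Suc n \<and>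
    descent t x (t / 2 ^ Suc n) ((1 / 2) ^ n) N (t / 2 ^ K) p p' u \<tau> \<xi>"
proof -
  \<comment> \<open>The exponent \<open>Suc n\<close> guarantees that \<sigma> is less than
    \<open>t\<close> even for \<open>n = 0\<close>.\<close>
  define \<sigma> where "\<sigma> = t / 2 ^ Suc n"
  have "t * 1 < t * 2 ^ Suc n" using t by (intro mult_strict_left_mono one_less_power) auto
  then have \<sigma>: "0 < \<sigma>" "\<sigma> < t" using t by (simp_all add: \<sigma>_def pos_divide_less_eq)
  have e0: "(0::real) < (1 / 2) ^ n" by simp
  obtain \<delta>0 where \<delta>0: "\<delta>0 > 0" "\<And>N \<delta>. 0 < \<delta> \<Longrightarrow> \<delta> \<le> \<delta>0 \<Longrightarrow> real N * \<delta> = t - \<sigma> \<Longrightarrow>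
     \<exists>p p' u \<tau> \<xi>. descent t x \<sigma> ((1 / 2) ^ n) N \<delta> p p' u \<tau> \<xi>"
    using discrete_descent[OF \<sigma> e0, of x] by blast
  obtain k where k: "\<And>m. m \<ge> k \<Longrightarrow> t / 2 ^ m < \<delta>0" using dyadic_mesh_less[OF \<delta>0(1)] by blast
  define K where "K = max k (Suc n)"
  \<comment> \<open>The full grid has \<open>2 ^ K\<close> steps, and since
    \<open>Suc n \<le> K\<close> the final stretch of length \<sigma> consists of exactly
    \<open>2 ^ (K - Suc n)\<close> of them.\<close>
  define N where "N = (2::nat) ^ K - 2 ^ (K - Suc n)"
  have K: "Suc n \<le> K" by (simp add: K_def)
  have small: "t / 2 ^ K \<le> \<delta>0" using k[of K] by (simp add: K_def)
  have "(2::nat) ^ (K - Suc n) \<le> 2 ^ K" by (intro power_increasing) auto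
  then have "real N = 2 ^ K - 2 ^ (K - Suc n)" by (simp add: N_def of_nat_diff)
  moreover have "(2::real) ^ K = 2 ^ (K - Suc n) * 2 ^ Suc n" using K by (simp flip: power_add del: power_Suc)
  moreover have "(a * b - a) * (t / (a * b)) = t - t / b" if "a > 0" "b > 0" for a b :: real
    using that by (simp add: field_simps)
  ultimately have N: "real N * (t / 2 ^ K) = t - t / 2 ^ Suc n"
    by (simp del: power_Suc)
  have "(2::nat) ^ (K - Suc n) \<le> 2 ^ (K - n)" by (intro power_increasing) auto
  then have N2: "2 ^ K - 2 ^ (K - n) \<le> N" unfolding N_def by (rule diff_le_mono2)
  have "0 < t / 2 ^ K" using t by simp
  from \<delta>0(2)[OF this small N[folded \<sigma>_def]] N N2 K show ?thesis
    unfolding \<sigma>_def using Suc_leD by blast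
qed

lemma optimal_arc:
  assumes t: "t > 0"
  obtains g where "absolutely_continuous_on {0..t} g" "g 0 = x" "bolza_cost L \<phi> t g \<le> ennreal (W (t, x))"
proof -
  define e where "e = (\<lambda>n::nat. (1 / 2 :: real) ^ n)"
  have e0: "e n > 0" "e n \<le> 1" for n by (auto simp: e_def power_le_one)
  have elim: "e \<longlonglongrightarrow> 0" unfolding e_def by (rule LIMSEQ_power_zero) simp
  have "\<forall>n. \<exists>K N p p' u \<tau> \<xi>. n \<le> K \<and> 2 ^ K - 2 ^ (K - n) \<le> N \<and> real N * (t / 2 ^ K) = t - t / 2 ^ Suc n \<and>
      descent t x (t / 2 ^ Suc n) (e n) N (t / 2 ^ K) p p' u \<tau> \<xi>"
    unfolding e_def using dyadic_descent[OF t] by blast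
  then obtain K N p p' u \<tau> \<xi> where Q: "\<And>n. n \<le> K n \<and> 2 ^ K n - 2 ^ (K n - n) \<le> N n \<and>
      real (N n) * (t / 2 ^ K n) = t - t / 2 ^ Suc n \<and>
      descent t x (t / 2 ^ Suc n) (e n) (N n) (t / 2 ^ K n) (p n) (p' n) (u n) (\<tau> n) (\<xi> n)"
    by metis
  define d where "d = (\<lambda>n. t / 2 ^ K n)"
  have d0: "d n > 0" for n using t by (simp add: d_def)
  have Kn: "n \<le> K n" and Nn: "2 ^ K n - 2 ^ (K n - n) \<le> N n" and Nt: "real (N n) * d n = t - t / 2 ^ Suc n"
    and p0: "p n 0 = x" and \<tau>0: "\<tau> n > 0" and \<tau>: "\<bar>\<tau> n - t / 2 ^ Suc n\<bar> \<le> e n" and \<xi>: "norm (\<xi> n - p n (N n)) \<le> e n"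
    and cost: "W (\<tau> n, \<xi> n) + (\<Sum>i<N n. d n * L (p' n i) (u n i)) \<le> W (t, x) + e n" for n
    using Q[of n] unfolding descent_def d_def by auto
  have rec: "p n (Suc i) = p n i + d n *\<^sub>R u n i" and pp: "norm (p' n i - p n i) \<le> e n" if "i < N n" for n i
    using Q[of n] that unfolding descent_def d_def by auto
  define c where "c = (\<lambda>n. \<Sum>i<N n. d n * L (p' n i) (u n i))"
  define M where "M = W (t, x) + 1"
  have M0: "M > 0" using W_nonneg[OF t, of x] by (simp add: M_def)
  have c0: "c n \<ge> 0" for n unfolding c_def using d0[of n] nonneg by (intro sum_nonneg mult_nonneg_nonneg) auto
  have cM: "c n \<le> M" for n using cost[of n] W_nonneg[OF \<tau>0[of n], of "\<xi> n"] e0(2)[of n] by (simp add: c_def M_def)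
  define y where "y = (\<lambda>n. polygon x (d n) (u n) (N n))"
  have grid: "real i * d n \<in> {0..t}" if "i \<le> N n" for i n
  proof -
    have "real i * d n \<le> real (N n) * d n" using that d0[of n] by (intro mult_right_mono) auto
    moreover have "t / 2 ^ Suc n \<ge> 0" using t by simp
    ultimately show ?thesis using d0[of n] Nt[of n] by simp
  qed
  have yp: "y n (real i * d n) = p n i" if "i \<le> N n" for n i
    unfolding y_def p0[of n, symmetric] by (rule polygon_grid[OF d0 that]) (rule rec)
  \<comment> \<open>\<open>R\<close> depends on \<epsilon> but not on \<open>n\<close>, so all
    polygons share one modulus of absolute continuity. Applied to single intervals it gives
    equicontinuity, and in the limit it makes \<open>g\<close> absolutely continuous.\<close>
  have var: "\<exists>R\<ge>0. \<forall>n I. finite I \<and> (\<forall>(a, b)\<in>I. a \<le> b) \<and> disjoint_family_on (\<lambda>(a, b). {a<..<b}) I \<longrightarrow>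
      (\<Sum>(a, b)\<in>I. norm (y n b - y n a)) \<le> R * (\<Sum>(a, b)\<in>I. b - a) + \<epsilon> * M" if \<epsilon>: "\<epsilon> > 0" for \<epsilon>
  proof -
    obtain R where R: "R > 0" "\<And>u x. norm u \<le> R + \<epsilon> * L x u" using superlinear_bound[OF \<epsilon>] by blast
    have "(\<Sum>(a, b)\<in>I. norm (y n b - y n a)) \<le> R * (\<Sum>(a, b)\<in>I. b - a) + \<epsilon> * M"
      if I: "finite I" "\<forall>(a, b)\<in>I. a \<le> b" "disjoint_family_on (\<lambda>(a, b). {a<..<b}) I" for n I
    proof -
      have "(\<Sum>(a, b)\<in>I. norm (y n b - y n a)) \<le> R * (\<Sum>(a, b)\<in>I. b - a) + \<epsilon> * (\<Sum>i<N n. d n * L (p' n i) (u n i))"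
        unfolding y_def
        by (rule polygon_variation[OF d0 I(1) _ I(3)]) (use I(2) R nonneg \<epsilon> in \<open>auto simp: less_imp_le\<close>)
      also have "\<epsilon> * (\<Sum>i<N n. d n * L (p' n i) (u n i)) \<le> \<epsilon> * M" using cM[of n] \<epsilon> by (simp add: c_def)
      finally show ?thesis by simp
    qed
    then show ?thesis using R(1) by (intro exI[of _ R]) auto
  qed
  have inc: "\<exists>R\<ge>0. \<forall>n a b. norm (y n b - y n a) \<le> R * \<bar>b - a\<bar> + \<epsilon> * M" if \<epsilon>: "\<epsilon> > 0" for \<epsilon>
  proof -
    obtain R where R: "R \<ge> 0" "\<And>n I. finite I \<Longrightarrow> (\<forall>(a, b)\<in>I. a \<le> b) \<Longrightarrow> disjoint_family_on (\<lambda>(a, b). {a<..<b}) I \<Longrightarrow>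
      (\<Sum>(a, b)\<in>I. norm (y n b - y n a)) \<le> R * (\<Sum>(a, b)\<in>I. b - a) + \<epsilon> * M" using var[OF \<epsilon>] by blast
    have le: "norm (y n b - y n a) \<le> R * (b - a) + \<epsilon> * M" if "a \<le> b" for n a b
      using R(2)[of "{(a, b)}" n] that by (simp add: disjoint_family_on_def)
    have "norm (y n b - y n a) \<le> R * \<bar>b - a\<bar> + \<epsilon> * M" for n a b
      using le[of a b n] le[of b a n] by (cases "a \<le> b") (auto simp: norm_minus_commute)
    then show ?thesis using R(1) by blast
  qed
  obtain g r1 where gc: "continuous_on {0..t} g" and r1: "strict_mono (r1 :: nat \<Rightarrow> nat)"
    and unif1: "\<And>\<epsilon>. 0 < \<epsilon> \<Longrightarrow> \<exists>n0. \<forall>n s. n \<ge> n0 \<and> s \<in> {0..t} \<longrightarrow> norm (y (r1 n) s - g s) < \<epsilon>"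
  proof -
    obtain R where R: "R \<ge> 0" "\<And>n a b. norm (y n b - y n a) \<le> R * \<bar>b - a\<bar> + 1 * M" using inc[of 1] by auto
    show thesis
    proof (rule Arzela_Ascoli[of "{0..t}" y "norm x + (R * t + M)"])
      fix n s assume s: "s \<in> {0..t}"
      have "norm (y n s) \<le> norm (y n 0) + norm (y n s - y n 0)" by (metis add.commute diff_add_cancel norm_triangle_ineq)
      also have "norm (y n s - y n 0) \<le> R * \<bar>s - 0\<bar> + 1 * M" by (rule R(2))
      also have "R * \<bar>s - 0\<bar> \<le> R * t" using s R(1) by (intro mult_left_mono) auto
      finally show "norm (y n s) \<le> norm x + (R * t + M)" using d0 by (simp add: y_def)
    next
      fix s \<epsilon> :: real assume s: "s \<in> {0..t}" and \<epsilon>: "0 < \<epsilon>"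
      then have "\<epsilon> / (2 * M) > 0" using M0 by simp
      then obtain R where R: "R \<ge> 0" "\<And>n a b. norm (y n b - y n a) \<le> R * \<bar>b - a\<bar> + \<epsilon> / (2 * M) * M" using inc by blast
      show "\<exists>d>0. \<forall>n s'. s' \<in> {0..t} \<and> norm (s - s') < d \<longrightarrow> norm (y n s - y n s') < \<epsilon>"
      proof (intro exI[of _ "\<epsilon> / (2 * (R + 1))"] conjI allI impI)
        show "0 < \<epsilon> / (2 * (R + 1))" using \<epsilon> R by simp
        fix n s' assume s': "s' \<in> {0..t} \<and> norm (s - s') < \<epsilon> / (2 * (R + 1))"
        have "R * \<bar>s - s'\<bar> \<le> (R + 1) * \<bar>s - s'\<bar>" by (intro mult_right_mono) auto
        also have "\<dots> < \<epsilon> / 2" using s' R(1) by (simp add: field_simps)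
        finally show "norm (y n s - y n s') < \<epsilon>" using R(2)[of n s s'] M0 by (simp add: field_simps)
      qed
    qed (use that in \<open>auto\<close>)
  qed
  \<comment> \<open>A further subsequence makes the discrete costs converge as well; their limit
    \<open>S\<close> is the share of \<open>W (t, x)\<close> that bounds the running cost.\<close>
  have "seq_compact {0..M}" by (intro compact_imp_seq_compact) auto
  moreover have "\<forall>n. (c \<circ> r1) n \<in> {0..M}" using c0 cM by auto
  ultimately obtain S r2 where S: "S \<in> {0..M}" and r2: "strict_mono (r2 :: nat \<Rightarrow> nat)" and Slim: "((c \<circ> r1) \<circ> r2) \<longlonglongrightarrow> S"
    by (rule seq_compactE)
  define r where "r = r1 \<circ> r2"
  have r: "strict_mono r" unfolding r_def using r1 r2 by (rule strict_mono_o)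
  have rn: "n \<le> r n" for n using r by (rule strict_mono_imp_increasing)
  have clim: "(\<lambda>n. c (r n)) \<longlonglongrightarrow> S" using Slim by (simp add: r_def o_def)
  have unif: "\<exists>n0. \<forall>n\<ge>n0. \<forall>s\<in>{0..t}. norm (y (r n) s - g s) < \<epsilon>" if "\<epsilon> > 0" for \<epsilon>
  proof -
    obtain n0 where n0: "\<And>n s. n \<ge> n0 \<Longrightarrow> s \<in> {0..t} \<Longrightarrow> norm (y (r1 n) s - g s) < \<epsilon>" using unif1[OF \<open>\<epsilon> > 0\<close>] by blast
    have "norm (y (r n) s - g s) < \<epsilon>" if "n \<ge> n0" "s \<in> {0..t}" for n s
      using n0[of "r2 n" s] that strict_mono_imp_increasing[OF r2, of n] by (simp add: r_def)
    then show ?thesis by blast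
  qed
  have ptw: "(\<lambda>n. y (r n) s) \<longlonglongrightarrow> g s" if "s \<in> {0..t}" for s
    using unif that by (intro LIMSEQ_I) blast
  have er: "(\<lambda>n. e (r n)) \<longlonglongrightarrow> 0" using LIMSEQ_subseq_LIMSEQ[OF elim r] by (simp add: o_def)
  have g0: "g 0 = x"
  proof -
    have "(\<lambda>n. y (r n) 0) \<longlonglongrightarrow> g 0" using t by (intro ptw) simp
    moreover have "y (r n) 0 = x" for n using d0 by (simp add: y_def)
    ultimately show ?thesis by (simp add: LIMSEQ_const_iff)
  qed
  have ac: "absolutely_continuous_on {0..t} g"
    unfolding absolutely_continuous_on_def
  proof (intro allI impI)
    fix \<epsilon> :: real assume \<epsilon>: "\<epsilon> > 0"
    then have "\<epsilon> / (2 * M) > 0" using M0 by simp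
    from var[OF this] obtain R where R: "R \<ge> 0" "\<And>n I. finite I \<Longrightarrow> (\<forall>(a, b)\<in>I. a \<le> b) \<Longrightarrow> disjoint_family_on (\<lambda>(a, b). {a<..<b}) I \<Longrightarrow>
      (\<Sum>(a, b)\<in>I. norm (y n b - y n a)) \<le> R * (\<Sum>(a, b)\<in>I. b - a) + \<epsilon> / (2 * M) * M" by blast
    show "\<exists>\<delta>>0. \<forall>I. finite I \<and> (\<forall>(a, b)\<in>I. a \<le> b \<and> {a..b} \<subseteq> {0..t}) \<and>
        disjoint_family_on (\<lambda>(a, b). {a<..<b}) I \<and> (\<Sum>(a, b)\<in>I. b - a) < \<delta> \<longrightarrow> (\<Sum>(a, b)\<in>I. norm (g b - g a)) < \<epsilon>"
    proof (intro exI[of _ "\<epsilon> / (2 * (R + 1))"] conjI allI impI)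
      show "0 < \<epsilon> / (2 * (R + 1))" using \<epsilon> R by simp
      fix I :: "(real \<times> real) set"
      assume "finite I \<and> (\<forall>(a, b)\<in>I. a \<le> b \<and> {a..b} \<subseteq> {0..t}) \<and>
        disjoint_family_on (\<lambda>(a, b). {a<..<b}) I \<and> (\<Sum>(a, b)\<in>I. b - a) < \<epsilon> / (2 * (R + 1))"
      then have I: "finite I" "\<forall>(a, b)\<in>I. a \<le> b \<and> {a..b} \<subseteq> {0..t}" "disjoint_family_on (\<lambda>(a, b). {a<..<b}) I"
        "(\<Sum>(a, b)\<in>I. b - a) < \<epsilon> / (2 * (R + 1))" by auto
      have le: "\<forall>(a, b)\<in>I. a \<le> b" using I(2) by fast
      have sum0: "(\<Sum>(a, b)\<in>I. b - a) \<ge> 0" using le by (intro sum_nonneg) auto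
      have "(\<lambda>n. \<Sum>p\<in>I. norm (y (r n) (snd p) - y (r n) (fst p))) \<longlonglongrightarrow> (\<Sum>p\<in>I. norm (g (snd p) - g (fst p)))"
      proof (intro tendsto_sum tendsto_norm tendsto_diff ptw)
        fix p assume "p \<in> I"
        then have "fst p \<le> snd p" "{fst p..snd p} \<subseteq> {0..t}" using I(2) by (auto simp: case_prod_beta)
        then show "fst p \<in> {0..t}" "snd p \<in> {0..t}" by auto
      qed
      moreover have "(\<Sum>p\<in>I. norm (y (r n) (snd p) - y (r n) (fst p))) \<le> R * (\<Sum>(a, b)\<in>I. b - a) + \<epsilon> / 2" for n
        using R(2)[OF I(1) le I(3), of "r n"] M0 by (simp add: case_prod_beta)
      ultimately have "(\<Sum>p\<in>I. norm (g (snd p) - g (fst p))) \<le> R * (\<Sum>(a, b)\<in>I. b - a) + \<epsilon> / 2"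
        by (intro tendsto_upperbound[of _ _ sequentially]) auto
      moreover have "R * (\<Sum>(a, b)\<in>I. b - a) \<le> (R + 1) * (\<Sum>(a, b)\<in>I. b - a)" using sum0 by (intro mult_right_mono) auto
      moreover have "(R + 1) * (\<Sum>(a, b)\<in>I. b - a) < \<epsilon> / 2" using I(4) R(1) by (simp add: field_simps)
      ultimately show "(\<Sum>(a, b)\<in>I. norm (g b - g a)) < \<epsilon>" by (simp add: case_prod_beta)
    qed
  qed
  have lsc: "(\<integral>\<^sup>+ s\<in>{0..t}. ennreal (L (g s) (vector_derivative g (at s within {0..t}))) \<partial>lebesgue) \<le> ennreal S"
  proof (rule lower_semicontinuity[OF t ac])
    fix R \<epsilon> :: real assume \<epsilon>: "\<epsilon> > 0"
    show "\<exists>m0. \<forall>m\<ge>m0. truncated_sum g t R \<epsilon> m \<le> S"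
    proof (rule dyadic_lower_bound[OF t gc, where K = "\<lambda>n. K (r n)" and N = "\<lambda>n. N (r n)" and p = "\<lambda>n. p (r n)"
          and p' = "\<lambda>n. p' (r n)" and u = "\<lambda>n. u (r n)" and e = \<epsilon> and R = R])
      show "n \<le> K (r n)" for n using rn[of n] Kn[of "r n"] by linarith
      have "(2::nat) ^ (K (r n) - r n) \<le> 2 ^ (K (r n) - n)" for n using rn[of n] by (intro power_increasing) auto
      then show "2 ^ K (r n) - 2 ^ (K (r n) - n) \<le> N (r n)" for n
        using Nn[of "r n"] by (meson diff_le_mono2 order_trans)
      show "p (r n) (Suc i) = p (r n) i + (t / 2 ^ K (r n)) *\<^sub>R u (r n) i" if "i < N (r n)" for n i
        using rec[OF that] by (simp add: d_def)
      show "\<exists>n0. \<forall>n\<ge>n0. \<forall>i\<le>N (r n). norm (p (r n) i - g (real i * (t / 2 ^ K (r n)))) \<le> b" if "b > 0" for b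
      proof -
        obtain n0 where n0: "\<And>n s. n \<ge> n0 \<Longrightarrow> s \<in> {0..t} \<Longrightarrow> norm (y (r n) s - g s) < b" using unif[OF \<open>b > 0\<close>] by blast
        have "norm (p (r n) i - g (real i * d (r n))) \<le> b" if "n \<ge> n0" "i \<le> N (r n)" for n i
          using n0[OF that(1) grid[OF that(2)]] yp[OF that(2)] by simp
        then show ?thesis unfolding d_def by blast
      qed
      show "\<exists>n0. \<forall>n\<ge>n0. \<forall>i<N (r n). norm (p' (r n) i - p (r n) i) \<le> b" if "b > 0" for b
      proof -
        have "\<forall>\<^sub>F n in sequentially. e (r n) < b" using order_tendstoD(2)[OF er that] .
        then obtain n0 where "\<And>n. n \<ge> n0 \<Longrightarrow> e (r n) < b" by (auto simp: eventually_sequentially)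
        then show ?thesis using pp by (intro exI[of _ n0]) (meson less_imp_le order_trans)
      qed
      show "(\<lambda>n. \<Sum>i<N (r n). t / 2 ^ K (r n) * L (p' (r n) i) (u (r n) i)) \<longlonglongrightarrow> S"
        using clim by (simp add: c_def d_def)
      show "\<epsilon> > 0" by (rule \<epsilon>)
    qed blast
  qed
  have \<sigma>lim: "(\<lambda>n. t / 2 ^ Suc (r n)) \<longlonglongrightarrow> 0"
  proof -
    have "(\<lambda>n. (t / 2) * e (r n)) \<longlonglongrightarrow> (t / 2) * 0" by (intro tendsto_intros er)
    then show ?thesis by (simp add: e_def power_divide mult.commute)
  qed
  have "(\<lambda>n. \<tau> (r n) - t / 2 ^ Suc (r n)) \<longlonglongrightarrow> 0"
    by (rule Lim_null_comparison[OF _ er]) (use \<tau> in \<open>auto simp del: power_Suc\<close>)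
  from tendsto_add[OF this \<sigma>lim] have \<tau>lim: "(\<lambda>n. \<tau> (r n)) \<longlonglongrightarrow> 0" by simp
  have \<xi>lim: "(\<lambda>n. \<xi> (r n)) \<longlonglongrightarrow> g t"
  proof -
    \<comment> \<open>The polygons stop at varying times before \<open>t\<close>, so convergence at
      the final vertex combines uniform convergence of the polygons with continuity of the limit
      \<open>g\<close>.\<close>
    have "(\<lambda>n. real (N (r n)) * d (r n)) \<longlonglongrightarrow> t - 0" unfolding Nt by (intro tendsto_intros \<sigma>lim)
    then have "(\<lambda>n. g (real (N (r n)) * d (r n))) \<longlonglongrightarrow> g t"
      using t grid by (intro continuous_on_tendsto_compose[OF gc]) auto
    moreover have "(\<lambda>n. p (r n) (N (r n)) - g (real (N (r n)) * d (r n))) \<longlonglongrightarrow> 0"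
    proof (rule LIMSEQ_I)
      fix b :: real assume "b > 0"
      then obtain n0 where n0: "\<And>n s. n \<ge> n0 \<Longrightarrow> s \<in> {0..t} \<Longrightarrow> norm (y (r n) s - g s) < b" using unif by blast
      have "norm (p (r n) (N (r n)) - g (real (N (r n)) * d (r n)) - 0) < b" if "n \<ge> n0" for n
        using n0[OF that grid[of "N (r n)" "r n"]] yp[of "N (r n)" "r n"] by simp
      then show "\<exists>n0. \<forall>n\<ge>n0. norm (p (r n) (N (r n)) - g (real (N (r n)) * d (r n)) - 0) < b" by blast
    qed
    moreover have "(\<lambda>n. \<xi> (r n) - p (r n) (N (r n))) \<longlonglongrightarrow> 0"
      by (rule Lim_null_comparison[OF _ er]) (use \<xi> in auto)
    ultimately have "(\<lambda>n. g (real (N (r n)) * d (r n)) + ((p (r n) (N (r n)) - g (real (N (r n)) * d (r n))) + (\<xi> (r n) - p (r n) (N (r n)))))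
        \<longlonglongrightarrow> g t + (0 + 0)" by (intro tendsto_add)
    then show ?thesis by simp
  qed
  have blim: "(\<lambda>n. W (t, x) + e (r n) - c (r n)) \<longlonglongrightarrow> W (t, x) + 0 - S" by (intro tendsto_intros er clim)
  have Wb: "W (\<tau> (r n), \<xi> (r n)) \<le> W (t, x) + e (r n) - c (r n)" for n using cost[of "r n"] by (simp add: c_def)
  have phi: "\<phi> (g t) \<le> ennreal (W (t, x) - S)"
    using init_le_limit[OF \<xi>lim \<tau>lim \<tau>0 Wb blim] by simp
  \<comment> \<open>Both \<open>S\<close> and the remainder must be nonnegative for their
    \<open>ennreal\<close> images to add up to that of \<open>W (t, x)\<close>.\<close>
  have "0 \<le> W (t, x) + 0 - S"
  proof (rule tendsto_lowerbound[OF blim])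
    have "0 \<le> W (t, x) + e (r n) - c (r n)" for n using Wb[of n] W_nonneg[OF \<tau>0[of "r n"], of "\<xi> (r n)"] by linarith
    then show "\<forall>\<^sub>F n in sequentially. 0 \<le> W (t, x) + e (r n) - c (r n)" by simp
  qed simp
  then have "ennreal S + ennreal (W (t, x) - S) = ennreal (W (t, x))" using S by (simp flip: ennreal_plus)
  then have "bolza_cost L \<phi> t g \<le> ennreal (W (t, x))"
    unfolding bolza_cost_def using add_mono[OF lsc phi] by simp
  then show ?thesis using that ac g0 by blast
qed

theorem value_function_eq:
  assumes t: "t > 0"
  shows "ennreal (W (t, x)) = value_function L \<phi> t x"
proof -
  obtain g where g: "absolutely_continuous_on {0..t} g" "g 0 = x" "bolza_cost L \<phi> t g \<le> ennreal (W (t, x))"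
    using optimal_arc[OF t] by blast
  have "ennreal (W (t, x)) = bolza_cost L \<phi> t g"
    using value_le_cost[OF g(1) t] g by (intro antisym) auto
  moreover have "ennreal (W (t, x)) \<le> bolza_cost L \<phi> t y" if "absolutely_continuous_on {0..t} y" "y 0 = x" for y
    using value_le_cost[OF that(1) t] that(2) by simp
  ultimately show ?thesis unfolding value_function_def
    using g(1,2) by (intro Least_equality[symmetric]) blast+
qed

end

theorem theorem1p2:
  fixes \<phi> :: "real ^ 'n \<Rightarrow> ennreal"
    and L :: "real ^ 'n \<Rightarrow> real ^ 'n \<Rightarrow> real"
    and \<Theta> :: "real ^ 'n \<Rightarrow> real"
    and W :: "real \<times> (real ^ 'n) \<Rightarrow> real"
  assumes phi_lsc: "lower_semicontinuous \<phi>"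
    and L_nonneg: "\<And>x u. L x u \<ge> 0"
    and L_locally_bounded: "locally_bounded (\<lambda>(x, u). L x u)"
    and L_lsc: "lower_semicontinuous (\<lambda>(x, u). L x u)"
    and L_convex: "\<And>x. convex_on UNIV (L x)"
    and Theta_nonneg: "\<And>u. \<Theta> u \<ge> 0"
    and Theta_superlinear: "filterlim (\<lambda>u. \<Theta> u / norm u) at_top at_infinity"
    and L_ge_Theta: "\<And>x u. L x u \<ge> \<Theta> u"
    and L_continuous: "continuous_on UNIV (\<lambda>(x, u). L x u)"
    and W_nonneg: "\<And>t x. t > 0 \<Longrightarrow> W (t, x) \<ge> 0"
    and W_continuous: "continuous_on ({0<..} \<times> UNIV) W"
    and W_supersolution: "\<And>t x p\<^sub>t p\<^sub>x. t > 0 \<Longrightarrow> (p\<^sub>t, p\<^sub>x) \<in> subdifferential W (t, x) \<Longrightarrow>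
          ereal p\<^sub>t + hamiltonian L x (- p\<^sub>x) \<ge> 0"
    and W_subsolution: "\<And>t x p\<^sub>t p\<^sub>x. t > 0 \<Longrightarrow> (p\<^sub>t, p\<^sub>x) \<in> superdifferential W (t, x) \<Longrightarrow>
          ereal p\<^sub>t + hamiltonian L x (- p\<^sub>x) \<le> 0"
    and W_derivative_zero: "\<And>t x. t > 0 \<Longrightarrow> contingent_derivative W (t, x) (0, 0) = 0"
    and W_derivative_finite: "\<And>t x. t > 0 \<Longrightarrow> \<exists>u. contingent_derivative W (t, x) (- 1, u) < \<infinity>"
    and W_initial: "\<And>x. Liminf (at_right 0 \<times>\<^sub>F nhds x) (\<lambda>(h, y). ennreal (W (h, y))) = \<phi> x"
  shows "\<forall>t>0. \<forall>x. ennreal (W (t, x)) = value_function L \<phi> t x"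
proof -
  interpret hamilton_jacobi L \<Theta> W \<phi>
    by unfold_locales (fact assms)+
  show ?thesis using value_function_eq by blast
qed

end
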